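(* Let $p$ be an odd prime and $\alpha,\beta,\gamma,\delta,\epsilon\in\mathbb Z_p$. Suppose that (i) $\langle -\alpha\rangle_p\leq\min\{\langle -\beta\rangle_p,\langle -\gamma\rangle_p,\langle -\delta\rangle_p,\langle -\epsilon\rangle_p\}$; (ii) $p+\langle-\alpha\rangle_p>\max\{\langle-\beta\rangle_p+\langle-\gamma\rangle_p+\langle -\delta\rangle_p,\ \min\{\langle-\beta\rangle_p,\langle-\gamma\rangle_p,\langle -\delta\rangle_p\}+\langle-\epsilon\rangle_p\}$; (iii) $(\alpha-\beta+1)_{p-1}$, $(\alpha-\gamma+1)_{p-1}$, $(\alpha-\delta+1)_{p-1}$, $(\alpha-\epsilon+1)_{p-1}$ and $(\beta+\gamma+\delta-\alpha)_{p-1}$ are not divisible by $p^2$. Then $$ {}_7F_6\bigg[\begin{matrix}\alpha&\alpha&\frac12\alpha+1&\beta&\gamma&\delta&\epsilon\\&1&\frac12\alpha&\alpha-\beta+1&\alpha-\gamma+1&\alpha-\delta+1&\alpha-\epsilon+1\end{matrix}\bigg|\,1\bigg]_{p-1} \equiv\big(\alpha+\langle-\alpha\rangle_p\big)\cdot\frac{\Gamma_p(\alpha-\beta+1)\Gamma_p(\alpha-\gamma+1)\Gamma_p(\alpha-\delta+1)\Gamma_p(\alpha-\beta-\gamma-\delta+1)}{\Gamma_p(\alpha+1)\Gamma_p(\alpha-\beta-\gamma+1)\Gamma_p(\alpha-\beta-\delta+1)\Gamma_p(\alpha-\gamma-\delta+1)}\cdot{}_4F_3\bigg[\begin{matrix}1-\epsilon&\beta&\gamma&\delta\\&1&\alpha-\epsilon+1&\beta+\gamma+\delta-\alpha\end{matrix}\bigg|\,1\bigg]_{p-1}\pmod{p^2}.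 $$
   Context: $\mathbb Z_p$ denotes the $p$-adic integers. For $\alpha\in\mathbb Z_p$, $\langle\alpha\rangle_p$ is the unique integer in $\{0,1,\ldots,p-1\}$ congruent to $\alpha$ modulo $p$. Pochhammer symbol: $(x)_0=1$, $(x)_k=x(x+1)\cdots(x+k-1)$. For $n\ge 0$ the truncated hypergeometric series is ${}_{m+1}F_m\Big[\begin{matrix}\alpha_0&\alpha_1&\ldots&\alpha_m\\&\beta_1&\ldots&\beta_m\end{matrix}\Big|\,z\Big]_n=\sum_{k=0}^{n}\frac{(\alpha_0)_k\cdots(\alpha_m)_k}{(\beta_1)_k\cdots(\beta_m)_k}\cdot\frac{z^k}{k!}$. $\Gamma_p$ is Morita's $p$-adic gamma function: $\Gamma_p(n)=(-1)^n\prod_{1\le j<n,\ p\nmid j}j$ for integers $n\ge1$, $\Gamma_p(0)=1$, extended to $\mathbb Z_p$ by continuity. For $x,y\in\mathbb Q_p$, $x\equiv y\pmod{p^2}$ means $x-y\in p^2\mathbb Z_p$.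
   Formalization: Adds that α is not divisible by p (⟨-α⟩_p ≠ 0), since otherwise the left side is ≡ 1 and the right side ≡ 0 mod p (e.g. α=p, β=2p, γ=δ=ε=0), and that (α/2)_{p-1} ≠ 0, so that the 7F6 is defined. *)

theory Defs
  imports
    Complex_Main
    "HOL-Computational_Algebra.Polynomial_Factorial"
    "Berlekamp_Zassenhaus.Finite_Field"
begin

text \<open>
  The prime is carried by a type variable \<open>'p\<close> of class \<open>prime_card\<close>: \<open>p = CARD('p)\<close> is prime, and
  every prime arises in this way. The \<open>p\<close>-adic integers are the inverse limit of the rings
  \<open>\<int>/p^n\<int>\<close>: a \<open>p\<close>-adic integer \<open>x\<close> is the coherent sequence of its residues
  \<open>x n \<in> {0..<p^n}\<close> modulo \<open>p^n\<close> (the range is forced by the coherence condition).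
\<close>

typedef (overloaded) ('p :: prime_card) padic_int =
  "{x :: nat \<Rightarrow> int. \<forall>n. x n = x (Suc n) mod int CARD('p) ^ n}"
  morphisms residue_seq Abs_padic_int
  by (rule exI[of _ "\<lambda>_. 0"]) simp

setup_lifting type_definition_padic_int

lemma prime_card_gt_1: "CARD('p :: prime_card) > 1"
  by (rule prime_gt_1_nat[OF prime_card])

lemma mod_power_Suc_mod: "a mod (b ^ Suc n) mod b ^ n = a mod (b :: int) ^ n"
  by (rule mod_mod_cancel) simp

lemma residue_seq_Suc:
  "residue_seq (x :: 'p :: prime_card padic_int) (Suc n) mod int CARD('p) ^ n = residue_seq x n"
  using residue_seq[of x] unfolding mem_Collect_eq by metis

lemma residue_seq_bounds:
  fixes x :: "'p :: prime_card padic_int"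
  shows "0 \<le> residue_seq x n" "residue_seq x n < int CARD('p) ^ n"
proof -
  have "int CARD('p) ^ n > 0" using prime_card_gt_1[where 'p = 'p] by simp
  then show "0 \<le> residue_seq x n" "residue_seq x n < int CARD('p) ^ n"
    by (metis residue_seq_Suc pos_mod_sign, metis residue_seq_Suc pos_mod_bound)
qed

lemma residue_seq_mod:
  fixes x :: "'p :: prime_card padic_int"
  assumes "m \<le> n"
  shows "residue_seq x n mod int CARD('p) ^ m = residue_seq x m"
  using assms
proof (induction n rule: dec_induct)
  case base
  then show ?case using residue_seq_bounds[of x m] by simp
next
  case (step n)
  have "residue_seq x (Suc n) mod int CARD('p) ^ m
      = residue_seq x (Suc n) mod int CARD('p) ^ n mod int CARD('p) ^ m"
    using step by (simp add: mod_mod_cancel le_imp_power_dvd)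
  then show ?case using step by (simp add: residue_seq_Suc)
qed

lemma residue_seq_mod_self [simp]:
  "residue_seq (x :: 'p :: prime_card padic_int) n mod int CARD('p) ^ n = residue_seq x n"
  by (rule residue_seq_mod) simp

lemma padic_int_eqI:
  "(\<And>n. residue_seq x n = residue_seq y n) \<Longrightarrow> x = (y :: 'p :: prime_card padic_int)"
  by (metis residue_seq_inject ext)

instantiation padic_int :: (prime_card) comm_ring_1
begin

lift_definition zero_padic_int :: "'a padic_int" is "\<lambda>_. 0" by simp

lift_definition one_padic_int :: "'a padic_int" is "\<lambda>n. 1 mod int CARD('a) ^ n"
  by (rule mod_power_Suc_mod[symmetric])

lift_definition plus_padic_int :: "'a padic_int \<Rightarrow> 'a padic_int \<Rightarrow> 'a padic_int"
  is "\<lambda>x y n. (x n + y n) mod int CARD('a) ^ n"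
  by (unfold mod_power_Suc_mod) (metis mod_add_eq)

lift_definition uminus_padic_int :: "'a padic_int \<Rightarrow> 'a padic_int"
  is "\<lambda>x n. (- x n) mod int CARD('a) ^ n"
  by (unfold mod_power_Suc_mod) (metis mod_minus_eq)

lift_definition minus_padic_int :: "'a padic_int \<Rightarrow> 'a padic_int \<Rightarrow> 'a padic_int"
  is "\<lambda>x y n. (x n - y n) mod int CARD('a) ^ n"
  by (unfold mod_power_Suc_mod) (metis mod_diff_eq)

lift_definition times_padic_int :: "'a padic_int \<Rightarrow> 'a padic_int \<Rightarrow> 'a padic_int"
  is "\<lambda>x y n. (x n * y n) mod int CARD('a) ^ n"
  by (unfold mod_power_Suc_mod) (metis mod_mult_eq)

instance
proof
  fix a b c :: "'a padic_int"
  note rep = zero_padic_int.rep_eq one_padic_int.rep_eq plus_padic_int.rep_eq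
    uminus_padic_int.rep_eq minus_padic_int.rep_eq times_padic_int.rep_eq
  show "a * b * c = a * (b * c)"
    by (rule padic_int_eqI) (simp add: rep mod_simps mult.assoc)
  show "a * b = b * a"
    by (rule padic_int_eqI) (simp add: rep mult.commute)
  show "1 * a = a"
    by (rule padic_int_eqI) (simp add: rep mod_simps)
  show "a + b + c = a + (b + c)"
    by (rule padic_int_eqI) (simp add: rep mod_simps add.assoc)
  show "a + b = b + a"
    by (rule padic_int_eqI) (simp add: rep add.commute)
  show "0 + a = a"
    by (rule padic_int_eqI) (simp add: rep)
  show "- a + a = 0"
    by (rule padic_int_eqI) (simp add: rep mod_simps)
  show "a - b = a + - b"
    by (rule padic_int_eqI) (simp add: rep mod_simps)
  show "(a + b) * c = a * c + b * c"
    by (rule padic_int_eqI) (simp add: rep mod_simps distrib_right)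
  have "residue_seq (0 :: 'a padic_int) 1 \<noteq> residue_seq (1 :: 'a padic_int) 1"
    using prime_card_gt_1[where 'p = 'a] by (simp add: zero_padic_int.rep_eq one_padic_int.rep_eq)
  then show "(0 :: 'a padic_int) \<noteq> 1" by metis
qed

end

lemma residue_seq_of_nat:
  "residue_seq (of_nat m :: 'p :: prime_card padic_int) n = int m mod int CARD('p) ^ n"
  by (induction m)
     (simp_all add: zero_padic_int.rep_eq plus_padic_int.rep_eq one_padic_int.rep_eq mod_simps)

instance padic_int :: (prime_card) idom
proof
  fix x y :: "'a padic_int"
  assume "x \<noteq> 0" "y \<noteq> 0"
  then obtain i j where ij: "residue_seq x i \<noteq> 0" "residue_seq y j \<noteq> 0"
    by (metis padic_int_eqI zero_padic_int.rep_eq)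
  let ?p = "int CARD('a)" and ?n = "i + j"
  have ndvd: "\<not> ?p ^ i dvd residue_seq x ?n" "\<not> ?p ^ j dvd residue_seq y ?n"
    using ij residue_seq_mod[of i ?n x] residue_seq_mod[of j ?n y] by (auto simp: dvd_eq_mod_eq_0)
  show "x * y \<noteq> 0"
  proof
    assume "x * y = 0"
    then have "(residue_seq x ?n * residue_seq y ?n) mod ?p ^ ?n = 0"
      by (metis times_padic_int.rep_eq zero_padic_int.rep_eq)
    then have "?p ^ ?n dvd residue_seq x ?n * residue_seq y ?n" by (simp add: dvd_eq_mod_eq_0)
    then obtain k l where kl: "k + l = ?n" "?p ^ k dvd residue_seq x ?n" "?p ^ l dvd residue_seq y ?n"
      using prime_elem_power_dvd_prod[OF _ prime_imp_prime_elem[OF prime_card_int[where 'a = 'a]]]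
      by blast
    then have "i \<le> k \<or> j \<le> l" by linarith
    then show False using kl ndvd by (meson dvd_trans le_imp_power_dvd)
  qed
qed

instance padic_int :: (prime_card) ring_char_0
proof
  show "inj (of_nat :: nat \<Rightarrow> 'a padic_int)"
  proof (rule injI)
    fix m n :: nat
    assume eq: "(of_nat m :: 'a padic_int) = of_nat n"
    let ?k = "m + n"
    have "?k < 2 ^ ?k" by (rule less_exp)
    also have "2 ^ ?k \<le> CARD('a) ^ ?k" using prime_card_gt_1[where 'p = 'a] by (simp add: power_mono)
    finally have lt: "int m < int CARD('a) ^ ?k" "int n < int CARD('a) ^ ?k"
      by (simp_all flip: of_nat_power)
    have "int m mod int CARD('a) ^ ?k = int n mod int CARD('a) ^ ?k"
      using eq residue_seq_of_nat[where 'p = 'a] by metis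
    then show "m = n" using lt by simp
  qed
qed

text \<open>
  The \<open>p\<close>-adic metric \<open>dist x y = p ^ (- v)\<close>, where \<open>v\<close> is the largest exponent with
  \<open>x \<equiv> y (mod p ^ v)\<close>, that is, the least \<open>v\<close> such that \<open>x\<close> and \<open>y\<close> differ modulo \<open>p ^ Suc v\<close>.
\<close>

instantiation padic_int :: (prime_card) metric_space
begin

definition dist_padic_int :: "'a padic_int \<Rightarrow> 'a padic_int \<Rightarrow> real" where
  "dist_padic_int x y =
     (if x = y then 0
      else 1 / real CARD('a) ^ (LEAST v. residue_seq x (Suc v) \<noteq> residue_seq y (Suc v)))"

definition uniformity_padic_int :: "('a padic_int \<times> 'a padic_int) filter" where
  "uniformity_padic_int = (INF e\<in>{0 <..}. principal {(x, y). dist x y < e})"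

definition open_padic_int :: "'a padic_int set \<Rightarrow> bool" where
  "open_padic_int U = (\<forall>x\<in>U. eventually (\<lambda>(x', y). x' = x \<longrightarrow> y \<in> U) uniformity)"

instance
proof
  show "(uniformity :: ('a padic_int \<times> 'a padic_int) filter)
      = (INF e\<in>{0 <..}. principal {(x, y). dist x y < e})"
    by (rule uniformity_padic_int_def)
  show "open U = (\<forall>x\<in>U. eventually (\<lambda>(x', y). x' = x \<longrightarrow> y \<in> U) uniformity)"
    for U :: "'a padic_int set"
    by (rule open_padic_int_def)
  fix x y z :: "'a padic_int"
  have p: "real CARD('a) > 1" using prime_card_gt_1[where 'p = 'a] by simp
  show "dist x y = 0 \<longleftrightarrow> x = y" using p by (simp add: dist_padic_int_def)
  have least: "residue_seq a (Suc (LEAST v. residue_seq a (Suc v) \<noteq> residue_seq b (Suc v)))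
      \<noteq> residue_seq b (Suc (LEAST v. residue_seq a (Suc v) \<noteq> residue_seq b (Suc v)))"
    if "a \<noteq> b" for a b :: "'a padic_int"
  proof -
    have "\<exists>n. residue_seq a n \<noteq> residue_seq b n"
      using that by (metis residue_seq_inject ext)
    then obtain n where n: "residue_seq a n \<noteq> residue_seq b n" by blast
    moreover have "n \<noteq> 0" using n residue_seq_bounds[of a 0] residue_seq_bounds[of b 0]
      by (cases n) auto
    ultimately have "\<exists>v. residue_seq a (Suc v) \<noteq> residue_seq b (Suc v)" by (metis not0_implies_Suc)
    then show ?thesis by (rule LeastI_ex)
  qed
  have nonneg: "dist a b \<ge> 0" for a b :: "'a padic_int"
    by (simp add: dist_padic_int_def)
  have sym: "dist a b = dist b a" for a b :: "'a padic_int"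
    unfolding dist_padic_int_def by (subst (1 2) eq_commute) (rule refl)
  show "dist x y \<le> dist x z + dist y z"
  proof (cases "x = y \<or> x = z \<or> y = z")
    case True
    then consider "x = y" | "x = z" | "y = z" by blast
    then show ?thesis
    proof cases
      case 1
      then have "dist x y = 0" by (simp add: dist_padic_int_def)
      then show ?thesis using nonneg[of x z] nonneg[of y z] by linarith
    next
      case 2
      then show ?thesis using nonneg[of x z] sym[of x y] by simp
    next
      case 3
      then show ?thesis using nonneg[of y z] by simp
    qed
  next
    case False
    let ?L = "\<lambda>a b. LEAST v. residue_seq a (Suc v) \<noteq> residue_seq (b :: 'a padic_int) (Suc v)"
    have "residue_seq x (Suc (?L x y)) \<noteq> residue_seq z (Suc (?L x y))
        \<or> residue_seq y (Suc (?L x y)) \<noteq> residue_seq z (Suc (?L x y))"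
      using least[of x y] False by metis
    then have "?L x z \<le> ?L x y \<or> ?L y z \<le> ?L x y"
      by (blast intro: Least_le)
    moreover have "1 / real CARD('a) ^ n \<le> 1 / real CARD('a) ^ m" if "m \<le> n" for m n
      using p that by (intro divide_left_mono power_increasing mult_pos_pos zero_less_power) simp_all
    ultimately have "1 / real CARD('a) ^ ?L x y \<le> 1 / real CARD('a) ^ ?L x z
        \<or> 1 / real CARD('a) ^ ?L x y \<le> 1 / real CARD('a) ^ ?L y z"
      by blast
    then have "dist x y \<le> dist x z \<or> dist x y \<le> dist y z"
      using False by (simp add: dist_padic_int_def)
    then show ?thesis using nonneg[of x z] nonneg[of y z] by linarith
  qed
qed

end

text \<open>The field \<open>\<rat>\<^sub>p\<close> is the fraction field of \<open>\<int>\<^sub>p\<close>; the embedding \<open>\<int>\<^sub>p \<rightarrow> \<rat>\<^sub>p\<close> is \<^const>\<open>to_fract\<close>.\<close>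

type_synonym 'p padic = "'p padic_int fract"

instance fract :: ("{idom, ring_char_0}") field_char_0
proof
  have "of_nat n = (to_fract (of_nat n) :: 'a fract)" for n
    by (induction n) simp_all
  then show "inj (of_nat :: nat \<Rightarrow> 'a fract)"
    by (simp add: inj_def)
qed

text \<open>Congruence modulo \<open>p ^ k\<close> in \<open>\<rat>\<^sub>p\<close>: the difference lies in \<open>p ^ k \<int>\<^sub>p\<close>.\<close>

definition padic_cong :: "nat \<Rightarrow> 'p :: prime_card padic \<Rightarrow> 'p padic \<Rightarrow> bool" where
  "padic_cong k x y \<longleftrightarrow> (\<exists>z. x - y = of_nat (CARD('p) ^ k) * to_fract z)"

definition padic_residue :: "'p :: prime_card padic_int \<Rightarrow> nat" where
  "padic_residue x = (THE r. r < CARD('p) \<and> of_nat CARD('p) dvd x - of_nat r)"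

lemma of_nat_CARD_dvd_iff:
  fixes x :: "'p :: prime_card padic_int"
  shows "of_nat CARD('p) dvd x \<longleftrightarrow> residue_seq x 1 = 0"
proof
  let ?p = "int CARD('p)"
  assume "of_nat CARD('p) dvd x"
  then obtain y where "x = of_nat CARD('p) * y" by (rule dvdE)
  then show "residue_seq x 1 = 0"
    by (simp add: times_padic_int.rep_eq residue_seq_of_nat)
next
  let ?p = "int CARD('p)"
  assume x1: "residue_seq x 1 = 0"
  have p: "?p > 0" using prime_card_gt_1[where 'p = 'p] by simp
  define y where "y n = residue_seq x (Suc n) div ?p" for n
  have dvd: "?p dvd residue_seq x (Suc n)" for n
    using residue_seq_mod[of 1 "Suc n" x] x1 by (simp add: dvd_eq_mod_eq_0)
  have "y n = y (Suc n) mod ?p ^ n" for n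
  proof -
    have "?p * y n = (?p * y (Suc n)) mod (?p * ?p ^ n)"
      using residue_seq_mod[of "Suc n" "Suc (Suc n)" x] dvd by (simp add: y_def)
    also have "\<dots> = ?p * (y (Suc n) mod ?p ^ n)" by (rule mult_mod_right[symmetric])
    finally show ?thesis using p by simp
  qed
  then have rep: "residue_seq (Abs_padic_int y :: 'p padic_int) = y"
    by (intro Abs_padic_int_inverse CollectI allI)
  have "residue_seq x n = residue_seq (of_nat CARD('p) * (Abs_padic_int y :: 'p padic_int)) n" for n
  proof -
    have "residue_seq (of_nat CARD('p) * (Abs_padic_int y :: 'p padic_int)) n = (?p * y n) mod ?p ^ n"
      by (simp add: times_padic_int.rep_eq residue_seq_of_nat rep mod_simps)
    also have "?p * y n = residue_seq x (Suc n)" using dvd by (simp add: y_def)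
    finally show ?thesis by (simp only: residue_seq_Suc)
  qed
  then have "x = of_nat CARD('p) * Abs_padic_int y" by (intro padic_int_eqI)
  then show "of_nat CARD('p) dvd x" by (rule dvdI)
qed

lemma padic_residue_ex1:
  "\<exists>!r. r < CARD('p) \<and> of_nat CARD('p) dvd (x :: 'p :: prime_card padic_int) - of_nat r"
proof -
  have "of_nat CARD('p) dvd x - of_nat r \<longleftrightarrow> residue_seq x 1 = int r" if "r < CARD('p)" for r
  proof -
    have bounds: "0 \<le> residue_seq x 1" "residue_seq x 1 < int CARD('p)"
      using residue_seq_bounds[of x 1] by simp_all
    have "residue_seq (x - of_nat r) 1 = (residue_seq x 1 - int r) mod int CARD('p)"
      by (simp add: minus_padic_int.rep_eq residue_seq_of_nat mod_simps)
    also have "\<dots> = 0 \<longleftrightarrow> residue_seq x 1 mod int CARD('p) = int r mod int CARD('p)"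
      by (simp add: mod_eq_dvd_iff dvd_eq_mod_eq_0)
    also have "\<dots> \<longleftrightarrow> residue_seq x 1 = int r" using bounds that by simp
    finally show ?thesis by (simp add: of_nat_CARD_dvd_iff)
  qed
  moreover have "nat (residue_seq x 1) < CARD('p)" "int (nat (residue_seq x 1)) = residue_seq x 1"
    using residue_seq_bounds[of x 1] by simp_all
  ultimately show ?thesis by (metis of_nat_eq_iff)
qed

text \<open>
  As \<open>x / 0 = 0\<close>, the following is the intended sum only if \<open>pochhammer b n \<noteq> 0\<close> for all
  \<open>b \<in> set bs\<close>.
\<close>

definition truncated_hypergeometric ::
  "'a :: field_char_0 list \<Rightarrow> 'a list \<Rightarrow> 'a \<Rightarrow> nat \<Rightarrow> 'a"
  where
  "truncated_hypergeometric as bs z n =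
     (\<Sum>k\<le>n. (\<Prod>a\<leftarrow>as. pochhammer a k) / (\<Prod>b\<leftarrow>bs. pochhammer b k) * (z ^ k / fact k))"

definition Gamma_padic_nat :: "nat \<Rightarrow> nat \<Rightarrow> int" where
  "Gamma_padic_nat p n = (- 1) ^ n * (\<Prod>j | 1 \<le> j \<and> j < n \<and> \<not> p dvd j. int j)"

text \<open>
  The unique continuous extension from \<open>\<nat>\<close>, which is dense in \<open>\<int>\<^sub>p\<close>. At \<open>n = 0\<close> the formula
  of \<^const>\<open>Gamma_padic_nat\<close> has an empty product and gives the value \<open>1\<close>.
\<close>

definition Gamma_padic :: "'p :: prime_card padic_int \<Rightarrow> 'p padic_int" where
  "Gamma_padic = (THE f. continuous_on UNIV f \<and>
     (\<forall>n. f (of_nat n) = of_int (Gamma_padic_nat CARD('p) n)))"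

end

theory Submission
  imports Defs "HOL-Number_Theory.Number_Theory"
begin

text \<open>
  Write \<open>a, b, c, d, e\<close> for the residues of \<open>-\<alpha>, \<dots>, -\<epsilon>\<close> and \<open>S(x, y)\<close> for the series with its first
  two parameters set to \<open>x\<close> and \<open>y\<close>, cut off at \<open>k = a\<close>. Conditions (i)-(iii) pair the parameters so
  that the terms with \<open>k > a\<close> vanish modulo \<open>p\<^sup>2\<close>. Since \<open>S\<close> is well-poised, its terms are antisymmetric
  under \<open>k \<mapsto> a - k\<close> when \<open>x = -a\<close>, so \<open>S(-a, y) = 0\<close> for all values of the other parameters. Modulo
  \<open>p\<^sup>2\<close> the sum is affine in \<open>p\<close>-adic perturbations of its parameters; hence it equals
  \<open>(\<alpha> + a) / p\<close> times its value at the integer point \<open>x = p - a\<close>, \<open>y = -a\<close>, \<open>\<beta> = -b\<close>, and so on. There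
  Whipple's transformation of a terminating very-well-poised \<open>\<^sub>7F\<^sub>6\<close> applies exactly, and the result
  carries a factor \<open>p\<close>, so that the remaining comparison with the Gamma quotient and the \<open>\<^sub>4F\<^sub>3\<close> takes
  place modulo \<open>p\<close>, where Gamma values are factorials.
\<close>

section \<open>Terminating well-poised hypergeometric series\<close>

text \<open>The parameter \<alpha> occurs twice, and its two copies are perturbed independently:
  antisymmetry needs only the well-poised base \<open>x\<close> at -a, while the other copy
  \<open>y\<close> may stay at -a and cut the series off. One evaluation at x = p - a thus replaces
  any derivative. The affine argument covers only k \<le> a, where all denominators are units;
  beyond a they may contain one factor p, and the tail needs its own estimate. Whipple's formula is
  applied with length d rather than a: -d is the terminating parameter and -a is grouped with -e,
  since 1 + (p - a) + a + e and 1 + (p - a) + a reduce modulo p to the parameters 1 - \<epsilon> and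
  1 of the 4F3. The factor p is the single multiple of p among p - a + 1, ..., p - a + d, present
  because 1 \<le> a \<le> d < p. Condition (ii) bounds e only together with the smallest of b, c, d;
  both sides being symmetric in \<beta>, \<gamma>, \<delta>, that smallest residue is taken to be
  d.\<close>

text \<open>The Pfaff-Saalschutz sum with its denominators cleared, hence valid in every commutative
  ring. Both sides satisfy the same first-order recurrence in n; for the left side this is a
  creative telescoping identity.\<close>

lemma saalschutz_polynomial:
  fixes A B C :: "'a :: comm_ring_1"
  shows "(\<Sum>j\<le>n. of_nat (n choose j) * pochhammer A j * pochhammer B j
            * pochhammer (C + of_nat j) (n - j) * pochhammer (C - A - B) (n - j))
    = pochhammer (C - A) n * pochhammer (C - B) n"
proof (induction n)
  case 0
  show ?case by simp
next
  case (Suc n)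
  define T where "T m j = of_nat (m choose j) * pochhammer A j * pochhammer B j
      * pochhammer (C + of_nat j) (m - j) * pochhammer (C - A - B) (m - j)" for m j :: nat
  \<comment> \<open>Telescoping certificate: \<open>T (n + 1) - E T n\<close> is a difference of consecutive values of \<open>G\<close>.\<close>
  define G where "G j = of_nat (n choose j) * pochhammer A (Suc j) * pochhammer B (Suc j)
      * pochhammer (C + of_nat j) (n - j) * pochhammer (C - A - B) (n - j)" for j
  \<comment> \<open>The ratio of the right-hand sides at n + 1 and at n.\<close>
  define E where "E = (C - A + of_nat n) * (C - B + of_nat n)"
  have step0: "T (Suc n) 0 = E * T n 0 - G 0"
    by (simp add: T_def G_def E_def pochhammer_Suc algebra_simps)
  have step: "T (Suc n) (Suc i) = E * T n (Suc i) - G (Suc i) + G i" if "i \<le> n" for i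
  proof (cases "i = n")
    case True
    then show ?thesis by (simp add: T_def G_def binomial_eq_0)
  next
    case False
    with that have "i < n" by simp
    then obtain l where l: "n = Suc (i + l)" using less_imp_Suc_add by blast
    have absorb: "of_nat (n choose Suc i) * of_nat (Suc i) = of_nat (n choose i) * (of_nat (Suc l) :: 'a)"
    proof -
      have "(n choose Suc i) * Suc i = (n choose i) * Suc l"
        using binomial_absorb_comp[of n i] binomial_absorption[of i n] l
        by (simp add: mult.commute Suc_diff_le)
      then show ?thesis by (metis of_nat_mult)
    qed
    define X Y where "X = (of_nat (n choose i) :: 'a)" and "Y = (of_nat (n choose Suc i) :: 'a)"
    define q r where "q = pochhammer (C + of_nat (Suc i)) l" and "r = pochhammer (C - A - B) l"
    define u v where "u = pochhammer A (Suc i)" and "v = pochhammer B (Suc i)"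
    have XY: "Y * (of_nat i + 1) = X * (of_nat l + 1)"
      using absorb by (simp add: X_def Y_def add.commute)
    \<comment> \<open>What remains of the recurrence once the common factor
      \<open>u * v * q * r\<close> is taken out. Pascal's rule has produced X + Y, and
      \<open>XY\<close> is the relation between the two binomial coefficients that closes the
      computation.\<close>
    have bracket: "(X + Y) * (C + 1 + of_nat i + of_nat l) * (C - A - B + of_nat l)
        = E * Y - Y * (A + of_nat i + 1) * (B + of_nat i + 1) + X * (C + of_nat i) * (C - A - B + of_nat l)"
    proof -
      have *: "(C + 1 + of_nat i + of_nat l) * (C - A - B + of_nat l)
          = E - (A + of_nat i + 1) * (B + of_nat i + 1) - (of_nat i + 1) * (C - A - B + of_nat l)"
        by (simp add: E_def l algebra_simps)
      have dist: "(X + Y) * P * Q = Y * (P * Q) + X * P * Q" for P Q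
        by (simp add: algebra_simps)
      have "(X + Y) * (C + 1 + of_nat i + of_nat l) * (C - A - B + of_nat l)
        = Y * ((C + 1 + of_nat i + of_nat l) * (C - A - B + of_nat l))
          + X * (C + 1 + of_nat i + of_nat l) * (C - A - B + of_nat l)"
        by (rule dist)
      also have "\<dots> = Y * (E - (A + of_nat i + 1) * (B + of_nat i + 1)) - (Y * (of_nat i + 1)) * (C - A - B + of_nat l)
          + X * (C + 1 + of_nat i + of_nat l) * (C - A - B + of_nat l)"
        unfolding * by (simp only: right_diff_distrib mult.assoc)
      also have "\<dots> = E * Y - Y * (A + of_nat i + 1) * (B + of_nat i + 1) + X * (C + of_nat i) * (C - A - B + of_nat l)"
        unfolding XY by (simp add: algebra_simps)
      finally show ?thesis .
    qed
    have 1: "T (Suc n) (Suc i) = u * v * q * r * ((X + Y) * (C + 1 + of_nat i + of_nat l) * (C - A - B + of_nat l))"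
      by (simp add: T_def u_def v_def q_def r_def X_def Y_def l pochhammer_Suc[of _ l] ac_simps)
    have 2: "T n (Suc i) = u * v * q * r * Y"
      by (simp add: T_def u_def v_def q_def r_def Y_def l ac_simps)
    have 3: "G (Suc i) = u * v * q * r * (Y * (A + of_nat i + 1) * (B + of_nat i + 1))"
      by (simp add: G_def u_def v_def q_def r_def Y_def l pochhammer_Suc[of _ "Suc i"] ac_simps)
    have 4: "G i = u * v * q * r * (X * (C + of_nat i) * (C - A - B + of_nat l))"
    proof -
      have "pochhammer (C + of_nat i) (Suc l) = (C + of_nat i) * q"
        by (simp add: q_def pochhammer_rec ac_simps)
      moreover have "pochhammer (C - A - B) (Suc l) = r * (C - A - B + of_nat l)"
        by (simp add: r_def pochhammer_Suc)
      ultimately show ?thesis by (simp add: G_def u_def v_def X_def l Suc_diff_le ac_simps)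
    qed
    show ?thesis unfolding 1 2 3 4 bracket by (simp add: algebra_simps)
  qed
  have "(\<Sum>j\<le>Suc n. T (Suc n) j) = T (Suc n) 0 + (\<Sum>i\<le>n. T (Suc n) (Suc i))"
    by (rule sum.atMost_Suc_shift)
  also have "\<dots> = E * T n 0 - G 0 + (\<Sum>i\<le>n. E * T n (Suc i) - G (Suc i) + G i)"
    using step step0 by simp
  also have "\<dots> = E * (T n 0 + (\<Sum>i\<le>n. T n (Suc i))) - (G 0 + (\<Sum>i\<le>n. G (Suc i))) + (\<Sum>i\<le>n. G i)"
    by (simp add: sum.distrib sum_subtractf sum_distrib_left algebra_simps)
  also have "\<dots> = E * (\<Sum>i\<le>Suc n. T n i) - (\<Sum>i\<le>Suc n. G i) + (\<Sum>i\<le>n. G i)"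
    by (simp only: sum.atMost_Suc_shift)
  also have "\<dots> = E * (\<Sum>i\<le>n. T n i)"
    by (simp add: T_def G_def binomial_eq_0)
  also have "\<dots> = pochhammer (C - A) (Suc n) * pochhammer (C - B) (Suc n)"
    using Suc by (simp add: T_def E_def pochhammer_Suc)
  finally show ?case by (simp add: T_def)
qed

text \<open>The series is summable in closed form up to every cutoff: the induction step checks that
  the summand is the difference of the right-hand side. \<open>N\<close> is independent of the
  cutoff m; setting N = m afterwards turns the sum into a Kronecker delta.\<close>

lemma well_poised_partial_sum:
  fixes A N :: "'a :: field_char_0"
  assumes "A \<noteq> 0" "pochhammer (1 + A + N) m \<noteq> 0"
  shows "(\<Sum>i\<le>m. pochhammer A i * (A + 2 * of_nat i) / A * pochhammer (- N) i
            / (fact i * pochhammer (1 + A + N) i))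
    = pochhammer (A + 1) m * pochhammer (1 - N) m / (fact m * pochhammer (1 + A + N) m)"
  using assms(2)
proof (induction m)
  case 0
  show ?case using assms(1) by simp
next
  case (Suc m)
  have nz: "pochhammer (1 + A + N) m \<noteq> 0" "1 + A + N + of_nat m \<noteq> 0"
    using Suc.prems by (auto simp: pochhammer_Suc)
  have A1: "pochhammer A (Suc m) / A = pochhammer (A + 1) m" using assms(1) by (simp add: pochhammer_rec)
  have N1: "pochhammer (- N) (Suc m) = - N * pochhammer (1 - N) m" by (simp add: pochhammer_rec)
  have "pochhammer A (Suc m) * (A + 2 * of_nat (Suc m)) / A * pochhammer (- N) (Suc m)
            / (fact (Suc m) * pochhammer (1 + A + N) (Suc m))
     = pochhammer (A + 1) m * (A + 2 * of_nat (Suc m)) * (- N * pochhammer (1 - N) m)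
            / (fact (Suc m) * pochhammer (1 + A + N) (Suc m))"
    by (simp only: A1[symmetric] N1) (simp add: field_simps)
  then show ?case
    using Suc.IH[OF nz(1)] nz of_nat_neq_0[of m, where 'a='a]
    apply (simp add: pochhammer_Suc[of "A+1"] pochhammer_Suc[of "1-N"] pochhammer_Suc[of "1+A+N"] fact_Suc del: of_nat_Suc)
    apply (simp add: divide_simps del: of_nat_Suc)
    apply (simp add: algebra_simps)
    done
qed

text \<open>The balance condition ties D to E = C - A - B by D = 1 - E - n, so reversing a product
  turns (E)_n into (E)_(n-j) times (D)_j up to sign. Multiplication by (C)_n (E)_n then gives the
  division-free form.\<close>

lemma saalschutz:
  fixes A B C D :: "'a :: field_char_0"
  assumes "C + D = 1 + A + B - of_nat n" "pochhammer C n \<noteq> 0" "pochhammer D n \<noteq> 0"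
  shows "(\<Sum>j\<le>n. pochhammer (- of_nat n) j * pochhammer A j * pochhammer B j
            / (fact j * pochhammer C j * pochhammer D j))
    = pochhammer (C - A) n * pochhammer (C - B) n / (pochhammer C n * pochhammer (C - A - B) n)"
proof -
  define E where "E = C - A - B"
  have D: "D = 1 - E - of_nat n" using assms(1) by (simp add: E_def algebra_simps)
  have Dn: "pochhammer D n = (- 1) ^ n * pochhammer E n"
    using pochhammer_minus[of "E + of_nat n - 1" n] by (simp add: D algebra_simps)
  then have E0: "pochhammer E n \<noteq> 0" using assms(3) by auto
  have "pochhammer (- of_nat n) j * pochhammer A j * pochhammer B j
            / (fact j * pochhammer C j * pochhammer D j) * (pochhammer C n * pochhammer E n)
      = of_nat (n choose j) * pochhammer A j * pochhammer B j
            * pochhammer (C + of_nat j) (n - j) * pochhammer E (n - j)" if j: "j \<le> n" for j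
  proof -
    have 1: "pochhammer (- of_nat n :: 'a) j = (- 1) ^ j * fact j * of_nat (n choose j)"
      using j by (simp add: binomial_gbinomial gbinomial_pochhammer)
    have 2: "pochhammer C n = pochhammer C j * pochhammer (C + of_nat j) (n - j)"
      by (rule pochhammer_product[OF j])
    have 3: "pochhammer E n = pochhammer E (n - j) * ((- 1) ^ j * pochhammer D j)"
    proof -
      have "pochhammer E n = pochhammer E (n - j) * pochhammer (E + of_nat (n - j)) j"
        using pochhammer_product[of "n - j" n E] j by simp
      moreover have "pochhammer D j = (- 1) ^ j * pochhammer (E + of_nat (n - j)) j"
        using pochhammer_minus[of "E + of_nat n - 1" j] j by (simp add: D of_nat_diff algebra_simps)
      ultimately show ?thesis by (simp add: power_mult_distrib[symmetric])
    qed
    have "pochhammer C j \<noteq> 0" "pochhammer D j \<noteq> 0"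
      using assms(2,3) j pochhammer_eq_0_mono by blast+
    then show ?thesis unfolding 1 2 3 by simp
  qed
  then have "(\<Sum>j\<le>n. pochhammer (- of_nat n) j * pochhammer A j * pochhammer B j
            / (fact j * pochhammer C j * pochhammer D j)) * (pochhammer C n * pochhammer E n)
      = pochhammer (C - A) n * pochhammer (C - B) n"
    unfolding sum_distrib_right saalschutz_polynomial[symmetric] E_def[symmetric]
    by (intro sum.cong refl) (simp only: atMost_iff)
  then show ?thesis using assms(2) E0 by (simp add: E_def field_simps)
qed

section \<open>Bailey's interchange of summation and Whipple's transformation\<close>

lemma sum_triangle_shift:
  fixes f :: "nat \<Rightarrow> nat \<Rightarrow> 'a :: comm_monoid_add"
  shows "(\<Sum>k\<le>n. \<Sum>j\<le>k. f k j) = (\<Sum>j\<le>n. \<Sum>i\<le>n - j. f (i + j) j)"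
proof -
  have "(\<Sum>k\<le>n. \<Sum>j\<le>k. f k j) = (\<Sum>(k, j)\<in>(SIGMA k:{..n}. {..k}). f k j)"
    by (rule sum.Sigma) auto
  also have "\<dots> = (\<Sum>(j, i)\<in>(SIGMA j:{..n}. {..n - j}). f (i + j) j)"
    by (rule sum.reindex_bij_witness[where i = "\<lambda>(j, i). (i + j, j)" and j = "\<lambda>(k, j). (j, k - j)"]) auto
  also have "\<dots> = (\<Sum>j\<le>n. \<Sum>i\<le>n - j. f (i + j) j)"
    by (rule sum.Sigma[symmetric]) auto
  finally show ?thesis .
qed

text \<open>With k = i + j, the product (x)_k (x + k)_j depends on i + 2j only and splits as
  (x)_(2j) (x + 2j)_i, so the inner sum over i is again very-well-poised, now with base x + 2j.
  \<open>u\<close> and \<open>r\<close> are arbitrary: each application decides which parameters are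
  expanded and which stay inside.\<close>

lemma bailey_interchange:
  fixes x :: "'a :: field_char_0" and u r :: "nat \<Rightarrow> 'a"
  assumes nz: "\<And>j. j \<le> n \<Longrightarrow> x + 2 * of_nat j \<noteq> 0"
  shows "(\<Sum>k\<le>n. pochhammer x k * (x + 2 * of_nat k) / x * u k / fact k
            * (\<Sum>j\<le>k. pochhammer (- of_nat k) j * pochhammer (x + of_nat k) j * r j))
    = (\<Sum>j\<le>n. r j * (- 1) ^ j * pochhammer x (Suc (2 * j)) / x
        * (\<Sum>i\<le>n - j. pochhammer (x + 2 * of_nat j) i * (x + 2 * of_nat j + 2 * of_nat i)
            / (x + 2 * of_nat j) * u (i + j) / fact i))"
proof -
  have eq: "pochhammer x (i + j) * (x + 2 * of_nat (i + j)) / x * u (i + j) / fact (i + j)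
        * (pochhammer (- of_nat (i + j)) j * pochhammer (x + of_nat (i + j)) j * r j)
      = r j * (- 1) ^ j * pochhammer x (Suc (2 * j)) / x
        * (pochhammer (x + 2 * of_nat j) i * (x + 2 * of_nat j + 2 * of_nat i)
            / (x + 2 * of_nat j) * u (i + j) / fact i)" if j: "j \<le> n" for i j
  proof -
    have 1: "pochhammer (- of_nat (i + j) :: 'a) j = (- 1) ^ j * pochhammer (1 + of_nat i) j"
      using pochhammer_minus[of "of_nat (i + j) :: 'a" j] by (simp add: add.commute)
    have 2: "fact (i + j) = (fact i * pochhammer (1 + of_nat i) j :: 'a)"
      unfolding pochhammer_fact by (rule pochhammer_product')
    have 3: "pochhammer x (i + j) * pochhammer (x + of_nat (i + j)) j = pochhammer x (2 * j) * pochhammer (x + 2 * of_nat j) i"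
    proof -
      have "i + j + j = 2 * j + i" by simp
      then show ?thesis
        using pochhammer_product'[of x "i + j" j] pochhammer_product'[of x "2 * j" i]
        by (simp only: of_nat_mult of_nat_numeral)
    qed
    have 4: "pochhammer x (Suc (2 * j)) = pochhammer x (2 * j) * (x + 2 * of_nat j)"
      by (simp add: pochhammer_Suc)
    have 5: "pochhammer (1 + of_nat i :: 'a) j \<noteq> 0"
    proof -
      have "fact (i + j) \<noteq> (0 :: 'a)" by simp
      then show ?thesis unfolding 2 by simp
    qed
    have "pochhammer x (i + j) * (x + 2 * of_nat (i + j)) / x * u (i + j) / fact (i + j)
        * (pochhammer (- of_nat (i + j)) j * pochhammer (x + of_nat (i + j)) j * r j)
      = (pochhammer x (i + j) * pochhammer (x + of_nat (i + j)) j) * (x + 2 * of_nat (i + j)) / x * u (i + j) * r j * (- 1) ^ j / fact i"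
      unfolding 1 2 using 5 by simp
    also have "\<dots> = r j * (- 1) ^ j * pochhammer x (Suc (2 * j)) / x
        * (pochhammer (x + 2 * of_nat j) i * (x + 2 * of_nat j + 2 * of_nat i)
            / (x + 2 * of_nat j) * u (i + j) / fact i)"
      unfolding 3 4 using nz[OF j] by simp
    finally show ?thesis .
  qed
  show ?thesis
    unfolding sum_distrib_left
    by (subst sum_triangle_shift) (intro sum.cong refl eq, simp)
qed

text \<open>The closed form with N = m has the factor (1 - m)_m, which contains zero unless m =
  0.\<close>

lemma well_poised_orthogonality:
  fixes A :: "'a :: field_char_0"
  assumes "A \<noteq> 0" "pochhammer (1 + A + of_nat m) m \<noteq> 0"
  shows "(\<Sum>i\<le>m. pochhammer A i * (A + 2 * of_nat i) / A
            * (pochhammer (- of_nat m) i / pochhammer (1 + A + of_nat m) i) / fact i)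
    = (if m = 0 then 1 else 0)"
proof -
  have "pochhammer (1 - of_nat m :: 'a) m = (if m = 0 then 1 else 0)"
    using pochhammer_of_nat_eq_0_lemma[of "m - 1" m, where 'a='a] by (cases m) auto
  then show ?thesis
    using well_poised_partial_sum[OF assms] by (simp add: ac_simps)
qed

lemma pochhammer_add_nonzero:
  fixes z :: "'a :: field_char_0"
  assumes "pochhammer z n \<noteq> 0" "i + j \<le> n"
  shows "pochhammer (z + of_nat i) j \<noteq> 0"
  using assms pochhammer_product'[of z i j] pochhammer_eq_0_mono[of z "i + j" n] by auto

text \<open>Saalschutz's sum read from right to left: a quotient with two upper and two lower
  parameters is expanded in (-k)_j (x + k)_j, the shape that \<open>bailey_interchange\<close>
  accepts. Both reversals produce the sign (-1)^k, which cancels.\<close>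

lemma saalschutz_well_poised:
  fixes x b c :: "'a :: field_char_0"
  assumes "pochhammer (1 + x - b) k \<noteq> 0" "pochhammer (1 + x - c) k \<noteq> 0"
  shows "(\<Sum>j\<le>k. pochhammer (- of_nat k) j * pochhammer (x + of_nat k) j
            * (pochhammer (1 + x - b - c) j / (fact j * pochhammer (1 + x - b) j * pochhammer (1 + x - c) j)))
    = pochhammer b k * pochhammer c k / (pochhammer (1 + x - b) k * pochhammer (1 + x - c) k)"
proof -
  have 1: "pochhammer (1 + x - b - (x + of_nat k)) k = (- 1) ^ k * pochhammer b k"
    using pochhammer_minus[of "b + of_nat k - 1" k] by (simp add: algebra_simps)
  have 2: "pochhammer (1 + x - b - (x + of_nat k) - (1 + x - b - c)) k = (- 1) ^ k * pochhammer (1 + x - c) k"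
    using pochhammer_minus[of "x - c + of_nat k" k] by (simp add: algebra_simps)
  have 3: "1 + x - b - (1 + x - b - c) = c" by simp
  have "(\<Sum>j\<le>k. pochhammer (- of_nat k) j * pochhammer (x + of_nat k) j
            * (pochhammer (1 + x - b - c) j / (fact j * pochhammer (1 + x - b) j * pochhammer (1 + x - c) j)))
      = (\<Sum>j\<le>k. pochhammer (- of_nat k) j * pochhammer (x + of_nat k) j * pochhammer (1 + x - b - c) j
            / (fact j * pochhammer (1 + x - b) j * pochhammer (1 + x - c) j))"
    by simp
  also have "\<dots> = pochhammer (1 + x - b - (x + of_nat k)) k * pochhammer (1 + x - b - (1 + x - b - c)) k
     / (pochhammer (1 + x - b) k * pochhammer (1 + x - b - (x + of_nat k) - (1 + x - b - c)) k)"
    using assms by (intro saalschutz) (simp_all add: algebra_simps)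
  also have "\<dots> = pochhammer b k * pochhammer c k / (pochhammer (1 + x - b) k * pochhammer (1 + x - c) k)"
    unfolding 1 2 3 by simp
  finally show ?thesis .
qed

text \<open>The pair d, e is expanded and the quotient containing (-n)_k is kept as
  \<open>u\<close>. The inner sums then fall under \<open>well_poised_orthogonality\<close>, and
  only j = n survives. Nonvanishing of (x)_(2n+1) covers both x + 2j and (1 + x + n)_n.\<close>

lemma well_poised_5F4:
  fixes x d e :: "'a :: field_char_0"
  assumes x: "pochhammer x (Suc (2 * n)) \<noteq> 0"
    and d: "pochhammer (1 + x - d) n \<noteq> 0" and e: "pochhammer (1 + x - e) n \<noteq> 0"
  shows "(\<Sum>k\<le>n. pochhammer x k * (x + 2 * of_nat k) / x * pochhammer d k * pochhammer e k * pochhammer (- of_nat n) k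
            / (fact k * pochhammer (1 + x - d) k * pochhammer (1 + x - e) k * pochhammer (1 + x + of_nat n) k))
    = pochhammer (1 + x) n * pochhammer (1 + x - d - e) n
        / (pochhammer (1 + x - d) n * pochhammer (1 + x - e) n)"
proof -
  define r where "r j = pochhammer (1 + x - d - e) j / (fact j * pochhammer (1 + x - d) j * pochhammer (1 + x - e) j)" for j
  define u where "u k = pochhammer (- of_nat n) k / pochhammer (1 + x + of_nat n) k" for k
  have x0: "x \<noteq> 0" using x by (auto simp: pochhammer_rec)
  have xnz: "x + of_nat j \<noteq> 0" if "j \<le> 2 * n" for j
    using pochhammer_add_nonzero[OF x, of j 1] that by simp
  have xnz2: "x + 2 * of_nat j \<noteq> 0" if "j \<le> n" for j
    using xnz[of "2 * j"] that by simp
  have N: "pochhammer (1 + x + of_nat n) n \<noteq> 0"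
    using pochhammer_add_nonzero[OF x, of "Suc n" n] by (simp add: add_ac)
  have "(\<Sum>k\<le>n. pochhammer x k * (x + 2 * of_nat k) / x * pochhammer d k * pochhammer e k * pochhammer (- of_nat n) k
            / (fact k * pochhammer (1 + x - d) k * pochhammer (1 + x - e) k * pochhammer (1 + x + of_nat n) k))
      = (\<Sum>k\<le>n. pochhammer x k * (x + 2 * of_nat k) / x * u k / fact k
            * (\<Sum>j\<le>k. pochhammer (- of_nat k) j * pochhammer (x + of_nat k) j * r j))"
  proof (rule sum.cong[OF refl])
    fix k assume "k \<in> {..n}"
    then have nz: "pochhammer (1 + x - d) k \<noteq> 0" "pochhammer (1 + x - e) k \<noteq> 0"
      using d e pochhammer_eq_0_mono by (metis atMost_iff)+
    show "pochhammer x k * (x + 2 * of_nat k) / x * pochhammer d k * pochhammer e k * pochhammer (- of_nat n) k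
            / (fact k * pochhammer (1 + x - d) k * pochhammer (1 + x - e) k * pochhammer (1 + x + of_nat n) k)
      = pochhammer x k * (x + 2 * of_nat k) / x * u k / fact k
            * (\<Sum>j\<le>k. pochhammer (- of_nat k) j * pochhammer (x + of_nat k) j * r j)"
      unfolding r_def saalschutz_well_poised[OF nz] u_def by (simp add: ac_simps)
  qed
  also have "\<dots> = (\<Sum>j\<le>n. r j * (- 1) ^ j * pochhammer x (Suc (2 * j)) / x
        * (\<Sum>i\<le>n - j. pochhammer (x + 2 * of_nat j) i * (x + 2 * of_nat j + 2 * of_nat i)
            / (x + 2 * of_nat j) * u (i + j) / fact i))"
    by (rule bailey_interchange) (rule xnz2)
  also have "\<dots> = (\<Sum>j\<le>n. if j = n then r n * (- 1) ^ n * pochhammer x (Suc (2 * n)) / x * u n else 0)"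
  proof (rule sum.cong[OF refl])
    fix j assume "j \<in> {..n}"
    then have j: "j \<le> n" by simp
    have ueq: "u (i + j) = u j * (pochhammer (- of_nat (n - j)) i / pochhammer (1 + (x + 2 * of_nat j) + of_nat (n - j)) i)" for i
    proof -
      have "pochhammer (- of_nat n :: 'a) (j + i) = pochhammer (- of_nat n) j * pochhammer (- of_nat (n - j)) i"
        using pochhammer_product'[of "- of_nat n :: 'a" j i] j by (simp add: of_nat_diff algebra_simps)
      moreover have "pochhammer (1 + x + of_nat n) (j + i)
          = pochhammer (1 + x + of_nat n) j * pochhammer (1 + (x + 2 * of_nat j) + of_nat (n - j)) i"
        using pochhammer_product'[of "1 + x + of_nat n" j i] j by (simp add: of_nat_diff algebra_simps)
      ultimately show ?thesis by (simp add: u_def add.commute)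
    qed
    have "pochhammer (1 + (x + 2 * of_nat j) + of_nat (n - j)) (n - j) \<noteq> 0"
      using pochhammer_add_nonzero[OF N, of j "n - j"] j by (simp add: of_nat_diff algebra_simps)
    note ortho = well_poised_orthogonality[OF xnz2[OF j] this]
    have "(\<Sum>i\<le>n - j. pochhammer (x + 2 * of_nat j) i * (x + 2 * of_nat j + 2 * of_nat i)
            / (x + 2 * of_nat j) * u (i + j) / fact i)
        = u j * (\<Sum>i\<le>n - j. pochhammer (x + 2 * of_nat j) i * (x + 2 * of_nat j + 2 * of_nat i)
            / (x + 2 * of_nat j) * (pochhammer (- of_nat (n - j)) i / pochhammer (1 + (x + 2 * of_nat j) + of_nat (n - j)) i) / fact i)"
      unfolding ueq sum_distrib_left by (intro sum.cong refl) simp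
    then show "r j * (- 1) ^ j * pochhammer x (Suc (2 * j)) / x
        * (\<Sum>i\<le>n - j. pochhammer (x + 2 * of_nat j) i * (x + 2 * of_nat j + 2 * of_nat i)
            / (x + 2 * of_nat j) * u (i + j) / fact i)
      = (if j = n then r n * (- 1) ^ n * pochhammer x (Suc (2 * n)) / x * u n else 0)"
      unfolding ortho using j by simp
  qed
  also have "\<dots> = r n * (- 1) ^ n * pochhammer x (Suc (2 * n)) / x * u n"
    by simp
  also have "\<dots> = pochhammer (1 + x) n * pochhammer (1 + x - d - e) n
        / (pochhammer (1 + x - d) n * pochhammer (1 + x - e) n)"
  proof -
    have 1: "pochhammer x (Suc (2 * n)) = x * (pochhammer (1 + x) n * pochhammer (1 + x + of_nat n) n)"
      using pochhammer_product'[of "1 + x" n n] by (simp add: pochhammer_rec mult_2 add.commute)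
    have 2: "pochhammer (- of_nat n :: 'a) n = (- 1) ^ n * fact n"
      by (rule pochhammer_same)
    show ?thesis unfolding r_def u_def 1 2 using x0 N by simp
  qed
  finally show ?thesis .
qed

text \<open>The same expansion, now of the pair b, c. The inner sum over i is a terminating 5F4 with
  base x + 2j and length n - j, evaluated by \<open>well_poised_5F4\<close>; what remains as a
  function of j is the summand of the 4F3.\<close>

theorem whipple_7F6:
  fixes x b c d e :: "'a :: field_char_0"
  assumes x: "pochhammer x (Suc (2 * n)) \<noteq> 0"
    and b: "pochhammer (1 + x - b) n \<noteq> 0" and c: "pochhammer (1 + x - c) n \<noteq> 0"
    and d: "pochhammer (1 + x - d) n \<noteq> 0" and e: "pochhammer (1 + x - e) n \<noteq> 0"
    and de: "pochhammer (d + e - x - of_nat n) n \<noteq> 0"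
  shows "(\<Sum>k\<le>n. pochhammer x k * (x + 2 * of_nat k) / x * pochhammer b k * pochhammer c k
            * pochhammer d k * pochhammer e k * pochhammer (- of_nat n) k
            / (fact k * pochhammer (1 + x - b) k * pochhammer (1 + x - c) k
              * pochhammer (1 + x - d) k * pochhammer (1 + x - e) k * pochhammer (1 + x + of_nat n) k))
    = pochhammer (1 + x) n * pochhammer (1 + x - d - e) n
        / (pochhammer (1 + x - d) n * pochhammer (1 + x - e) n)
      * (\<Sum>j\<le>n. pochhammer (1 + x - b - c) j * pochhammer d j * pochhammer e j * pochhammer (- of_nat n) j
            / (fact j * pochhammer (1 + x - b) j * pochhammer (1 + x - c) j * pochhammer (d + e - x - of_nat n) j))"
proof -
  define r where "r j = pochhammer (1 + x - b - c) j / (fact j * pochhammer (1 + x - b) j * pochhammer (1 + x - c) j)" for j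
  define u where "u k = pochhammer d k * pochhammer e k * pochhammer (- of_nat n) k
      / (pochhammer (1 + x - d) k * pochhammer (1 + x - e) k * pochhammer (1 + x + of_nat n) k)" for k
  have x0: "x \<noteq> 0" using x by (auto simp: pochhammer_rec)
  have xnz2: "x + 2 * of_nat j \<noteq> 0" if "j \<le> n" for j
    using pochhammer_add_nonzero[OF x, of "2 * j" 1] that by simp
  have N: "pochhammer (1 + x + of_nat n) n \<noteq> 0"
    using pochhammer_add_nonzero[OF x, of "Suc n" n] by (simp add: add_ac)
  have "(\<Sum>k\<le>n. pochhammer x k * (x + 2 * of_nat k) / x * pochhammer b k * pochhammer c k
            * pochhammer d k * pochhammer e k * pochhammer (- of_nat n) k
            / (fact k * pochhammer (1 + x - b) k * pochhammer (1 + x - c) k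
              * pochhammer (1 + x - d) k * pochhammer (1 + x - e) k * pochhammer (1 + x + of_nat n) k))
      = (\<Sum>k\<le>n. pochhammer x k * (x + 2 * of_nat k) / x * u k / fact k
            * (\<Sum>j\<le>k. pochhammer (- of_nat k) j * pochhammer (x + of_nat k) j * r j))"
  proof (rule sum.cong[OF refl])
    fix k assume "k \<in> {..n}"
    then have nz: "pochhammer (1 + x - b) k \<noteq> 0" "pochhammer (1 + x - c) k \<noteq> 0"
      using b c pochhammer_eq_0_mono by (metis atMost_iff)+
    show "pochhammer x k * (x + 2 * of_nat k) / x * pochhammer b k * pochhammer c k
            * pochhammer d k * pochhammer e k * pochhammer (- of_nat n) k
            / (fact k * pochhammer (1 + x - b) k * pochhammer (1 + x - c) k
              * pochhammer (1 + x - d) k * pochhammer (1 + x - e) k * pochhammer (1 + x + of_nat n) k)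
      = pochhammer x k * (x + 2 * of_nat k) / x * u k / fact k
            * (\<Sum>j\<le>k. pochhammer (- of_nat k) j * pochhammer (x + of_nat k) j * r j)"
      unfolding r_def saalschutz_well_poised[OF nz] u_def by (simp add: ac_simps)
  qed
  also have "\<dots> = (\<Sum>j\<le>n. r j * (- 1) ^ j * pochhammer x (Suc (2 * j)) / x
        * (\<Sum>i\<le>n - j. pochhammer (x + 2 * of_nat j) i * (x + 2 * of_nat j + 2 * of_nat i)
            / (x + 2 * of_nat j) * u (i + j) / fact i))"
    by (rule bailey_interchange) (rule xnz2)
  also have "\<dots> = (\<Sum>j\<le>n. pochhammer (1 + x) n * pochhammer (1 + x - d - e) n
        / (pochhammer (1 + x - d) n * pochhammer (1 + x - e) n) *
        (pochhammer (1 + x - b - c) j * pochhammer d j * pochhammer e j * pochhammer (- of_nat n) j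
            / (fact j * pochhammer (1 + x - b) j * pochhammer (1 + x - c) j * pochhammer (d + e - x - of_nat n) j)))"
  proof (rule sum.cong[OF refl])
    fix j assume "j \<in> {..n}"
    then have j: "j \<le> n" by simp
    define l where "l = n - j"
    have nl: "n = j + l" using j by (simp add: l_def)
    define y where "y = x + 2 * of_nat j"
    \<comment> \<open>Shifting d and e by j while the base moves by 2j keeps the inner series
      well-poised: 1 + y - D is 1 + x - d shifted by j.\<close>
    define D E where "D = d + of_nat j" and "E = e + of_nat j"
    have arg: "1 + x - d + of_nat j = 1 + y - D" "1 + x - e + of_nat j = 1 + y - E"
      "- of_nat n + of_nat j = (- of_nat l :: 'a)" "1 + x + of_nat n + of_nat j = 1 + y + of_nat l"
      by (simp_all add: y_def D_def E_def nl)
    have ueq: "u (i + j) = u j * (pochhammer D i * pochhammer E i * pochhammer (- of_nat l) i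
        / (pochhammer (1 + y - D) i * pochhammer (1 + y - E) i * pochhammer (1 + y + of_nat l) i))" for i
      unfolding u_def add.commute[of i j] pochhammer_product' arg by (simp add: D_def E_def ac_simps)
    have "pochhammer y (Suc (2 * l)) \<noteq> 0"
      using pochhammer_add_nonzero[OF x, of "2 * j" "Suc (2 * l)"] by (simp add: y_def nl)
    moreover have D0: "pochhammer (1 + y - D) l \<noteq> 0"
      using pochhammer_add_nonzero[OF d, of j l] by (simp only: arg) (simp add: nl)
    moreover have E0: "pochhammer (1 + y - E) l \<noteq> 0"
      using pochhammer_add_nonzero[OF e, of j l] by (simp only: arg) (simp add: nl)
    ultimately have five: "(\<Sum>k\<le>l. pochhammer y k * (y + 2 * of_nat k) / y * pochhammer D k * pochhammer E k * pochhammer (- of_nat l) k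
            / (fact k * pochhammer (1 + y - D) k * pochhammer (1 + y - E) k * pochhammer (1 + y + of_nat l) k))
        = pochhammer (1 + y) l * pochhammer (1 + y - D - E) l
        / (pochhammer (1 + y - D) l * pochhammer (1 + y - E) l)"
      by (rule well_poised_5F4)
    have inner: "(\<Sum>i\<le>l. pochhammer y i * (y + 2 * of_nat i) / y * u (i + j) / fact i)
        = u j * (pochhammer (1 + y) l * pochhammer (1 + y - D - E) l
        / (pochhammer (1 + y - D) l * pochhammer (1 + y - E) l))"
      unfolding five[symmetric] sum_distrib_left ueq
      by (intro sum.cong refl) (simp add: ac_simps)
    have 1: "pochhammer x (Suc (2 * j)) * pochhammer (1 + y) l
        = x * (pochhammer (1 + x) n * pochhammer (1 + x + of_nat n) j)"
    proof -
      have "pochhammer (1 + x) (2 * j + l) = pochhammer (1 + x) (2 * j) * pochhammer (1 + y) l"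
        by (simp add: pochhammer_product' y_def add.assoc)
      moreover have "pochhammer (1 + x) (n + j) = pochhammer (1 + x) n * pochhammer (1 + x + of_nat n) j"
        by (rule pochhammer_product')
      moreover have "2 * j + l = n + j" by (simp add: nl)
      ultimately have "pochhammer (1 + x) (2 * j) * pochhammer (1 + y) l
          = pochhammer (1 + x) n * pochhammer (1 + x + of_nat n) j"
        by (simp only:)
      then show ?thesis by (simp add: pochhammer_rec add.commute[of x 1])
    qed
    have 2: "pochhammer (1 + x - d) n = pochhammer (1 + x - d) j * pochhammer (1 + y - D) l"
      "pochhammer (1 + x - e) n = pochhammer (1 + x - e) j * pochhammer (1 + y - E) l"
      unfolding arg[symmetric] unfolding nl by (rule pochhammer_product')+
    have sgn: "(- 1) ^ j * (- 1) ^ j = (1 :: 'a)" by (simp add: power_mult_distrib[symmetric])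
    \<comment> \<open>Reversing the last j factors of (1 + x - d - e)_n is where the lower parameter
      d + e - x - n of the 4F3 comes from.\<close>
    have 3: "pochhammer (1 + x - d - e) n = (- 1) ^ j * pochhammer (1 + y - D - E) l * pochhammer (d + e - x - of_nat n) j"
    proof -
      define M where "M = pochhammer (1 + x - d - e + of_nat l) j"
      have "1 + x - d - e = 1 + y - D - E" by (simp add: y_def D_def E_def)
      then have "pochhammer (1 + x - d - e) n = ((- 1) ^ j * (- 1) ^ j) * pochhammer (1 + y - D - E) l * M"
        using pochhammer_product'[of "1 + x - d - e" l j]
        by (simp only: sgn mult_1_left nl M_def add.commute[of j l])
      moreover have "pochhammer (d + e - x - of_nat n) j = (- 1) ^ j * M"
        using pochhammer_minus[of "x - d - e + of_nat n" j] by (simp add: nl M_def algebra_simps)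
      ultimately show ?thesis by (simp only: ac_simps)
    qed
    have nz: "pochhammer (d + e - x - of_nat n) j \<noteq> 0" "pochhammer (1 + x - d) j \<noteq> 0"
      "pochhammer (1 + x - e) j \<noteq> 0" "pochhammer (1 + x + of_nat n) j \<noteq> 0"
      using de d e N j pochhammer_eq_0_mono by blast+
    have "r j * (- 1) ^ j * pochhammer x (Suc (2 * j)) / x
        * (u j * (pochhammer (1 + y) l * pochhammer (1 + y - D - E) l
        / (pochhammer (1 + y - D) l * pochhammer (1 + y - E) l)))
      = r j * (- 1) ^ j / x * (pochhammer x (Suc (2 * j)) * pochhammer (1 + y) l) * u j * pochhammer (1 + y - D - E) l
        / (pochhammer (1 + y - D) l * pochhammer (1 + y - E) l)"
      by simp
    also have "\<dots> = r j * (- 1) ^ j * (pochhammer (1 + x) n * pochhammer (1 + x + of_nat n) j) * u j * pochhammer (1 + y - D - E) l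
        / (pochhammer (1 + y - D) l * pochhammer (1 + y - E) l)"
      unfolding 1 using x0 by simp
    also have "\<dots> = pochhammer (1 + x) n * pochhammer (1 + x - d - e) n
        / (pochhammer (1 + x - d) n * pochhammer (1 + x - e) n) *
        (pochhammer (1 + x - b - c) j * pochhammer d j * pochhammer e j * pochhammer (- of_nat n) j
            / (fact j * pochhammer (1 + x - b) j * pochhammer (1 + x - c) j * pochhammer (d + e - x - of_nat n) j))"
      unfolding 2 3 r_def u_def using nz by (simp add: ac_simps)
    finally show "r j * (- 1) ^ j * pochhammer x (Suc (2 * j)) / x
        * (\<Sum>i\<le>n - j. pochhammer (x + 2 * of_nat j) i * (x + 2 * of_nat j + 2 * of_nat i)
            / (x + 2 * of_nat j) * u (i + j) / fact i)
      = pochhammer (1 + x) n * pochhammer (1 + x - d - e) n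
        / (pochhammer (1 + x - d) n * pochhammer (1 + x - e) n) *
        (pochhammer (1 + x - b - c) j * pochhammer d j * pochhammer e j * pochhammer (- of_nat n) j
            / (fact j * pochhammer (1 + x - b) j * pochhammer (1 + x - c) j * pochhammer (d + e - x - of_nat n) j))"
      unfolding y_def[symmetric] l_def[symmetric] inner .
  qed
  finally show ?thesis by (simp only: sum_distrib_left)
qed

section \<open>Vanishing of well-poised sums by reflection\<close>

lemma well_poised_antisymmetric_sum:
  fixes f :: "nat \<Rightarrow> 'a :: field_char_0"
  assumes "\<And>k. k \<le> n \<Longrightarrow> f (n - k) = f k"
  shows "(\<Sum>k\<le>n. (2 * of_nat k - of_nat n) * f k) = 0"
proof -
  let ?S = "\<Sum>k\<le>n. (2 * of_nat k - of_nat n) * f k"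
  have "?S = (\<Sum>k\<le>n. (2 * of_nat (n - k) - of_nat n) * f (n - k))"
    by (rule sum.reindex_bij_witness[where i = "\<lambda>k. n - k" and j = "\<lambda>k. n - k"]) auto
  also have "\<dots> = (\<Sum>k\<le>n. - ((2 * of_nat k - of_nat n) * f k))"
    by (intro sum.cong refl) (simp add: assms of_nat_diff algebra_simps)
  also have "\<dots> = - ?S" by (simp add: sum_negf)
  finally show ?thesis by simp
qed

text \<open>At base x = -n the well-poised partner of z is 1 + x - z = 1 - n - z. Reversing both
  products shows that their quotient picks up exactly (-1)^n under reflection, so a product of an
  even number of such quotients is symmetric.\<close>

lemma well_poised_factor_reflect:
  fixes z :: "'a :: field_char_0"
  assumes "pochhammer (1 - of_nat n - z) n \<noteq> 0" "k \<le> n"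
  shows "pochhammer z (n - k) / pochhammer (1 - of_nat n - z) (n - k)
    = (- 1) ^ n * (pochhammer z k / pochhammer (1 - of_nat n - z) k)"
proof -
  have refl: "pochhammer (1 - of_nat n - z) j = (- 1) ^ j * pochhammer (z + of_nat (n - j)) j" if "j \<le> n" for j
    using pochhammer_minus[of "of_nat n + z - 1" j] that by (simp add: of_nat_diff algebra_simps)
  have "pochhammer (1 - of_nat n - z) k \<noteq> 0" "pochhammer (1 - of_nat n - z) (n - k) \<noteq> 0"
    using assms pochhammer_eq_0_mono by (metis diff_le_self)+
  then have nz: "pochhammer (z + of_nat (n - k)) k \<noteq> 0" "pochhammer (z + of_nat k) (n - k) \<noteq> 0"
    using assms(2) refl[of k] refl[of "n - k"] by auto
  have "pochhammer z k * pochhammer (z + of_nat k) (n - k) = pochhammer z (n - k) * pochhammer (z + of_nat (n - k)) k"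
    using pochhammer_product[OF assms(2), of z] pochhammer_product[of "n - k" n z] assms(2) by simp
  then have eq: "pochhammer z (n - k) / pochhammer (z + of_nat k) (n - k) = pochhammer z k / pochhammer (z + of_nat (n - k)) k"
    using nz by (simp add: field_simps)
  have sign: "(- 1) ^ (n - k) = ((- 1) ^ n * (- 1) ^ k :: 'a)"
  proof -
    have "(- 1) ^ n = ((- 1) ^ (n - k) * (- 1) ^ k :: 'a)"
      by (simp only: power_add[symmetric] le_add_diff_inverse2[OF assms(2)])
    moreover have "(- 1) ^ k * (- 1) ^ k = (1 :: 'a)" by (simp flip: power_mult_distrib)
    ultimately show ?thesis by (simp only: mult.assoc mult_1_right)
  qed
  have inv: "u / ((- 1) ^ m * v) = (- 1) ^ m * (u / v)" for u v :: 'a and m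
    by (cases "even m") simp_all
  have refl': "pochhammer (1 - of_nat n - z) (n - k) = (- 1) ^ (n - k) * pochhammer (z + of_nat k) (n - k)"
    using refl[of "n - k"] assms(2) by simp
  show ?thesis unfolding refl' refl[OF assms(2)] inv eq unfolding sign by (simp only: mult.assoc)
qed

section \<open>Congruences and units in the \<open>p\<close>-adic numbers\<close>

lemma residue_seq_of_int:
  "residue_seq (of_int m :: 'p :: prime_card padic_int) n = m mod int CARD('p) ^ n"
proof (cases m rule: int_diff_cases)
  case (diff a b)
  then show ?thesis
    by (simp add: minus_padic_int.rep_eq residue_seq_of_nat mod_simps)
qed

lemma of_nat_CARD_dvd_of_int_iff:
  "of_nat CARD('p) dvd (of_int m :: 'p :: prime_card padic_int) \<longleftrightarrow> int CARD('p) dvd m"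
  by (simp add: of_nat_CARD_dvd_iff residue_seq_of_int dvd_eq_mod_eq_0)

lemma of_nat_CARD_dvd_mult:
  fixes x y :: "'p :: prime_card padic_int"
  assumes "of_nat CARD('p) dvd x * y"
  shows "of_nat CARD('p) dvd x \<or> of_nat CARD('p) dvd y"
proof -
  have "int CARD('p) dvd residue_seq x 1 * residue_seq y 1"
    using assms by (simp add: of_nat_CARD_dvd_iff times_padic_int.rep_eq dvd_eq_mod_eq_0)
  then have "int CARD('p) dvd residue_seq x 1 \<or> int CARD('p) dvd residue_seq y 1"
    using prime_card_int[where 'a = 'p] by (simp add: prime_dvd_mult_iff)
  then show ?thesis
    using residue_seq_mod_self[of x 1] residue_seq_mod_self[of y 1]
    by (auto simp: of_nat_CARD_dvd_iff dvd_eq_mod_eq_0)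
qed

text \<open>The inverse is assembled from inverses modulo each p^n, which exist because the residue
  of x is prime to p at every positive level.\<close>

lemma padic_int_unit:
  fixes x :: "'p :: prime_card padic_int"
  assumes "\<not> of_nat CARD('p) dvd x"
  shows "x dvd 1"
proof -
  let ?p = "int CARD('p)"
  have cop: "coprime (residue_seq x n) (?p ^ n)" for n
  proof (cases "n = 0")
    case False
    then have "residue_seq x n mod ?p ^ 1 = residue_seq x 1" by (intro residue_seq_mod) simp
    then have "\<not> ?p dvd residue_seq x n"
      using assms by (auto simp: of_nat_CARD_dvd_iff dvd_eq_mod_eq_0)
    then have "coprime ?p (residue_seq x n)"
      using prime_card_int[where 'a = 'p] by (simp add: prime_imp_coprime)
    then show ?thesis by (simp add: coprime_commute)
  qed simp
  then have "\<forall>n. \<exists>y. [residue_seq x n * y = 1] (mod ?p ^ n)"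
    by (blast intro: cong_solve_coprime_int)
  then obtain y where y: "\<And>n. [residue_seq x n * y n = 1] (mod ?p ^ n)"
    by metis
  define z where "z n = y n mod ?p ^ n" for n
  \<comment> \<open>Coherence of the levels: two inverses of the same residue agree modulo p^n, by
    cancelling \<open>residue_seq x n\<close>.\<close>
  have "z n = z (Suc n) mod ?p ^ n" for n
  proof -
    have "[residue_seq x n * y (Suc n) = residue_seq x (Suc n) * y (Suc n)] (mod ?p ^ n)"
      using residue_seq_Suc[of x n] by (intro cong_mult) (auto simp: cong_def)
    also have "[residue_seq x (Suc n) * y (Suc n) = 1] (mod ?p ^ n)"
      using y[of "Suc n"] by (rule cong_dvd_modulus) simp
    also have "[1 = residue_seq x n * y n] (mod ?p ^ n)"
      using y[of n] by (rule cong_sym)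
    finally have "[y (Suc n) = y n] (mod ?p ^ n)"
      using cop[of n] by (simp add: cong_mult_lcancel)
    then show ?thesis by (simp add: z_def cong_def mod_power_Suc_mod del: power_Suc)
  qed
  then have rep: "residue_seq (Abs_padic_int z :: 'p padic_int) = z"
    by (intro Abs_padic_int_inverse CollectI allI)
  have "x * Abs_padic_int z = 1"
    using y by (intro padic_int_eqI)
      (simp add: times_padic_int.rep_eq one_padic_int.rep_eq rep z_def mod_simps cong_def)
  then show ?thesis by (metis dvdI)
qed

text \<open>The ideals are taken inside the field, with \<open>padic_ideal 0\<close> as its ring of
  integers, so that integrality and divisibility of quotients are handled by one family.\<close>

definition padic_ideal :: "nat \<Rightarrow> 'p :: prime_card padic set" where
  "padic_ideal k = range (\<lambda>z. of_nat (CARD('p) ^ k) * to_fract z)"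

text \<open>Described by the residue modulo p, which is what congruences control;
  \<open>padic_int_unit\<close> turns this into invertibility.\<close>

definition padic_units :: "'p :: prime_card padic set" where
  "padic_units = to_fract ` {z. \<not> of_nat CARD('p) dvd z}"

lemma padic_cong_iff: "padic_cong k x y \<longleftrightarrow> x - y \<in> padic_ideal k"
  by (auto simp: padic_cong_def padic_ideal_def)

lemma to_fract_of_nat [simp]: "to_fract (of_nat n) = of_nat n"
  by (induction n) simp_all

lemma to_fract_of_int [simp]: "to_fract (of_int n) = of_int n"
  by (cases n rule: int_diff_cases) simp

lemma to_fract_pochhammer: "to_fract (pochhammer z k) = pochhammer (to_fract z) k"
  by (induction k) (simp_all add: pochhammer_Suc)

lemma to_fract_integral [simp]: "to_fract z \<in> padic_ideal 0"
  by (simp add: padic_ideal_def)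

lemma of_nat_integral [simp]: "of_nat n \<in> padic_ideal 0"
  using to_fract_integral[of "of_nat n"] by simp

lemma of_int_integral [simp]: "of_int n \<in> padic_ideal 0"
  using to_fract_integral[of "of_int n"] by simp

lemma one_integral [simp]: "1 \<in> padic_ideal 0"
  using of_nat_integral[of 1] by simp

lemma numeral_integral [simp]: "numeral n \<in> padic_ideal 0"
  using of_nat_integral[of "numeral n"] by simp

lemma integralE:
  assumes "x \<in> padic_ideal 0"
  obtains z where "x = to_fract z"
  using assms by (auto simp: padic_ideal_def)

lemma padic_ideal_zero [simp]: "0 \<in> padic_ideal k"
  using rangeI[of "\<lambda>z. of_nat (CARD('p) ^ k) * to_fract z" 0] by (simp add: padic_ideal_def)

lemma padic_ideal_add: "x \<in> padic_ideal k \<Longrightarrow> y \<in> padic_ideal k \<Longrightarrow> x + y \<in> padic_ideal k"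
  unfolding padic_ideal_def by (auto simp flip: distrib_left to_fract_add)

lemma padic_ideal_uminus: "x \<in> padic_ideal k \<Longrightarrow> - x \<in> padic_ideal k"
  unfolding padic_ideal_def by (auto simp flip: mult_minus_right to_fract_uminus)

lemma padic_ideal_diff: "x \<in> padic_ideal k \<Longrightarrow> y \<in> padic_ideal k \<Longrightarrow> x - y \<in> padic_ideal k"
  using padic_ideal_add[OF _ padic_ideal_uminus, of x k y] by simp

lemma padic_ideal_mult:
  assumes "x \<in> padic_ideal i" "y \<in> padic_ideal j"
  shows "x * y \<in> padic_ideal (i + j)"
proof -
  obtain u v where "x = of_nat (CARD('a) ^ i) * to_fract u" "y = of_nat (CARD('a) ^ j) * to_fract v"
    using assms by (auto simp: padic_ideal_def)
  then have "x * y = of_nat (CARD('a) ^ (i + j)) * to_fract (u * v)"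
    by (simp add: power_add)
  then show ?thesis unfolding padic_ideal_def by (rule range_eqI)
qed

lemma integral_mult: "x \<in> padic_ideal 0 \<Longrightarrow> y \<in> padic_ideal k \<Longrightarrow> x * y \<in> padic_ideal k"
  using padic_ideal_mult[of x 0 y k] by simp

lemma padic_ideal_integral: "x \<in> padic_ideal k \<Longrightarrow> y \<in> padic_ideal 0 \<Longrightarrow> x * y \<in> padic_ideal k"
  using padic_ideal_mult[of x k y 0] by simp

lemma of_nat_CARD_power_ideal: "of_nat CARD('p) ^ k \<in> (padic_ideal k :: 'p :: prime_card padic set)"
  using rangeI[of "\<lambda>z. of_nat (CARD('p) ^ k) * to_fract z" "1 :: 'p padic_int"] by (simp add: padic_ideal_def)

lemma padic_ideal_antimono:
  assumes "x \<in> padic_ideal k" "j \<le> k"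
  shows "x \<in> padic_ideal j"
proof -
  obtain z where "x = of_nat (CARD('a) ^ k) * to_fract z" using assms(1) by (auto simp: padic_ideal_def)
  moreover have "(of_nat (CARD('a) ^ k) :: 'a padic) = of_nat (CARD('a) ^ j) * of_nat (CARD('a) ^ (k - j))"
    by (simp only: of_nat_mult[symmetric] power_add[symmetric] le_add_diff_inverse[OF assms(2)])
  ultimately have "x = of_nat (CARD('a) ^ j) * to_fract (of_nat (CARD('a) ^ (k - j)) * z)"
    by (simp only: to_fract_mult to_fract_of_nat mult.assoc)
  then show ?thesis unfolding padic_ideal_def by (rule range_eqI)
qed

lemma padic_ideal_sum: "(\<And>i. i \<in> A \<Longrightarrow> f i \<in> padic_ideal k) \<Longrightarrow> sum f A \<in> padic_ideal k"
  by (induction A rule: infinite_finite_induct) (auto intro: padic_ideal_add)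

lemma integral_pochhammer: "x \<in> padic_ideal 0 \<Longrightarrow> pochhammer x k \<in> padic_ideal 0"
  by (induction k) (auto simp: pochhammer_Suc intro!: integral_mult padic_ideal_add)

lemma to_fract_ideal_1_iff: "to_fract z \<in> padic_ideal 1 \<longleftrightarrow> of_nat CARD('p) dvd (z :: 'p :: prime_card padic_int)"
proof -
  have "to_fract z = of_nat CARD('p) * to_fract y \<longleftrightarrow> z = of_nat CARD('p) * y" for y
    unfolding to_fract_of_nat[symmetric] to_fract_mult[symmetric] by (rule to_fract_eq_iff)
  then show ?thesis by (auto simp: padic_ideal_def dvd_def)
qed

lemma padic_units_integral: "x \<in> padic_units \<Longrightarrow> x \<in> padic_ideal 0"
  by (auto simp: padic_units_def)

lemma padic_units_iff: "x \<in> padic_units \<longleftrightarrow> x \<in> padic_ideal 0 \<and> x \<notin> padic_ideal 1"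
  by (auto simp: padic_units_def to_fract_ideal_1_iff[unfolded One_nat_def] elim!: integralE)

lemma padic_units_nonzero: "x \<in> padic_units \<Longrightarrow> x \<noteq> 0"
  by (auto simp: padic_units_iff)

lemma padic_units_mult: "x \<in> padic_units \<Longrightarrow> y \<in> padic_units \<Longrightarrow> x * y \<in> padic_units"
  unfolding padic_units_def by (auto simp flip: to_fract_mult dest: of_nat_CARD_dvd_mult)

lemma one_unit [simp]: "1 \<in> padic_units"
proof -
  have "int CARD('a) \<noteq> 1" using prime_card_gt_1[where 'p = 'a] by simp
  then have "\<not> of_nat CARD('a) dvd (1 :: 'a padic_int)"
    using of_nat_CARD_dvd_of_int_iff[of 1, where 'p = 'a] by simp
  then show ?thesis by (metis (mono_tags) image_eqI mem_Collect_eq padic_units_def to_fract_1)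
qed

lemma of_int_unit_iff: "of_int m \<in> (padic_units :: 'p :: prime_card padic set) \<longleftrightarrow> \<not> int CARD('p) dvd m"
  unfolding to_fract_of_int[symmetric] padic_units_iff to_fract_ideal_1_iff
  by (simp only: of_nat_CARD_dvd_of_int_iff to_fract_integral simp_thms)

lemma of_nat_unit_iff: "of_nat m \<in> (padic_units :: 'p :: prime_card padic set) \<longleftrightarrow> \<not> CARD('p) dvd m"
  using of_int_unit_iff[of "int m", where 'p = 'p] by simp

lemma of_int_ideal_1_iff: "of_int m \<in> (padic_ideal 1 :: 'p :: prime_card padic set) \<longleftrightarrow> int CARD('p) dvd m"
  using of_int_unit_iff[of m, where 'p = 'p] by (simp add: padic_units_iff)

lemma padic_units_inverse:
  assumes "x \<in> padic_units"
  shows "inverse x \<in> padic_units"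
proof -
  obtain z where z: "x = to_fract z" "\<not> of_nat CARD('a) dvd z"
    using assms by (auto simp: padic_units_def)
  obtain y where y: "z * y = 1" using padic_int_unit[OF z(2)] by (auto elim: dvdE)
  then have "x * to_fract y = 1" using z by (simp flip: to_fract_mult)
  then have inv: "inverse x = to_fract y" by (rule inverse_unique)
  have "\<not> of_nat CARD('a) dvd y"
  proof
    assume "of_nat CARD('a) dvd y"
    then have "of_nat CARD('a) dvd (1 :: 'a padic_int)" using y by (metis dvd_mult)
    then show False using one_unit[where 'a = 'a] to_fract_ideal_1_iff[of "1 :: 'a padic_int"]
      by (simp add: padic_units_iff)
  qed
  then show ?thesis by (auto simp: inv padic_units_def)
qed

lemma padic_units_inverse_integral: "x \<in> padic_units \<Longrightarrow> inverse x \<in> padic_ideal 0"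
  by (intro padic_units_integral padic_units_inverse)

lemma padic_units_divide: "x \<in> padic_units \<Longrightarrow> y \<in> padic_units \<Longrightarrow> x / y \<in> padic_units"
  unfolding divide_inverse by (intro padic_units_mult padic_units_inverse)

lemma padic_ideal_divide_unit: "x \<in> padic_ideal k \<Longrightarrow> y \<in> padic_units \<Longrightarrow> x / y \<in> padic_ideal k"
  unfolding divide_inverse by (intro padic_ideal_integral padic_units_inverse_integral)

lemma padic_cong_refl [simp]: "padic_cong k x x"
  by (simp add: padic_cong_iff)

lemma padic_cong_sym: "padic_cong k x y \<Longrightarrow> padic_cong k y x"
  using padic_ideal_uminus[of "x - y" k] by (simp add: padic_cong_iff)

lemma padic_cong_trans [trans]: "padic_cong k x y \<Longrightarrow> padic_cong k y z \<Longrightarrow> padic_cong k x z"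
  using padic_ideal_add[of "x - y" k "y - z"] by (simp add: padic_cong_iff)

lemma padic_cong_add: "padic_cong k x y \<Longrightarrow> padic_cong k u v \<Longrightarrow> padic_cong k (x + u) (y + v)"
  using padic_ideal_add[of "x - y" k "u - v"] by (simp add: padic_cong_iff algebra_simps)

lemma padic_cong_diff: "padic_cong k x y \<Longrightarrow> padic_cong k u v \<Longrightarrow> padic_cong k (x - u) (y - v)"
  using padic_ideal_diff[of "x - y" k "u - v"] by (simp add: padic_cong_iff algebra_simps)

lemma padic_cong_mult:
  assumes "padic_cong k x y" "padic_cong k u v" "y \<in> padic_ideal 0" "u \<in> padic_ideal 0"
  shows "padic_cong k (x * u) (y * v)"
proof -
  have "(x - y) * u + y * (u - v) \<in> padic_ideal k"
    using assms unfolding padic_cong_iff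
    by (intro padic_ideal_add padic_ideal_integral integral_mult)
  then show ?thesis by (simp add: padic_cong_iff algebra_simps)
qed

lemma padic_cong_sum: "(\<And>i. i \<in> A \<Longrightarrow> padic_cong k (f i) (g i)) \<Longrightarrow> padic_cong k (sum f A) (sum g A)"
  using padic_ideal_sum[of A "\<lambda>i. f i - g i" k] by (simp add: padic_cong_iff sum_subtractf)

lemma padic_cong_integral: "padic_cong k x y \<Longrightarrow> y \<in> padic_ideal 0 \<Longrightarrow> x \<in> padic_ideal 0"
  using padic_ideal_add[of "x - y" 0 y] padic_ideal_antimono[of "x - y" k 0] by (simp add: padic_cong_iff)

lemma padic_cong_unit: "padic_cong 1 x y \<Longrightarrow> y \<in> padic_units \<Longrightarrow> x \<in> padic_units"
  using padic_cong_integral[of 1 x y] padic_ideal_diff[of x 1 "x - y"]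
  by (auto simp: padic_units_iff padic_cong_iff)

lemma padic_cong_inverse:
  assumes "padic_cong k x y" "x \<in> padic_units" "y \<in> padic_units"
  shows "padic_cong k (inverse x) (inverse y)"
proof -
  have "inverse x - inverse y = - (inverse x * (x - y) * inverse y)"
    using assms(2,3) by (intro inverse_diff_inverse padic_units_nonzero)
  then show ?thesis
    using assms unfolding padic_cong_iff
    by (simp only:) (intro padic_ideal_uminus padic_ideal_integral[OF integral_mult] padic_units_inverse_integral)
qed

lemma padic_cong_divide:
  assumes "padic_cong k x y" "padic_cong k u v" "y \<in> padic_ideal 0" "u \<in> padic_units" "v \<in> padic_units"
  shows "padic_cong k (x / u) (y / v)"
  unfolding divide_inverse using assms
  by (intro padic_cong_mult padic_cong_inverse padic_units_inverse_integral)

lemma padic_cong_pochhammer: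
  assumes "padic_cong k x y" "y \<in> padic_ideal 0"
  shows "padic_cong k (pochhammer x n) (pochhammer y n)"
  by (induction n)
     (use assms in \<open>auto simp: pochhammer_Suc intro!: padic_cong_mult padic_cong_add padic_ideal_add integral_pochhammer padic_cong_integral[OF assms]\<close>)

text \<open>Being a unit depends only on the residue modulo p, so it suffices to inspect the
  integers m, ..., m + k - 1.\<close>

lemma unit_pochhammer:
  assumes "padic_cong 1 z (of_int m)" "\<And>i. i < k \<Longrightarrow> \<not> int CARD('p) dvd m + int i"
  shows "pochhammer (z :: 'p :: prime_card padic) k \<in> padic_units"
proof -
  have "pochhammer (of_int m :: 'p padic) k \<in> padic_units"
    using assms(2)
  proof (induction k)
    case (Suc k)
    have "of_int (m + int k) \<in> (padic_units :: 'p padic set)"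
      using Suc.prems[of k] by (simp only: of_int_unit_iff) simp
    then show ?case using Suc by (auto simp: pochhammer_Suc intro!: padic_units_mult)
  qed simp
  then show ?thesis by (rule padic_cong_unit[OF padic_cong_pochhammer[OF assms(1) of_int_integral]])
qed

lemma pochhammer_ideal_1:
  assumes "padic_cong 1 z (of_int m)" "int CARD('p) dvd m + int i" "i < k"
  shows "pochhammer (z :: 'p :: prime_card padic) k \<in> padic_ideal 1"
proof -
  have int: "z \<in> padic_ideal 0" using assms(1) by (rule padic_cong_integral) simp
  have "padic_cong 1 (z + of_nat i) (of_int (m + int i))"
    using padic_cong_add[OF assms(1) padic_cong_refl[of 1 "of_nat i"]] by simp
  moreover have "of_int (m + int i) \<in> (padic_ideal 1 :: 'p padic set)"
    using assms(2) by (simp only: of_int_ideal_1_iff)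
  ultimately have 1: "z + of_nat i \<in> padic_ideal 1"
    using padic_ideal_add by (fastforce simp: padic_cong_iff)
  have "pochhammer z k = pochhammer z i * ((z + of_nat i) * pochhammer (z + of_nat i + 1) (k - Suc i))"
    using pochhammer_product[of i k z] pochhammer_rec[of "z + of_nat i" "k - Suc i"] assms(3)
    by (simp add: Suc_diff_Suc)
  also have "\<dots> \<in> padic_ideal 1"
    by (rule integral_mult[OF integral_pochhammer[OF int] padic_ideal_integral[OF 1 integral_pochhammer]])
      (intro padic_ideal_add int; simp)
  finally show ?thesis .
qed

text \<open>The valuation of z is at most 1. This is how condition (iii) enters: a denominator may
  contain p once, and a numerator divisible by p compensates for it.\<close>

lemma CARD_divide_integral:
  fixes z :: "'p :: prime_card padic_int"
  assumes "\<not> of_nat (CARD('p) ^ 2) dvd z"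
  shows "z \<noteq> 0" "of_nat CARD('p) / to_fract z \<in> padic_ideal 0"
proof -
  show "z \<noteq> 0" using assms by auto
  show "of_nat CARD('p) / to_fract z \<in> padic_ideal 0"
  proof (cases "of_nat CARD('p) dvd z")
    case True
    then obtain y where y: "z = of_nat CARD('p) * y" by (rule dvdE)
    then have "\<not> of_nat CARD('p) dvd y"
      using assms by (auto simp: power2_eq_square)
    then have "to_fract y \<in> padic_units" by (auto simp: padic_units_def)
    moreover have "of_nat CARD('p) / to_fract z = inverse (to_fract y)"
      by (simp add: y field_simps)
    ultimately show ?thesis by (simp add: padic_units_inverse_integral)
  next
    case False
    then have "to_fract z \<in> padic_units" by (auto simp: padic_units_def)
    then show ?thesis by (intro padic_ideal_divide_unit) simp_all
  qed
qed

lemma padic_residue_props: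
  fixes z :: "'p :: prime_card padic_int"
  shows "padic_residue z < CARD('p)" "of_nat CARD('p) dvd z - of_nat (padic_residue z)"
  using theI'[OF padic_residue_ex1[of z]] by (simp_all add: padic_residue_def)

lemma padic_cong_neg_residue:
  "padic_cong 1 (to_fract z) (- of_nat (padic_residue (- z)))"
proof -
  have "of_nat CARD('a) dvd - (- z - of_nat (padic_residue (- z)))"
    unfolding dvd_minus_iff by (rule padic_residue_props)
  then have "to_fract (z + of_nat (padic_residue (- z))) \<in> padic_ideal 1"
    by (simp only: to_fract_ideal_1_iff) (simp add: add.commute)
  then show ?thesis by (simp add: padic_cong_iff)
qed

section \<open>Existence and residues of the \<open>p\<close>-adic Gamma function\<close>

lemma Gamma_padic_nat_0 [simp]: "Gamma_padic_nat p 0 = 1"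
  by (simp add: Gamma_padic_nat_def)

lemma Gamma_padic_nat_Suc:
  "Gamma_padic_nat p (Suc n) = (if p dvd n then - 1 else - int n) * Gamma_padic_nat p n"
proof -
  have "{j. 1 \<le> j \<and> j < Suc n \<and> \<not> p dvd j}
      = (if p dvd n then {j. 1 \<le> j \<and> j < n \<and> \<not> p dvd j} else insert n {j. 1 \<le> j \<and> j < n \<and> \<not> p dvd j})"
    by (auto simp: less_Suc_eq intro: Suc_leI gr0I)
  then show ?thesis by (simp add: Gamma_padic_nat_def)
qed

text \<open>Gauss's extension of Wilson's theorem, by a primitive root g: with totient 2t the
  product is g^(t(2t-1)), an odd power of g^t, and g^t is a square root of 1 other than 1, hence
  -1.\<close>

lemma prod_totatives_prime_power:
  assumes "prime p" "odd p" "k > 0"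
  shows "[(\<Prod>j\<in>totatives (p ^ k). int j) = - 1] (mod int (p ^ k))"
proof -
  define q where "q = p ^ k"
  have p2: "p > 2" using assms prime_ge_2_nat[of p] by (cases "p = 2") auto
  have "p ^ 1 \<le> p ^ k" using p2 assms(3) by (intro power_increasing) auto
  then have q: "q > 2" using p2 by (simp add: q_def)
  obtain g where g: "residue_primroot q g"
    using residue_primroot_odd_prime_power_exists[OF assms(1,2)] assms(3) unfolding q_def by metis
  define t where "t = totient q div 2"
  have ev: "even (totient q)" using q by (intro totient_even)
  then have t: "totient q = 2 * t" by (simp add: t_def)
  have "totient q > 0" using q by simp
  then have t0: "t > 0" using t by simp
  have "(\<Prod>j\<in>totatives q. int j) = (\<Prod>i<totient q. int (g ^ i mod q))"
    using prod.reindex_bij_betw[OF residue_primroot_is_generator[OF _ g], of int] q by simp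
  also have "[(\<Prod>i<totient q. int (g ^ i mod q)) = (\<Prod>i<totient q. int g ^ i)] (mod int q)"
    by (intro cong_prod) (simp add: cong_def of_nat_mod)
  also have "(\<Prod>i<totient q. int g ^ i) = int g ^ (\<Sum>i<totient q. i)"
    by (simp add: power_sum)
  also have "(\<Sum>i<totient q. i) = t * (2 * t - 1)"
  proof -
    have "(\<Sum>i<2 * t. i) = t * (2 * t - 1)" for t :: nat
      by (induction t) (auto simp: algebra_simps)
    then show ?thesis by (simp add: t)
  qed
  also have "int g ^ (t * (2 * t - 1)) = (int g ^ t) ^ (2 * t - 1)" by (simp add: power_mult)
  also have "[(int g ^ t) ^ (2 * t - 1) = (- 1) ^ (2 * t - 1)] (mod int q)"
  proof (rule cong_pow)
    define h where "h = int g ^ t"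
    have "[g ^ totient q = 1] (mod q)"
      using g by (intro euler_theorem) (simp add: residue_primroot_def coprime_commute)
    then have "[int (g ^ totient q) = int 1] (mod int q)" by (simp only: cong_int_iff)
    then have "[h ^ 2 = 1] (mod int q)" by (simp add: h_def t power_mult mult.commute)
    then have dvd: "int p ^ k dvd (h - 1) * (h + 1)"
      by (simp add: cong_iff_dvd_diff q_def power2_eq_square algebra_simps)
    have n1: "\<not> int q dvd h - 1"
    proof
      assume "int q dvd h - 1"
      then have "[int (g ^ t) = int 1] (mod int q)" by (simp add: h_def cong_iff_dvd_diff)
      then have "[g ^ t = 1] (mod q)" by (simp only: cong_int_iff)
      then have "totient q dvd t" using g ord_divides[of g t q] by (simp add: residue_primroot_def)
      then show False using t t0 by (auto dest: dvd_imp_le)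
    qed
    \<comment> \<open>As p is odd it cannot divide both h - 1 and h + 1, so all of p^k falls on one
      of the factors, and \<open>n1\<close> excludes h - 1.\<close>
    have "int p ^ k dvd h + 1"
    proof (cases "int p dvd h - 1")
      case True
      have "\<not> int p dvd h + 1"
      proof
        assume "int p dvd h + 1"
        then have "int p dvd (h + 1) - (h - 1)" using True by (rule dvd_diff)
        then have "int p dvd 2" by simp
        then show False using p2 by (auto dest: zdvd_imp_le)
      qed
      then have "coprime (int p ^ k) (h + 1)"
        using assms(1) by (simp add: prime_imp_coprime)
      then have "int p ^ k dvd h - 1" using dvd by (simp add: coprime_dvd_mult_left_iff)
      then show ?thesis using n1 by (simp add: q_def)
    next
      case False
      then have "coprime (int p ^ k) (h - 1)"
        using assms(1) by (simp add: prime_imp_coprime)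
      then show ?thesis using dvd by (simp add: coprime_dvd_mult_right_iff)
    qed
    then show "[int g ^ t = - 1] (mod int q)"
      by (simp add: h_def q_def cong_iff_dvd_diff)
  qed
  also have "(- 1) ^ (2 * t - 1) = (- 1 :: int)" using t0 by simp
  finally show ?thesis by (simp add: q_def)
qed

text \<open>The continuity estimate on the naturals. For k > 0 the product -1 of the units meets the
  sign (-1)^(p^k) = -1 at n = 0; the recurrence propagates the congruence, since its factor depends
  modulo p^k only on n modulo p^k.\<close>

lemma Gamma_padic_nat_add_power:
  assumes "prime p" "odd p"
  shows "[Gamma_padic_nat p (n + p ^ k) = Gamma_padic_nat p n] (mod int (p ^ k))"
proof (cases "k = 0")
  case False
  show ?thesis
  proof (induction n)
    case 0
    have "{j. 1 \<le> j \<and> j < p ^ k \<and> \<not> p dvd j} = totatives (p ^ k)"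
    proof -
      have "p \<noteq> 1" using assms(1) by auto
      have coprime: "coprime j (p ^ k) \<longleftrightarrow> \<not> p dvd j" for j
      proof
        assume "coprime j (p ^ k)"
        then have "coprime j p" using False by simp
        then show "\<not> p dvd j" using \<open>p \<noteq> 1\<close> by (auto simp: coprime_absorb_right)
      next
        assume "\<not> p dvd j"
        then show "coprime j (p ^ k)"
          using prime_imp_coprime[OF assms(1), of j] coprime_commute[of j "p ^ k"] by simp
      qed
      have "p dvd p ^ k" using False by simp
      then have "j < p ^ k \<and> \<not> p dvd j \<longleftrightarrow> j \<le> p ^ k \<and> \<not> p dvd j" for j
        by (cases "j = p ^ k") auto
      then show ?thesis
        unfolding totatives_def coprime by (auto simp: Suc_le_eq)
    qed
    then have "Gamma_padic_nat p (p ^ k) = (- 1) ^ (p ^ k) * (\<Prod>j\<in>totatives (p ^ k). int j)"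
      by (simp add: Gamma_padic_nat_def)
    also have "[\<dots> = (- 1) ^ (p ^ k) * (- 1)] (mod int (p ^ k))"
      using assms False by (intro cong_mult prod_totatives_prime_power cong_refl) auto
    finally show ?case using assms(2) by simp
  next
    case (Suc n)
    have "p dvd n + p ^ k \<longleftrightarrow> p dvd n" using False by (simp add: dvd_add_left_iff)
    then have "Gamma_padic_nat p (Suc n + p ^ k)
        = (if p dvd n then - 1 else - int (n + p ^ k)) * Gamma_padic_nat p (n + p ^ k)"
      by (simp add: Gamma_padic_nat_Suc)
    also have "[\<dots> = (if p dvd n then - 1 else - int n) * Gamma_padic_nat p n] (mod int (p ^ k))"
      by (intro cong_mult Suc) (simp add: cong_iff_dvd_diff)
    also have "(if p dvd n then - 1 else - int n) * Gamma_padic_nat p n = Gamma_padic_nat p (Suc n)"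
      by (rule Gamma_padic_nat_Suc[symmetric])
    finally show ?case .
  qed
qed simp

lemma Gamma_padic_nat_cong:
  assumes "prime p" "odd p" "[m = n] (mod p ^ k)"
  shows "[Gamma_padic_nat p m = Gamma_padic_nat p n] (mod int (p ^ k))"
proof -
  have add: "[Gamma_padic_nat p (r + t * p ^ k) = Gamma_padic_nat p r] (mod int (p ^ k))" for r t
  proof (induction t)
    case (Suc t)
    show ?case
      using cong_trans[OF Gamma_padic_nat_add_power[OF assms(1,2), of "r + t * p ^ k" k] Suc]
      by (simp add: ac_simps)
  qed simp
  have "[Gamma_padic_nat p x = Gamma_padic_nat p (x mod p ^ k)] (mod int (p ^ k))" for x
    using add[of "x mod p ^ k" "x div p ^ k"] by (simp only: mod_div_mult_eq)
  then show ?thesis using assms(3) by (metis cong_def)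
qed

lemma dist_padic_int_le:
  fixes x y :: "'p :: prime_card padic_int"
  assumes "residue_seq x n = residue_seq y n"
  shows "dist x y \<le> 1 / real CARD('p) ^ n"
proof (cases "x = y")
  case False
  define L where "L = (LEAST v. residue_seq x (Suc v) \<noteq> residue_seq y (Suc v))"
  obtain m where m: "residue_seq x m \<noteq> residue_seq y m" using False padic_int_eqI by blast
  have "m \<noteq> 0" using m residue_seq_bounds[of x 0] residue_seq_bounds[of y 0] by (cases m) auto
  then have "residue_seq x (Suc (m - 1)) \<noteq> residue_seq y (Suc (m - 1))" using m by simp
  then have L: "residue_seq x (Suc L) \<noteq> residue_seq y (Suc L)" unfolding L_def by (rule LeastI)
  have "n \<le> L"
  proof (rule ccontr)
    assume "\<not> n \<le> L"
    then have "Suc L \<le> n" by simp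
    then show False using L assms residue_seq_mod by metis
  qed
  moreover have "real CARD('p) > 1" using prime_card_gt_1[where 'p = 'p] by simp
  ultimately have "1 / real CARD('p) ^ L \<le> 1 / real CARD('p) ^ n"
    by (intro divide_left_mono power_increasing mult_pos_pos zero_less_power) simp_all
  then show ?thesis using False by (simp add: dist_padic_int_def L_def)
qed (simp add: dist_padic_int_def)

lemma residue_seq_eq_if_dist_less:
  fixes x y :: "'p :: prime_card padic_int"
  assumes "dist x y < 1 / real CARD('p) ^ n"
  shows "residue_seq x n = residue_seq y n"
proof (rule ccontr)
  assume neq: "residue_seq x n \<noteq> residue_seq y n"
  then have "x \<noteq> y" by auto
  have "residue_seq x (Suc n) \<noteq> residue_seq y (Suc n)" using neq by (metis residue_seq_Suc)
  then have "(LEAST v. residue_seq x (Suc v) \<noteq> residue_seq y (Suc v)) \<le> n" by (rule Least_le)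
  moreover have "real CARD('p) > 1" using prime_card_gt_1[where 'p = 'p] by simp
  ultimately have "1 / real CARD('p) ^ n \<le> dist x y"
    using \<open>x \<noteq> y\<close> unfolding dist_padic_int_def
    by (auto intro!: divide_left_mono power_increasing mult_pos_pos zero_less_power)
  then show False using assms by simp
qed

lemma padic_dist_small:
  assumes "e > 0"
  obtains n where "1 / real CARD('p :: prime_card) ^ n < e"
proof -
  have "1 / real CARD('p) < 1" using prime_card_gt_1[where 'p = 'p] by simp
  then obtain n where "(1 / real CARD('p)) ^ n < e"
    using real_arch_pow_inv[OF assms] by blast
  then show ?thesis using that by (simp add: power_one_over)
qed

lemma of_nat_residue_tendsto:
  "(\<lambda>n. of_nat (nat (residue_seq x n))) \<longlonglongrightarrow> (x :: 'p :: prime_card padic_int)"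
proof (rule metric_LIMSEQ_I)
  fix e :: real assume "e > 0"
  then obtain n0 where n0: "1 / real CARD('p) ^ n0 < e" by (rule padic_dist_small)
  show "\<exists>no. \<forall>n\<ge>no. dist (of_nat (nat (residue_seq x n))) x < e"
  proof (intro exI allI impI)
    fix n assume "n \<ge> n0"
    then have "residue_seq (of_nat (nat (residue_seq x n)) :: 'p padic_int) n0 = residue_seq x n0"
      using residue_seq_bounds[of x n] by (simp add: residue_seq_of_int residue_seq_mod)
    from dist_padic_int_le[OF this] n0
    show "dist (of_nat (nat (residue_seq x n))) x < e" by linarith
  qed
qed

text \<open>\<open>Gamma_padic\<close> is a definite description, so its values become accessible
  only after existence and uniqueness. The candidate is built level by level from the values at
  naturals; it is continuous because each level depends on finitely many digits, and unique because
  z is the limit of its truncations, which are naturals.\<close>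

lemma residue_seq_Gamma_padic:
  assumes "odd CARD('p :: prime_card)"
  shows "residue_seq (Gamma_padic (z :: 'p padic_int)) n
    = Gamma_padic_nat CARD('p) (nat (residue_seq z n)) mod int CARD('p) ^ n"
proof -
  define G :: "'p padic_int \<Rightarrow> nat \<Rightarrow> int" where
    "G z n = Gamma_padic_nat CARD('p) (nat (residue_seq z n)) mod int CARD('p) ^ n" for z n
  define f :: "'p padic_int \<Rightarrow> 'p padic_int" where "f z = Abs_padic_int (G z)" for z
  have pos: "nat (residue_seq z m mod int CARD('p) ^ n) = nat (residue_seq z m) mod CARD('p) ^ n" for z :: "'p padic_int" and m n
    using residue_seq_bounds[of z m] by (simp add: nat_mod_distrib nat_power_eq)
  have "G z n = G z (Suc n) mod int CARD('p) ^ n" for z n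
  proof -
    have "[nat (residue_seq z n) = nat (residue_seq z (Suc n))] (mod CARD('p) ^ n)"
      using pos[of z "Suc n" n] pos[of z n n] by (simp add: cong_def residue_seq_Suc)
    from Gamma_padic_nat_cong[OF prime_card assms this]
    show ?thesis by (simp add: G_def cong_def mod_power_Suc_mod del: power_Suc)
  qed
  then have rep: "residue_seq (f z) = G z" for z
    unfolding f_def by (intro Abs_padic_int_inverse CollectI allI)
  have cont: "continuous_on UNIV f"
  proof (intro continuous_at_imp_continuous_on ballI)
    fix x :: "'p padic_int"
    have "f \<midarrow>x\<rightarrow> f x"
    proof (rule metric_LIM_I)
      fix e :: real assume "e > 0"
      then obtain n where n: "1 / real CARD('p) ^ n < e" by (rule padic_dist_small)
      show "\<exists>d>0. \<forall>x'. x' \<noteq> x \<and> dist x' x < d \<longrightarrow> dist (f x') (f x) < e"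
      proof (intro exI[of _ "1 / real CARD('p) ^ n"] conjI allI impI)
        fix x' assume "x' \<noteq> x \<and> dist x' x < 1 / real CARD('p) ^ n"
        then have "residue_seq x' n = residue_seq x n" by (blast intro: residue_seq_eq_if_dist_less)
        then have "residue_seq (f x') n = residue_seq (f x) n" by (simp add: rep G_def)
        from dist_padic_int_le[OF this] n show "dist (f x') (f x) < e" by linarith
      qed (use prime_card_gt_1[where 'p = 'p] in simp)
    qed
    then show "isCont f x" by (simp add: isCont_def)
  qed
  have nat: "f (of_nat m) = of_int (Gamma_padic_nat CARD('p) m)" for m
  proof (rule padic_int_eqI)
    fix n
    have "[nat (residue_seq (of_nat m :: 'p padic_int) n) = m] (mod CARD('p) ^ n)"
      by (simp add: residue_seq_of_nat cong_def nat_mod_distrib nat_power_eq)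
    from Gamma_padic_nat_cong[OF prime_card assms this]
    show "residue_seq (f (of_nat m)) n = residue_seq (of_int (Gamma_padic_nat CARD('p) m) :: 'p padic_int) n"
      by (simp add: rep G_def cong_def residue_seq_of_int)
  qed
  have "Gamma_padic = f"
    unfolding Gamma_padic_def
  proof (rule the_equality)
    fix g :: "'p padic_int \<Rightarrow> 'p padic_int"
    assume g: "continuous_on UNIV g \<and> (\<forall>n. g (of_nat n) = of_int (Gamma_padic_nat CARD('p) n))"
    show "g = f"
    proof
      fix z
      have "(\<lambda>n. g (of_nat (nat (residue_seq z n)))) \<longlonglongrightarrow> g z"
        using g of_nat_residue_tendsto by (intro continuous_on_tendsto_compose[of UNIV g]) auto
      moreover have "(\<lambda>n. f (of_nat (nat (residue_seq z n)))) \<longlonglongrightarrow> f z"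
        using cont of_nat_residue_tendsto by (intro continuous_on_tendsto_compose[of UNIV f]) auto
      ultimately show "g z = f z" using g nat LIMSEQ_unique by simp
    qed
  qed (use cont nat in auto)
  then have "residue_seq (Gamma_padic z) n = residue_seq (f z) n" by simp
  then show ?thesis by (simp only: rep G_def)
qed

section \<open>Functions that are affine modulo \<open>p\<^sup>2\<close>\<close>

text \<open>A first-order Taylor expansion in the variables \<open>p * t i\<close>, with
  coefficients independent of t. Since only a congruence modulo p^2 is required, everything built
  from such variables and integral constants by ring operations and division by units belongs to the
  class.\<close>

definition affine_mod_square ::
  "nat \<Rightarrow> ((nat \<Rightarrow> 'p :: prime_card padic_int) \<Rightarrow> 'p padic) \<Rightarrow> bool" where
  "affine_mod_square n f \<longleftrightarrow> (\<exists>u v. u \<in> padic_ideal 0 \<and> (\<forall>i. v i \<in> padic_ideal 0) \<and>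
     (\<forall>t. padic_cong 2 (f t) (u + of_nat CARD('p) * (\<Sum>i<n. v i * to_fract (t i)))))"

lemma integral_linear_form:
  "(\<And>i. v i \<in> padic_ideal 0) \<Longrightarrow> (\<Sum>i<n. v i * to_fract (t i)) \<in> padic_ideal 0"
  by (intro padic_ideal_sum integral_mult) auto

lemma CARD_mult_ideal: "x \<in> padic_ideal k \<Longrightarrow> of_nat CARD('p) * x \<in> (padic_ideal (Suc k) :: 'p :: prime_card padic set)"
  using padic_ideal_mult[OF of_nat_CARD_power_ideal[of 1]] by simp

lemma affine_mod_square_const: "c \<in> padic_ideal 0 \<Longrightarrow> affine_mod_square n (\<lambda>_. c)"
  unfolding affine_mod_square_def by (intro exI[of _ c] exI[of _ "\<lambda>_. 0"]) simp

lemma affine_mod_square_coordinate: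
  fixes c :: "'p :: prime_card padic"
  assumes "c \<in> padic_ideal 0" "i < n"
  shows "affine_mod_square n (\<lambda>t. c + of_nat CARD('p) * to_fract (t i))"
proof -
  have "(\<Sum>j<n. (if j = i then 1 else 0) * to_fract (t j)) = to_fract (t i :: 'p padic_int)" for t
  proof -
    have "(\<Sum>j<n. (if j = i then 1 else 0) * to_fract (t j)) = (\<Sum>j<n. if j = i then to_fract (t j) else 0)"
      by (intro sum.cong) auto
    then show ?thesis using assms(2) by simp
  qed
  then show ?thesis
    unfolding affine_mod_square_def using assms
    by (intro exI[of _ c] exI[of _ "\<lambda>j. if j = i then 1 else 0"]) simp
qed

lemma affine_mod_square_add:
  fixes f g :: "(nat \<Rightarrow> 'p :: prime_card padic_int) \<Rightarrow> 'p padic"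
  assumes "affine_mod_square n f" "affine_mod_square n g"
  shows "affine_mod_square n (\<lambda>t. f t + g t)"
proof -
  obtain u v where f: "u \<in> padic_ideal 0" "\<And>i. v i \<in> padic_ideal 0"
    "\<And>t. padic_cong 2 (f t) (u + of_nat CARD('p) * (\<Sum>i<n. v i * to_fract (t i)))"
    using assms(1) unfolding affine_mod_square_def by metis
  obtain u' v' where g: "u' \<in> padic_ideal 0" "\<And>i. v' i \<in> padic_ideal 0"
    "\<And>t. padic_cong 2 (g t) (u' + of_nat CARD('p) * (\<Sum>i<n. v' i * to_fract (t i)))"
    using assms(2) unfolding affine_mod_square_def by metis
  have "padic_cong 2 (f t + g t) (u + u' + of_nat CARD('p) * (\<Sum>i<n. (v i + v' i) * to_fract (t i)))" for t
    using padic_cong_add[OF f(3) g(3), of t t] by (simp add: sum.distrib algebra_simps)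
  then show ?thesis
    unfolding affine_mod_square_def using f g
    by (intro exI[of _ "u + u'"] exI[of _ "\<lambda>i. v i + v' i"]) (auto intro: padic_ideal_add)
qed

text \<open>The only term outside the affine form is the product of the two linear parts, and it
  carries p^2.\<close>

lemma affine_mod_square_mult:
  fixes f g :: "(nat \<Rightarrow> 'p :: prime_card padic_int) \<Rightarrow> 'p padic"
  assumes "affine_mod_square n f" "affine_mod_square n g"
  shows "affine_mod_square n (\<lambda>t. f t * g t)"
proof -
  let ?p = "of_nat CARD('p) :: 'p padic"
  obtain u v where f: "u \<in> padic_ideal 0" "\<And>i. v i \<in> padic_ideal 0"
    "\<And>t. padic_cong 2 (f t) (u + ?p * (\<Sum>i<n. v i * to_fract (t i)))"
    using assms(1) unfolding affine_mod_square_def by metis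
  obtain u' v' where g: "u' \<in> padic_ideal 0" "\<And>i. v' i \<in> padic_ideal 0"
    "\<And>t. padic_cong 2 (g t) (u' + ?p * (\<Sum>i<n. v' i * to_fract (t i)))"
    using assms(2) unfolding affine_mod_square_def by metis
  have "padic_cong 2 (f t * g t) (u * u' + ?p * (\<Sum>i<n. (u * v' i + u' * v i) * to_fract (t i)))" for t
  proof -
    let ?L = "\<Sum>i<n. v i * to_fract (t i)" and ?L' = "\<Sum>i<n. v' i * to_fract (t i)"
    have L: "?L \<in> padic_ideal 0" "?L' \<in> padic_ideal 0"
      using f(2) g(2) by (auto intro: integral_linear_form)
    have int: "u + ?p * ?L \<in> padic_ideal 0" "g t \<in> padic_ideal 0"
      using f(1) g(1) L by (auto intro!: padic_ideal_add integral_mult padic_cong_integral[OF g(3)])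
    have eq: "(u + ?p * ?L) * (u' + ?p * ?L') - (u * u' + ?p * (\<Sum>i<n. (u * v' i + u' * v i) * to_fract (t i)))
        = ?p * (?p * (?L * ?L'))"
      by (simp add: sum.distrib distrib_right mult.assoc flip: sum_distrib_left) (simp add: algebra_simps)
    have "?p * (?p * (?L * ?L')) \<in> padic_ideal 2"
      using L by (auto simp: numeral_2_eq_2 intro!: CARD_mult_ideal integral_mult)
    then have "padic_cong 2 ((u + ?p * ?L) * (u' + ?p * ?L')) (u * u' + ?p * (\<Sum>i<n. (u * v' i + u' * v i) * to_fract (t i)))"
      unfolding padic_cong_iff eq .
    then show ?thesis
      by (rule padic_cong_trans[OF padic_cong_mult[OF f(3) g(3) int]])
  qed
  then show ?thesis
    unfolding affine_mod_square_def using f g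
    by (intro exI[of _ "u * u'"] exI[of _ "\<lambda>i. u * v' i + u' * v i"])
       (auto intro!: padic_ideal_add integral_mult)
qed

text \<open>Modulo p^2 the inverse of u + p L is u^(-1) - p u^(-2) L, the start of the geometric
  series. That u is a unit follows from the value of f at t = 0.\<close>

lemma affine_mod_square_inverse:
  fixes f :: "(nat \<Rightarrow> 'p :: prime_card padic_int) \<Rightarrow> 'p padic"
  assumes "affine_mod_square n f" "\<And>t. f t \<in> padic_units"
  shows "affine_mod_square n (\<lambda>t. inverse (f t))"
proof -
  let ?p = "of_nat CARD('p) :: 'p padic"
  obtain u v where f: "u \<in> padic_ideal 0" "\<And>i. v i \<in> padic_ideal 0"
    "\<And>t. padic_cong 2 (f t) (u + ?p * (\<Sum>i<n. v i * to_fract (t i)))"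
    using assms(1) unfolding affine_mod_square_def by metis
  have "padic_cong 2 u (f (\<lambda>_. 0))" using f(3)[of "\<lambda>_. 0"] by (simp add: padic_cong_sym)
  then have "padic_cong 1 u (f (\<lambda>_. 0))"
    unfolding padic_cong_iff by (rule padic_ideal_antimono) simp
  then have u: "u \<in> padic_units" using assms(2) padic_cong_unit by blast
  then have u0: "u \<noteq> 0" by (rule padic_units_nonzero)
  note inv = padic_units_inverse_integral[OF u]
  have "padic_cong 2 (inverse (f t)) (inverse u + ?p * (\<Sum>i<n. - (inverse u * inverse u * v i) * to_fract (t i)))" for t
  proof -
    let ?L = "\<Sum>i<n. v i * to_fract (t i)"
    let ?R = "inverse u + ?p * (\<Sum>i<n. - (inverse u * inverse u * v i) * to_fract (t i))"
    have L: "?L \<in> padic_ideal 0" using f(2) by (rule integral_linear_form)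
    have R: "?R = inverse u - ?p * (inverse u * inverse u * ?L)"
      by (simp add: mult.assoc sum_negf flip: sum_distrib_left)
    have Rint: "?R \<in> padic_ideal 0"
      unfolding R using L inv by (intro padic_ideal_diff integral_mult) auto
    have "1 - (u + ?p * ?L) * ?R = ?p * (?p * (inverse u * inverse u * ?L * ?L))"
      unfolding R using u0 by (simp add: algebra_simps)
    also have "\<dots> \<in> padic_ideal 2"
      using L inv by (auto simp: numeral_2_eq_2 intro!: CARD_mult_ideal integral_mult)
    finally have 1: "padic_cong 2 1 ((u + ?p * ?L) * ?R)" by (simp add: padic_cong_iff)
    have "u + ?p * ?L \<in> padic_ideal 0" using f(1) L by (intro padic_ideal_add integral_mult) auto
    then have "padic_cong 2 (f t * ?R) ((u + ?p * ?L) * ?R)"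
      using f(3) Rint by (intro padic_cong_mult) auto
    then have "padic_cong 2 1 (f t * ?R)" using 1 padic_cong_sym padic_cong_trans by blast
    then have "padic_cong 2 (inverse (f t) * 1) (inverse (f t) * (f t * ?R))"
      using assms(2) by (intro padic_cong_mult padic_units_inverse_integral) auto
    then show ?thesis
      by (simp only: mult.assoc[symmetric] left_inverse[OF padic_units_nonzero[OF assms(2)]] mult_1_left mult_1_right)
  qed
  then show ?thesis
    unfolding affine_mod_square_def using f inv
    by (intro exI[of _ "inverse u"] exI[of _ "\<lambda>i. - (inverse u * inverse u * v i)"])
       (auto intro!: padic_ideal_uminus integral_mult)
qed

lemma affine_mod_square_divide:
  assumes "affine_mod_square n f" "affine_mod_square n g" "\<And>t. g t \<in> padic_units"
  shows "affine_mod_square n (\<lambda>t. f t / g t)"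
  unfolding divide_inverse by (intro affine_mod_square_mult affine_mod_square_inverse assms)

lemma affine_mod_square_diff:
  assumes "affine_mod_square n f" "affine_mod_square n g"
  shows "affine_mod_square n (\<lambda>t. f t - g t)"
proof -
  have "affine_mod_square n (\<lambda>t. f t + (- 1) * g t)"
    using assms padic_ideal_uminus[OF one_integral]
    by (intro affine_mod_square_add affine_mod_square_mult affine_mod_square_const) auto
  then show ?thesis by simp
qed

lemma affine_mod_square_pochhammer:
  "affine_mod_square n f \<Longrightarrow> affine_mod_square n (\<lambda>t. pochhammer (f t) k)"
  by (induction k)
     (auto simp: pochhammer_Suc intro!: affine_mod_square_const affine_mod_square_mult affine_mod_square_add)

lemma affine_mod_square_sum:
  "(\<And>k. k \<in> A \<Longrightarrow> affine_mod_square n (f k)) \<Longrightarrow> affine_mod_square n (\<lambda>t. \<Sum>k\<in>A. f k t)"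
  by (induction A rule: infinite_finite_induct)
     (auto intro: affine_mod_square_const affine_mod_square_add)

text \<open>
  Vanishing on the hyperplane kills the constant term and all slopes but one, so a single value
  off the hyperplane determines the function modulo \<open>p\<^sup>2\<close>.
\<close>

lemma affine_mod_square_vanishing:
  fixes f :: "(nat \<Rightarrow> 'p :: prime_card padic_int) \<Rightarrow> 'p padic"
  assumes "affine_mod_square n f" "i < n" "\<And>t. t i = 0 \<Longrightarrow> f t = 0" "t' i = 1"
  shows "padic_cong 2 (f t) (to_fract (t i) * f t')"
proof -
  let ?p = "of_nat CARD('p) :: 'p padic"
  obtain u v where f: "u \<in> padic_ideal 0" "\<And>i. v i \<in> padic_ideal 0"
    "\<And>t. padic_cong 2 (f t) (u + ?p * (\<Sum>i<n. v i * to_fract (t i)))"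
    using assms(1) unfolding affine_mod_square_def by metis
  have u: "u \<in> padic_ideal 2"
    using f(3)[of "\<lambda>_. 0"] assms(3)[of "\<lambda>_. 0"] padic_ideal_uminus[of "- u" 2] by (simp add: padic_cong_iff)
  have v: "?p * v j \<in> padic_ideal 2" if "j < n" "j \<noteq> i" for j
  proof -
    \<comment> \<open>The j-th unit vector lies on the hyperplane and isolates the slope
      \<open>v j\<close>.\<close>
    define t0 :: "nat \<Rightarrow> 'p padic_int" where "t0 l = (if l = j then 1 else 0)" for l
    have "(\<Sum>l<n. v l * to_fract (t0 l)) = (\<Sum>l<n. if l = j then v l else 0)"
      by (intro sum.cong) (auto simp: t0_def)
    also have "\<dots> = v j" using that(1) by simp
    finally have "padic_cong 2 0 (u + ?p * v j)"
      using f(3)[of t0] assms(3)[of t0] that(2) by (simp add: t0_def)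
    then have "u + ?p * v j \<in> padic_ideal 2"
      using padic_cong_sym unfolding padic_cong_iff by fastforce
    from padic_ideal_diff[OF this u] show ?thesis by simp
  qed
  have main: "padic_cong 2 (f s) (?p * v i * to_fract (s i))" for s
  proof -
    have "(\<Sum>l<n. v l * to_fract (s l)) = v i * to_fract (s i) + (\<Sum>l\<in>{..<n} - {i}. v l * to_fract (s l))"
      using assms(2) by (intro sum.remove) auto
    then have "u + ?p * (\<Sum>l<n. v l * to_fract (s l)) - ?p * v i * to_fract (s i)
        = u + (\<Sum>l\<in>{..<n} - {i}. ?p * v l * to_fract (s l))"
      by (simp add: algebra_simps sum_distrib_left)
    also have "\<dots> \<in> padic_ideal 2"
    proof (intro padic_ideal_add padic_ideal_sum u)
      fix l assume "l \<in> {..<n} - {i}"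
      then show "?p * v l * to_fract (s l) \<in> padic_ideal 2"
        using padic_ideal_integral[OF v to_fract_integral] by simp
    qed
    finally have "padic_cong 2 (u + ?p * (\<Sum>l<n. v l * to_fract (s l))) (?p * v i * to_fract (s i))"
      by (simp add: padic_cong_iff)
    then show ?thesis by (rule padic_cong_trans[OF f(3)])
  qed
  have "padic_cong 2 (to_fract (t i) * f t') (to_fract (t i) * (?p * v i * to_fract (t' i)))"
    using f(2) by (intro padic_cong_mult main padic_cong_refl to_fract_integral
      padic_cong_integral[OF main] padic_ideal_integral integral_mult[OF of_nat_integral])
  then have "padic_cong 2 (to_fract (t i) * f t') (?p * v i * to_fract (t i))"
    using assms(4) by (simp add: ac_simps)
  then show ?thesis using main[of t] padic_cong_sym padic_cong_trans by blast
qed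

section \<open>Gamma values modulo p\<close>

text \<open>For m \<le> p no factor is skipped, since every positive j < m is prime to p. The range
  1..p represents all residue classes, so this determines Gamma modulo p everywhere.\<close>

lemma Gamma_padic_nat_fact:
  assumes "1 \<le> m" "m \<le> p"
  shows "Gamma_padic_nat p m = (- 1) ^ m * fact (m - 1)"
proof -
  have "{j. 1 \<le> j \<and> j < m \<and> \<not> p dvd j} = {1..m - 1}"
    using assms by (auto dest: dvd_imp_le)
  then show ?thesis by (simp add: Gamma_padic_nat_def fact_prod)
qed

lemma Gamma_padic_cong_fact:
  fixes z :: "'p :: prime_card padic_int"
  assumes "odd CARD('p)" "padic_cong 1 (to_fract z) (of_nat m)" "1 \<le> m" "m \<le> CARD('p)"
  shows "padic_cong 1 (to_fract (Gamma_padic z)) ((- 1) ^ m * fact (m - 1))"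
proof -
  have "to_fract (z - of_nat m) \<in> padic_ideal 1" using assms(2) by (simp add: padic_cong_iff)
  then have "residue_seq (z - of_nat m) 1 = 0"
    unfolding to_fract_ideal_1_iff of_nat_CARD_dvd_iff .
  then have "(residue_seq z 1 - int m) mod int CARD('p) = 0"
    by (simp add: minus_padic_int.rep_eq residue_seq_of_nat mod_simps)
  then have "[residue_seq z 1 = int m] (mod int CARD('p))"
    by (simp add: cong_iff_dvd_diff dvd_eq_mod_eq_0)
  then have "[int (nat (residue_seq z 1)) = int m] (mod int (CARD('p)))"
    using residue_seq_bounds[of z 1] by simp
  then have "[nat (residue_seq z 1) = m] (mod CARD('p) ^ 1)"
    by (simp only: cong_int_iff power_one_right)
  from Gamma_padic_nat_cong[OF prime_card assms(1) this]
  have "residue_seq (Gamma_padic z) 1 = Gamma_padic_nat CARD('p) m mod int CARD('p)"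
    unfolding residue_seq_Gamma_padic[OF assms(1)] by (simp add: cong_def)
  then have "residue_seq (Gamma_padic z - of_int (Gamma_padic_nat CARD('p) m)) 1 = 0"
    by (simp add: minus_padic_int.rep_eq residue_seq_of_int mod_simps)
  then have "to_fract (Gamma_padic z - of_int (Gamma_padic_nat CARD('p) m)) \<in> padic_ideal 1"
    unfolding to_fract_ideal_1_iff of_nat_CARD_dvd_iff .
  then show ?thesis
    unfolding padic_cong_iff to_fract_diff to_fract_of_int Gamma_padic_nat_fact[OF assms(3,4)]
    by simp
qed

section \<open>The congruence\<close>

text \<open>The two occurrences of \<alpha> are separated as x and y; for x = y the factor (1 + x -
  y)_k is a second k!. The quotient (x + 2k) / x stands for (x/2 + 1)_k / (x/2)_k, so no half
  parameters occur.\<close>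

definition well_poised_term :: "'a \<Rightarrow> 'a \<Rightarrow> 'a \<Rightarrow> 'a \<Rightarrow> 'a \<Rightarrow> 'a \<Rightarrow> nat \<Rightarrow> 'a :: field_char_0" where
  "well_poised_term x y b c d e k =
     pochhammer x k * (x + 2 * of_nat k) / x * pochhammer y k * pochhammer b k * pochhammer c k
       * pochhammer d k * pochhammer e k
     / (fact k * pochhammer (1 + x - y) k * pochhammer (1 + x - b) k * pochhammer (1 + x - c) k
         * pochhammer (1 + x - d) k * pochhammer (1 + x - e) k)"

text \<open>At x = -n the summand is 2k - n times a product of six reflecting quotients. The base
  supplies one of them, (-n)_k being paired with (1)_k = k!, so the number of signs (-1)^n is
  even.\<close>

lemma well_poised_term_sum_eq_0:
  fixes y b c d e :: "'a :: field_char_0"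
  assumes "pochhammer (1 - of_nat n - y) n \<noteq> 0" "pochhammer (1 - of_nat n - b) n \<noteq> 0"
    "pochhammer (1 - of_nat n - c) n \<noteq> 0" "pochhammer (1 - of_nat n - d) n \<noteq> 0"
    "pochhammer (1 - of_nat n - e) n \<noteq> 0"
  shows "(\<Sum>k\<le>n. well_poised_term (- of_nat n) y b c d e k) = 0"
proof -
  define \<phi> where "\<phi> z k = pochhammer z k / pochhammer (1 - of_nat n - z) k" for z :: 'a and k
  \<comment> \<open>For n = 0 the division by zero makes F vanish, in agreement with the summand,
    whose division by x is then also a division by zero.\<close>
  define F where "F k = \<phi> (- of_nat n) k * \<phi> y k * \<phi> b k * \<phi> c k * \<phi> d k * \<phi> e k / (- of_nat n)" for k
  have "F (n - k) = F k" if "k \<le> n" for k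
  proof -
    have one: "pochhammer (1 - of_nat n - (- of_nat n)) n \<noteq> (0 :: 'a)"
      by (simp flip: pochhammer_fact)
    have sgn: "(- 1) ^ n * ((- 1) ^ n * z) = (z :: 'a)" for z
    proof -
      have "(- 1) ^ n * (- 1) ^ n = (1 :: 'a)" by (simp flip: power_mult_distrib)
      then show ?thesis by (simp only: mult.assoc[symmetric] mult_1_left)
    qed
    have refl: "\<phi> z (n - k) = (- 1) ^ n * \<phi> z k" if "pochhammer (1 - of_nat n - z) n \<noteq> 0" for z
      unfolding \<phi>_def using well_poised_factor_reflect[OF that \<open>k \<le> n\<close>] .
    show ?thesis
      unfolding F_def refl[OF one] assms[THEN refl] by (simp add: sgn ac_simps)
  qed
  then have "(\<Sum>k\<le>n. (2 * of_nat k - of_nat n) * F k) = 0"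
    by (rule well_poised_antisymmetric_sum)
  moreover have "well_poised_term (- of_nat n) y b c d e k = (2 * of_nat k - of_nat n) * F k" for k
    by (simp add: well_poised_term_def F_def \<phi>_def pochhammer_fact ac_simps)
  ultimately show ?thesis by simp
qed

text \<open>Two parameters are negative integers. Whipple's formula is terminated by -n, and -a
  takes the place of its parameter \<open>b\<close>: the sum over k \<le> n stops at a anyway, and
  the 4F3 acquires the lower parameter 1 + x + a, which is 1 + p for x = p - a.\<close>

lemma sum_well_poised_term_whipple:
  fixes x c d e :: "'a :: field_char_0"
  assumes "a \<le> n" "pochhammer x (Suc (2 * n)) \<noteq> 0"
    "pochhammer (1 + x + of_nat a) n \<noteq> 0" "pochhammer (1 + x - c) n \<noteq> 0"
    "pochhammer (1 + x - d) n \<noteq> 0" "pochhammer (1 + x - e) n \<noteq> 0"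
    "pochhammer (d + e - x - of_nat n) n \<noteq> 0"
  shows "(\<Sum>k\<le>a. well_poised_term x (- of_nat a) d e (- of_nat n) c k)
    = pochhammer (1 + x) n * pochhammer (1 + x - d - e) n
        / (pochhammer (1 + x - d) n * pochhammer (1 + x - e) n)
      * (\<Sum>j\<le>n. pochhammer (1 + x + of_nat a - c) j * pochhammer d j * pochhammer e j * pochhammer (- of_nat n) j
            / (fact j * pochhammer (1 + x + of_nat a) j * pochhammer (1 + x - c) j * pochhammer (d + e - x - of_nat n) j))"
proof -
  have "(\<Sum>k\<le>a. well_poised_term x (- of_nat a) d e (- of_nat n) c k)
      = (\<Sum>k\<le>n. well_poised_term x (- of_nat a) d e (- of_nat n) c k)"
    using assms(1) by (intro sum.mono_neutral_left) (auto simp: well_poised_term_def pochhammer_of_nat_eq_0_lemma)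
  also have "\<dots> = (\<Sum>k\<le>n. pochhammer x k * (x + 2 * of_nat k) / x * pochhammer (- of_nat a) k * pochhammer c k
            * pochhammer d k * pochhammer e k * pochhammer (- of_nat n) k
            / (fact k * pochhammer (1 + x - (- of_nat a)) k * pochhammer (1 + x - c) k
              * pochhammer (1 + x - d) k * pochhammer (1 + x - e) k * pochhammer (1 + x + of_nat n) k))"
    by (intro sum.cong) (simp_all add: well_poised_term_def ac_simps)
  also have "\<dots> = pochhammer (1 + x) n * pochhammer (1 + x - d - e) n
        / (pochhammer (1 + x - d) n * pochhammer (1 + x - e) n)
      * (\<Sum>j\<le>n. pochhammer (1 + x - (- of_nat a) - c) j * pochhammer d j * pochhammer e j * pochhammer (- of_nat n) j
            / (fact j * pochhammer (1 + x - (- of_nat a)) j * pochhammer (1 + x - c) j * pochhammer (d + e - x - of_nat n) j))"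
    using assms by (intro whipple_7F6) simp_all
  finally show ?thesis by simp
qed

text \<open>(w)_k divides (w)_(p-1), so it is not divisible by p^2. If it contains p at all, then so
  does (z)_k by the last assumption, and the factor cancels.\<close>

lemma pochhammer_quotient_integral:
  fixes w :: "'p :: prime_card padic_int"
  assumes "padic_cong 1 z (of_int m)" "padic_cong 1 (to_fract w) (of_int n)"
    and "\<not> of_nat (CARD('p) ^ 2) dvd pochhammer w (CARD('p) - 1)" "k \<le> CARD('p) - 1"
    and "\<And>i. i < k \<Longrightarrow> int CARD('p) dvd n + int i \<Longrightarrow> \<exists>j<k. int CARD('p) dvd m + int j"
  shows "pochhammer z k / pochhammer (to_fract w) k \<in> padic_ideal 0"
proof -
  have z: "pochhammer z k \<in> padic_ideal 0"
    by (intro integral_pochhammer padic_cong_integral[OF assms(1) of_int_integral])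
  show ?thesis
  proof (cases "\<exists>i<k. int CARD('p) dvd n + int i")
    case False
    then have "pochhammer (to_fract w) k \<in> padic_units"
      by (intro unit_pochhammer[OF assms(2)]) auto
    then show ?thesis using z by (rule padic_ideal_divide_unit[rotated])
  next
    case True
    then obtain j where "j < k" "int CARD('p) dvd m + int j" using assms(5) by blast
    then have "pochhammer z k \<in> padic_ideal 1" using pochhammer_ideal_1[OF assms(1)] by blast
    then obtain y where y: "pochhammer z k = of_nat CARD('p) * to_fract y"
      by (auto simp: padic_ideal_def)
    have "\<not> of_nat (CARD('p) ^ 2) dvd pochhammer w k"
      using assms(3) pochhammer_product[OF assms(4), of w] by (metis dvd_mult2)
    note CARD_divide_integral(2)[OF this]
    moreover have "pochhammer z k / pochhammer (to_fract w) k
        = of_nat CARD('p) / to_fract (pochhammer w k) * to_fract y"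
      by (simp add: y to_fract_pochhammer)
    ultimately show ?thesis using padic_ideal_integral[OF _ to_fract_integral] by metis
  qed
qed

text \<open>Allows \<beta>, \<gamma>, \<delta> to be rotated in both series when the smallest
  residue is moved to the last place.\<close>

lemma truncated_hypergeometric_mset:
  assumes "mset as = mset as'" "mset bs = mset bs'"
  shows "truncated_hypergeometric as bs z n = truncated_hypergeometric as' bs' z n"
proof -
  have "(\<Prod>x\<leftarrow>xs. f x) = (\<Prod>x\<leftarrow>ys. f x)" if "mset xs = mset ys" for xs ys and f :: "'a \<Rightarrow> 'a"
  proof -
    have "prod_mset (mset (map f xs)) = prod_mset (mset (map f ys))" using that by simp
    then show ?thesis by (simp only: prod_mset_prod_list)
  qed
  note this[OF assms(1)] this[OF assms(2)]
  then show ?thesis unfolding truncated_hypergeometric_def by (simp only:)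
qed

lemma int_dvd_less_twice:
  assumes "int p dvd n" "0 < n" "n < 2 * int p"
  shows "n = int p"
proof -
  obtain q where q: "n = int p * q" using assms(1) by (rule dvdE)
  then have "0 < q" using assms(2) by (simp add: zero_less_mult_iff)
  moreover have "q < 2" using assms(2,3) q by (simp add: mult.commute[of 2] mult_less_cancel_left)
  ultimately show ?thesis using q by simp
qed

lemma fact_integral [simp]: "fact k \<in> padic_ideal 0"
  using of_nat_integral[of "fact k"] by simp

lemma fact_unit: "k < CARD('p) \<Longrightarrow> fact k \<in> (padic_units :: 'p :: prime_card padic set)"
  using of_nat_unit_iff[of "fact k", where 'p = 'p] prime_dvd_fact_iff[OF prime_card[where 'a = 'p]] by simp

lemma pochhammer_of_nat_nonzero: "0 < m \<Longrightarrow> pochhammer (of_nat m) k \<noteq> (0 :: 'a :: field_char_0)"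
  by (simp add: pochhammer_eq_0_iff eq_neg_iff_add_eq_0 flip: of_nat_add)

lemma pochhammer_Suc_of_nat: "pochhammer (1 + of_nat m) k = (fact (m + k) / fact m :: 'a :: field_char_0)"
  using pochhammer_product'[of "1 :: 'a" m k] by (simp flip: pochhammer_fact)

lemma padic_cong_of_int:
  "[m = n] (mod int CARD('p)) \<Longrightarrow> padic_cong 1 (of_int m) (of_int n :: 'p :: prime_card padic)"
  unfolding padic_cong_iff of_int_diff[symmetric] of_int_ideal_1_iff by (simp add: cong_iff_dvd_diff)

lemma padic_cong_CARD: "padic_cong 1 (of_nat CARD('p)) (0 :: 'p :: prime_card padic)"
  using of_nat_CARD_power_ideal[of 1, where 'p = 'p] by (simp add: padic_cong_iff)

section \<open>The left-hand side modulo p^2, with d the smallest of b, c, d\<close>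

text \<open>\<open>d_le\<close> turns the minimum in condition (ii) into d and leaves b and c
  unordered, so cyclic rotations of \<beta>, \<gamma>, \<delta> reach every case.
  \<open>a_pos\<close> makes \<alpha> a unit and puts a multiple of p among the d factors that start
  at p - a + 1.\<close>

locale residue_data =
  fixes \<alpha> \<beta> \<gamma> \<delta> \<epsilon> :: "'p :: prime_card padic_int" and a b c d e :: nat
  assumes odd_CARD: "odd CARD('p)"
    and res_\<alpha>: "padic_cong 1 (to_fract \<alpha>) (- of_nat a)"
    and res_\<beta>: "padic_cong 1 (to_fract \<beta>) (- of_nat b)"
    and res_\<gamma>: "padic_cong 1 (to_fract \<gamma>) (- of_nat c)"
    and res_\<delta>: "padic_cong 1 (to_fract \<delta>) (- of_nat d)"
    and res_\<epsilon>: "padic_cong 1 (to_fract \<epsilon>) (- of_nat e)"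
    and a_pos: "0 < a"
    and a_le: "a \<le> b" "a \<le> c" "a \<le> d" "a \<le> e"
    and less_CARD: "b < CARD('p)" "c < CARD('p)" "d < CARD('p)" "e < CARD('p)"
    and d_le: "d \<le> b" "d \<le> c"
    and sum_less: "b + c + d < CARD('p) + a" "d + e < CARD('p) + a"
    and not_dvd_\<beta>: "\<not> of_nat (CARD('p) ^ 2) dvd pochhammer (\<alpha> - \<beta> + 1) (CARD('p) - 1)"
    and not_dvd_\<gamma>: "\<not> of_nat (CARD('p) ^ 2) dvd pochhammer (\<alpha> - \<gamma> + 1) (CARD('p) - 1)"
    and not_dvd_\<delta>: "\<not> of_nat (CARD('p) ^ 2) dvd pochhammer (\<alpha> - \<delta> + 1) (CARD('p) - 1)"
    and not_dvd_\<epsilon>: "\<not> of_nat (CARD('p) ^ 2) dvd pochhammer (\<alpha> - \<epsilon> + 1) (CARD('p) - 1)"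
    and not_dvd_sum: "\<not> of_nat (CARD('p) ^ 2) dvd pochhammer (\<beta> + \<gamma> + \<delta> - \<alpha>) (CARD('p) - 1)"
begin

abbreviation "A \<equiv> to_fract \<alpha>"
abbreviation "B \<equiv> to_fract \<beta>"
abbreviation "C \<equiv> to_fract \<gamma>"
abbreviation "D \<equiv> to_fract \<delta>"
abbreviation "E \<equiv> to_fract \<epsilon>"
abbreviation "P \<equiv> of_nat CARD('p) :: 'p padic"

lemma padic_cong_one_add_diff:
  assumes "padic_cong 1 x (- of_nat a)" "padic_cong 1 z (- of_nat m)"
  shows "padic_cong 1 (1 + x - z) (of_int (1 + int m - int a))"
  using padic_cong_diff[OF padic_cong_add[OF padic_cong_refl[of 1 1] assms(1)] assms(2)]
  by (simp add: algebra_simps)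

text \<open>The factors are congruent to m - a + 1, ..., m - a + k, all strictly between 0 and
  p.\<close>

lemma unit_pochhammer_one_add_diff:
  assumes "padic_cong 1 x (- of_nat a)" "padic_cong 1 z (- of_nat m)"
    and "a \<le> m" "m - a + k < CARD('p)"
  shows "pochhammer (1 + x - z :: 'p padic) k \<in> padic_units"
proof (rule unit_pochhammer[OF padic_cong_one_add_diff[OF assms(1,2)]])
  fix i assume "i < k"
  then have "0 < 1 + int m - int a + int i" "1 + int m - int a + int i < int CARD('p)"
    using assms(3,4) by auto
  then show "\<not> int CARD('p) dvd 1 + int m - int a + int i" by (rule zdvd_not_zless)
qed

text \<open>The denominator meets a multiple of p at index p - 1 - n + a, the numerator at index m.
  The inequality m + n < p + a says that m comes no later, so the numerator contains p whenever the
  denominator does.\<close>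

lemma quotient_integral:
  assumes "padic_cong 1 y (- of_nat m)" "padic_cong 1 (to_fract \<zeta>) (- of_nat n)"
    and "\<not> of_nat (CARD('p) ^ 2) dvd pochhammer (\<alpha> - \<zeta> + 1) (CARD('p) - 1)"
    and "a \<le> n" "n < CARD('p)" "m + n < CARD('p) + a" "k \<le> CARD('p) - 1"
  shows "pochhammer y k / pochhammer (1 + A - to_fract \<zeta>) k \<in> padic_ideal 0"
proof -
  have eq: "1 + A - to_fract \<zeta> = to_fract (\<alpha> - \<zeta> + 1)" by simp
  have "padic_cong 1 y (of_int (- int m))" using assms(1) by simp
  then show ?thesis
    unfolding eq
  proof (rule pochhammer_quotient_integral[OF _ _ assms(3,7)])
    show "padic_cong 1 (to_fract (\<alpha> - \<zeta> + 1)) (of_int (1 + int n - int a))"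
      unfolding eq[symmetric] by (rule padic_cong_one_add_diff[OF res_\<alpha> assms(2)])
    fix i assume i: "i < k" "int CARD('p) dvd 1 + int n - int a + int i"
    have "1 + int n - int a + int i = int CARD('p)"
      using i assms(4,5,7) by (intro int_dvd_less_twice) auto
    then show "\<exists>j<k. int CARD('p) dvd - int m + int j"
      using i assms(6) by (intro exI[of _ m]) auto
  qed
qed

lemma unit_\<alpha>: "A \<in> padic_units"
proof (rule padic_cong_unit)
  show "padic_cong 1 A (of_int (- int a))" using res_\<alpha> by simp
  have "\<not> int CARD('p) dvd int a" using a_pos a_le less_CARD by (intro zdvd_not_zless) auto
  then show "of_int (- int a) \<in> (padic_units :: 'p padic set)"
    unfolding of_int_unit_iff by simp
qed

text \<open>(\<alpha>)_k occurs twice and each copy contains p. The other quotients are formed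
  crosswise, \<beta> over 1 + \<alpha> - \<gamma> and \<gamma> over 1 + \<alpha> - \<beta>, likewise
  \<delta> with \<epsilon>, because condition (ii) bounds b + c and d + e but neither 2b nor
  2e.\<close>

lemma well_poised_term_tail:
  assumes "a < k" "k \<le> CARD('p) - 1"
  shows "well_poised_term A A B C D E k \<in> padic_ideal 2"
proof -
  have k: "k < CARD('p)" using assms by linarith
  have eq: "well_poised_term A A B C D E k
      = pochhammer A k * pochhammer A k * ((A + 2 * of_nat k) / A) * (1 / (fact k * fact k))
        * (pochhammer B k / pochhammer (1 + A - C) k) * (pochhammer C k / pochhammer (1 + A - B) k)
        * (pochhammer D k / pochhammer (1 + A - E) k) * (pochhammer E k / pochhammer (1 + A - D) k)"
    by (simp add: well_poised_term_def ac_simps flip: pochhammer_fact)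
  have "pochhammer A k \<in> padic_ideal 1"
    using assms res_\<alpha> by (intro pochhammer_ideal_1[of _ "- int a" a]) auto
  then have 1: "pochhammer A k * pochhammer A k \<in> padic_ideal 2"
    using padic_ideal_mult[of "pochhammer A k" 1 "pochhammer A k" 1] by (simp add: numeral_2_eq_2)
  have 4: "pochhammer B k / pochhammer (1 + A - C) k \<in> padic_ideal 0"
    using assms a_le less_CARD sum_less
    by (intro quotient_integral[OF res_\<beta> res_\<gamma> not_dvd_\<gamma>]) auto
  have 5: "pochhammer C k / pochhammer (1 + A - B) k \<in> padic_ideal 0"
    using assms a_le less_CARD sum_less
    by (intro quotient_integral[OF res_\<gamma> res_\<beta> not_dvd_\<beta>]) auto
  have 6: "pochhammer D k / pochhammer (1 + A - E) k \<in> padic_ideal 0"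
    using assms a_le less_CARD sum_less
    by (intro quotient_integral[OF res_\<delta> res_\<epsilon> not_dvd_\<epsilon>]) auto
  have 7: "pochhammer E k / pochhammer (1 + A - D) k \<in> padic_ideal 0"
    using assms a_le less_CARD sum_less
    by (intro quotient_integral[OF res_\<epsilon> res_\<delta> not_dvd_\<delta>]) auto
  have 2: "(A + 2 * of_nat k) / A \<in> padic_ideal 0"
    by (intro padic_ideal_divide_unit unit_\<alpha> padic_ideal_add integral_mult) auto
  have 3: "1 / (fact k * fact k) \<in> (padic_ideal 0 :: 'p padic set)"
    using k by (intro padic_ideal_divide_unit padic_units_mult fact_unit) auto
  show ?thesis
    unfolding eq by (rule padic_ideal_integral[OF padic_ideal_integral[OF padic_ideal_integral[OF
      padic_ideal_integral[OF padic_ideal_integral[OF padic_ideal_integral[OF 1 2] 3] 4] 5] 6] 7])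
qed

text \<open>Coordinate 0 moves the base x and coordinate 1 the second copy of \<alpha>. Stopping at
  a keeps every denominator a unit for all t, since m - a + k \<le> m < p for each residue
  m.\<close>

definition perturbed_sum :: "(nat \<Rightarrow> 'p padic_int) \<Rightarrow> 'p padic" where
  "perturbed_sum t = (\<Sum>k\<le>a. well_poised_term
     (- of_nat a + P * to_fract (t 0)) (- of_nat a + P * to_fract (t 1))
     (- of_nat b + P * to_fract (t 2)) (- of_nat c + P * to_fract (t 3))
     (- of_nat d + P * to_fract (t 4)) (- of_nat e + P * to_fract (t 5)) k)"

lemma padic_cong_perturbed: "padic_cong 1 (- of_nat m + P * to_fract s) (- of_nat m)"
  using CARD_mult_ideal[OF to_fract_integral[of s]] by (simp add: padic_cong_iff)

lemma unit_pochhammer_perturbed: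
  assumes "a \<le> m" "m < CARD('p)" "k \<le> a"
  shows "pochhammer (1 + (- of_nat a + P * to_fract s) - (- of_nat m + P * to_fract s')) k \<in> padic_units"
  using assms by (intro unit_pochhammer_one_add_diff[OF padic_cong_perturbed padic_cong_perturbed]) auto

lemma affine_perturbed_sum: "affine_mod_square 6 perturbed_sum"
proof -
  have unit: "- of_nat a + P * to_fract s \<in> padic_units" for s
  proof (rule padic_cong_unit)
    show "padic_cong 1 (- of_nat a + P * to_fract s) A"
      using padic_cong_trans[OF padic_cong_perturbed padic_cong_sym[OF res_\<alpha>]] .
  qed (rule unit_\<alpha>)
  have coord: "affine_mod_square 6 (\<lambda>t. - of_nat m + P * to_fract (t i))" if "i < 6" for m i
    using that by (intro affine_mod_square_coordinate padic_ideal_uminus) auto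
  note aff = coord affine_mod_square_const affine_mod_square_divide affine_mod_square_mult
    affine_mod_square_pochhammer affine_mod_square_diff affine_mod_square_add
  have "affine_mod_square 6 (\<lambda>t. \<Sum>k\<le>a. well_poised_term
     (- of_nat a + P * to_fract (t 0)) (- of_nat a + P * to_fract (t 1))
     (- of_nat b + P * to_fract (t 2)) (- of_nat c + P * to_fract (t 3))
     (- of_nat d + P * to_fract (t 4)) (- of_nat e + P * to_fract (t 5)) k)"
    unfolding well_poised_term_def
  proof (rule affine_mod_square_sum, goal_cases)
    case (1 k)
    then have k: "k \<le> a" "k < CARD('p)" using a_le less_CARD by auto
    note units = padic_units_mult unit unit_pochhammer_perturbed[OF _ _ k(1)] fact_unit[OF k(2)]
    show ?case by (intro aff units) (use a_le less_CARD in \<open>auto intro: integral_mult\<close>)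
  qed
  then show ?thesis by (simp only: perturbed_sum_def[abs_def])
qed

lemma perturbed_sum_eq_0:
  assumes "t 0 = 0"
  shows "perturbed_sum t = 0"
proof -
  have nz: "pochhammer (1 - of_nat a - (- of_nat m + P * to_fract s)) a \<noteq> 0" if "a \<le> m" "m < CARD('p)" for m s
    using padic_units_nonzero[OF unit_pochhammer_perturbed[OF that, of a 0 s]] by simp
  show ?thesis
    using a_le less_CARD unfolding perturbed_sum_def assms
    by (simp only: to_fract_0 mult_zero_right add_0_right) (intro well_poised_term_sum_eq_0 nz; simp)
qed

text \<open>The value of \<open>perturbed_sum\<close> at t = (1, 0, ..., 0): the base is p - a and
  every other parameter is the negative of its residue.\<close>

definition whipple_sum :: "'p padic" where
  "whipple_sum = (\<Sum>k\<le>a. well_poised_term (of_nat (CARD('p) - a)) (- of_nat a)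
     (- of_nat b) (- of_nat c) (- of_nat d) (- of_nat e) k)"

lemma lhs_cong:
  assumes "A + of_nat a = P * to_fract s"
  shows "padic_cong 2 (\<Sum>k\<le>CARD('p) - 1. well_poised_term A A B C D E k) (to_fract s * whipple_sum)"
proof -
  have rep: "\<exists>s. x = - of_nat m + P * to_fract s" if "padic_cong 1 x (- of_nat m)" for x m
    using that by (auto simp: padic_cong_iff padic_ideal_def algebra_simps)
  obtain sb sc sd se where s: "B = - of_nat b + P * to_fract sb" "C = - of_nat c + P * to_fract sc"
    "D = - of_nat d + P * to_fract sd" "E = - of_nat e + P * to_fract se"
    using rep[OF res_\<beta>] rep[OF res_\<gamma>] rep[OF res_\<delta>] rep[OF res_\<epsilon>] by metis
  have sa: "A = - of_nat a + P * to_fract s" using assms by (simp add: algebra_simps)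
  \<comment> \<open>Both copies of \<alpha> carry the same s, so \<open>t\<close> gives the actual
    series, whereas \<open>t'\<close> moves the base alone.\<close>
  define t where "t i = [s, s, sb, sc, sd, se] ! i" for i
  define t' :: "nat \<Rightarrow> 'p padic_int" where "t' i = (if i = 0 then 1 else 0)" for i
  have "a < CARD('p)" using a_le less_CARD by linarith
  then have "whipple_sum = perturbed_sum t'"
    by (simp add: whipple_sum_def perturbed_sum_def t'_def of_nat_diff)
  moreover have "perturbed_sum t = (\<Sum>k\<le>a. well_poised_term A A B C D E k)"
  proof -
    have "- of_nat a + P * to_fract (t 0) = A" "- of_nat a + P * to_fract (t 1) = A"
      "- of_nat b + P * to_fract (t 2) = B" "- of_nat c + P * to_fract (t 3) = C"
      "- of_nat d + P * to_fract (t 4) = D" "- of_nat e + P * to_fract (t 5) = E"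
      by (simp_all add: t_def s sa)
    then show ?thesis by (simp only: perturbed_sum_def)
  qed
  moreover have "padic_cong 2 (perturbed_sum t) (to_fract (t 0) * perturbed_sum t')"
    by (rule affine_mod_square_vanishing[OF affine_perturbed_sum _ perturbed_sum_eq_0])
      (simp_all add: t'_def)
  ultimately have head: "padic_cong 2 (\<Sum>k\<le>a. well_poised_term A A B C D E k) (to_fract s * whipple_sum)"
    by (simp add: t_def)
  have "{..CARD('p) - 1} = {..a} \<union> {a<..CARD('p) - 1}" using \<open>a < CARD('p)\<close> by auto
  then have "(\<Sum>k\<le>CARD('p) - 1. well_poised_term A A B C D E k)
      = (\<Sum>k\<le>a. well_poised_term A A B C D E k) + (\<Sum>k\<in>{a<..CARD('p) - 1}. well_poised_term A A B C D E k)"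
    by (simp add: sum.union_disjoint ivl_disj_int)
  moreover have "(\<Sum>k\<in>{a<..CARD('p) - 1}. well_poised_term A A B C D E k) \<in> padic_ideal 2"
    by (intro padic_ideal_sum well_poised_term_tail) auto
  ultimately have "padic_cong 2 (\<Sum>k\<le>CARD('p) - 1. well_poised_term A A B C D E k)
      (\<Sum>k\<le>a. well_poised_term A A B C D E k)"
    by (simp add: padic_cong_iff)
  then show ?thesis using head by (rule padic_cong_trans)
qed

end

section \<open>Gamma quotient, Whipple's prefactor and the 4F3 modulo p\<close>

text \<open>Bundling the unit conditions makes the relation stable under division as well as
  multiplication.\<close>

definition unit_cong :: "'p :: prime_card padic \<Rightarrow> 'p padic \<Rightarrow> bool" where
  "unit_cong x y \<longleftrightarrow> padic_cong 1 x y \<and> x \<in> padic_units \<and> y \<in> padic_units"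

lemma unit_congI: "padic_cong 1 x y \<Longrightarrow> y \<in> padic_units \<Longrightarrow> unit_cong x y"
  by (simp add: unit_cong_def padic_cong_unit[unfolded One_nat_def])

lemma unit_cong_mult: "unit_cong x y \<Longrightarrow> unit_cong u v \<Longrightarrow> unit_cong (x * u) (y * v)"
  by (simp add: unit_cong_def padic_cong_mult padic_units_mult padic_units_integral)

lemma unit_cong_divide: "unit_cong x y \<Longrightarrow> unit_cong u v \<Longrightarrow> unit_cong (x / u) (y / v)"
  by (simp add: unit_cong_def padic_cong_divide padic_units_divide padic_units_integral)

lemma unit_cong_pochhammer:
  assumes "padic_cong 1 z (1 + of_nat m)" "m + k < CARD('p)"
  shows "unit_cong (pochhammer z k) (fact (m + k) / fact m :: 'p :: prime_card padic)"
proof (rule unit_congI)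
  show "padic_cong 1 (pochhammer z k) (fact (m + k) / fact m)"
    unfolding pochhammer_Suc_of_nat[symmetric]
    by (intro padic_cong_pochhammer assms padic_ideal_add) auto
  show "fact (m + k) / fact m \<in> (padic_units :: 'p padic set)"
    using assms(2) by (intro padic_units_divide fact_unit) auto
qed

definition gamma_quotient :: "'p :: prime_card padic_int \<Rightarrow> 'p padic_int \<Rightarrow> 'p padic_int \<Rightarrow> 'p padic_int \<Rightarrow> 'p padic" where
  "gamma_quotient \<alpha> \<beta> \<gamma> \<delta> = to_fract (Gamma_padic (\<alpha> - \<beta> + 1)) * to_fract (Gamma_padic (\<alpha> - \<gamma> + 1))
          * to_fract (Gamma_padic (\<alpha> - \<delta> + 1)) * to_fract (Gamma_padic (\<alpha> - \<beta> - \<gamma> - \<delta> + 1))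
        / (to_fract (Gamma_padic (\<alpha> + 1)) * to_fract (Gamma_padic (\<alpha> - \<beta> - \<gamma> + 1))
          * to_fract (Gamma_padic (\<alpha> - \<beta> - \<delta> + 1)) * to_fract (Gamma_padic (\<alpha> - \<gamma> - \<delta> + 1)))"

lemma gamma_quotient_rotate: "gamma_quotient \<alpha> \<gamma> \<delta> \<beta> = gamma_quotient \<alpha> \<beta> \<gamma> \<delta>"
proof -
  have eqs: "\<alpha> - \<gamma> - \<delta> - \<beta> = \<alpha> - \<beta> - \<gamma> - \<delta>" "\<alpha> - \<gamma> - \<beta> = \<alpha> - \<beta> - \<gamma>" "\<alpha> - \<delta> - \<beta> = \<alpha> - \<beta> - \<delta>"
    by (simp_all add: algebra_simps)
  show ?thesis unfolding gamma_quotient_def eqs by (simp only: mult_ac)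
qed

definition transformed_term :: "'a \<Rightarrow> 'a \<Rightarrow> 'a \<Rightarrow> 'a \<Rightarrow> 'a \<Rightarrow> nat \<Rightarrow> 'a :: field_char_0" where
  "transformed_term x b c d e k = pochhammer (1 - e) k * pochhammer b k * pochhammer c k * pochhammer d k
     / (fact k * fact k * pochhammer (1 + x - e) k * pochhammer (b + c + d - x) k)"

context residue_data
begin

text \<open>The common residue modulo p, in factorials, of the Gamma quotient and of Whipple's
  prefactor after p is removed. The sign is -1 because the exponents from the eight Gamma values add
  up to p plus an even number.\<close>

definition gamma_value :: "'p padic" where
  "gamma_value = - (fact (b - a) * fact (c - a) * fact (d - a) * fact (b + c + d - a)
     / (fact (CARD('p) - a) * fact (b + c - a) * fact (b + d - a) * fact (c + d - a)))"

lemma a_less_CARD: "a < CARD('p)"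
  using a_le less_CARD by linarith

lemma gamma_cong:
  assumes "padic_cong 1 (to_fract z) (of_int n)" "1 \<le> m" "m \<le> CARD('p)" "int CARD('p) dvd n - int m"
  shows "unit_cong (to_fract (Gamma_padic z)) ((- 1) ^ m * fact (m - 1) :: 'p padic)"
proof (rule unit_congI)
  have "padic_cong 1 (of_int n) (of_int (int m) :: 'p padic)"
    using assms(4) by (intro padic_cong_of_int) (simp add: cong_iff_dvd_diff)
  then show "padic_cong 1 (to_fract (Gamma_padic z)) ((- 1) ^ m * fact (m - 1))"
    using padic_cong_trans[OF assms(1)] assms(2,3) by (intro Gamma_padic_cong_fact odd_CARD) simp_all
  have "(- 1) ^ m \<in> (padic_units :: 'p padic set)"
    using padic_cong_unit[of "- 1" "- 1"] of_int_unit_iff[of "- 1", where 'p = 'p] prime_card_gt_1[where 'p = 'p]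
    by (cases "even m") simp_all
  then show "(- 1) ^ m * fact (m - 1) \<in> (padic_units :: 'p padic set)"
    using assms(2,3) by (intro padic_units_mult fact_unit) auto
qed

lemma gamma_quotient_cong: "unit_cong (gamma_quotient \<alpha> \<beta> \<gamma> \<delta>) gamma_value"
proof -
  obtain i j l where ijl: "b = a + i" "c = a + j" "d = a + l"
    using a_le by (metis le_iff_add)
  have 1: "unit_cong (to_fract (Gamma_padic (\<alpha> - \<beta> + 1))) ((- 1) ^ (i + 1) * fact (i + 1 - 1) :: 'p padic)"
  proof (rule gamma_cong)
    show "padic_cong 1 (to_fract (\<alpha> - \<beta> + 1)) (of_int (int i + 1))"
      using padic_cong_add[OF padic_cong_diff[OF res_\<alpha> res_\<beta>] padic_cong_refl[of 1 1]]
      by (simp add: ijl)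
  qed (use less_CARD ijl a_pos in auto)
  have 2: "unit_cong (to_fract (Gamma_padic (\<alpha> - \<gamma> + 1))) ((- 1) ^ (j + 1) * fact (j + 1 - 1) :: 'p padic)"
  proof (rule gamma_cong)
    show "padic_cong 1 (to_fract (\<alpha> - \<gamma> + 1)) (of_int (int j + 1))"
      using padic_cong_add[OF padic_cong_diff[OF res_\<alpha> res_\<gamma>] padic_cong_refl[of 1 1]]
      by (simp add: ijl)
  qed (use less_CARD ijl a_pos in auto)
  have 3: "unit_cong (to_fract (Gamma_padic (\<alpha> - \<delta> + 1))) ((- 1) ^ (l + 1) * fact (l + 1 - 1) :: 'p padic)"
  proof (rule gamma_cong)
    show "padic_cong 1 (to_fract (\<alpha> - \<delta> + 1)) (of_int (int l + 1))"
      using padic_cong_add[OF padic_cong_diff[OF res_\<alpha> res_\<delta>] padic_cong_refl[of 1 1]]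
      by (simp add: ijl)
  qed (use less_CARD ijl a_pos in auto)
  \<comment> \<open>The representative 2a + i + j + l + 1 is b + c + d - a + 1, at most p by
    condition (ii).\<close>
  have 4: "unit_cong (to_fract (Gamma_padic (\<alpha> - \<beta> - \<gamma> - \<delta> + 1)))
      ((- 1) ^ (2 * a + i + j + l + 1) * fact (2 * a + i + j + l + 1 - 1) :: 'p padic)"
  proof (rule gamma_cong)
    show "padic_cong 1 (to_fract (\<alpha> - \<beta> - \<gamma> - \<delta> + 1)) (of_int (int (2 * a + i + j + l + 1)))"
      using padic_cong_add[OF padic_cong_diff[OF padic_cong_diff[OF padic_cong_diff[OF res_\<alpha> res_\<beta>] res_\<gamma>] res_\<delta>] padic_cong_refl[of 1 1]]
      by (simp add: ijl algebra_simps)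
  qed (use sum_less ijl a_pos in auto)
  \<comment> \<open>\<alpha> + 1 reduces to 1 - a \<le> 0, so its representative in 1..p is p - a +
    1.\<close>
  have 5: "unit_cong (to_fract (Gamma_padic (\<alpha> + 1)))
      ((- 1) ^ (CARD('p) - a + 1) * fact (CARD('p) - a + 1 - 1) :: 'p padic)"
  proof (rule gamma_cong)
    show "padic_cong 1 (to_fract (\<alpha> + 1)) (of_int (1 - int a))"
      using padic_cong_add[OF res_\<alpha> padic_cong_refl[of 1 1]]
      by (simp add: ijl algebra_simps)
  qed (use a_less_CARD a_pos in \<open>auto simp: of_nat_diff\<close>)
  have 6: "unit_cong (to_fract (Gamma_padic (\<alpha> - \<beta> - \<gamma> + 1)))
      ((- 1) ^ (a + i + j + 1) * fact (a + i + j + 1 - 1) :: 'p padic)"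
  proof (rule gamma_cong)
    show "padic_cong 1 (to_fract (\<alpha> - \<beta> - \<gamma> + 1)) (of_int (int (a + i + j + 1)))"
      using padic_cong_add[OF padic_cong_diff[OF padic_cong_diff[OF res_\<alpha> res_\<beta>] res_\<gamma>] padic_cong_refl[of 1 1]]
      by (simp add: ijl algebra_simps)
  qed (use sum_less ijl a_pos in auto)
  have 7: "unit_cong (to_fract (Gamma_padic (\<alpha> - \<beta> - \<delta> + 1)))
      ((- 1) ^ (a + i + l + 1) * fact (a + i + l + 1 - 1) :: 'p padic)"
  proof (rule gamma_cong)
    show "padic_cong 1 (to_fract (\<alpha> - \<beta> - \<delta> + 1)) (of_int (int (a + i + l + 1)))"
      using padic_cong_add[OF padic_cong_diff[OF padic_cong_diff[OF res_\<alpha> res_\<beta>] res_\<delta>] padic_cong_refl[of 1 1]]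
      by (simp add: ijl algebra_simps)
  qed (use sum_less ijl a_pos in auto)
  have 8: "unit_cong (to_fract (Gamma_padic (\<alpha> - \<gamma> - \<delta> + 1)))
      ((- 1) ^ (a + j + l + 1) * fact (a + j + l + 1 - 1) :: 'p padic)"
  proof (rule gamma_cong)
    show "padic_cong 1 (to_fract (\<alpha> - \<gamma> - \<delta> + 1)) (of_int (int (a + j + l + 1)))"
      using padic_cong_add[OF padic_cong_diff[OF padic_cong_diff[OF res_\<alpha> res_\<gamma>] res_\<delta>] padic_cong_refl[of 1 1]]
      by (simp add: ijl algebra_simps)
  qed (use sum_less ijl a_pos in auto)
  have diffs: "b - a = i" "c - a = j" "d - a = l" "b + c + d - a = 2 * a + i + j + l"
    "b + c - a = a + i + j" "b + d - a = a + i + l" "c + d - a = a + j + l"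
    by (simp_all add: ijl)
  have val: "(- 1) ^ (i + 1) * fact (i + 1 - 1) * ((- 1) ^ (j + 1) * fact (j + 1 - 1)) * ((- 1) ^ (l + 1) * fact (l + 1 - 1))
      * ((- 1) ^ (2 * a + i + j + l + 1) * fact (2 * a + i + j + l + 1 - 1))
      / ((- 1) ^ (CARD('p) - a + 1) * fact (CARD('p) - a + 1 - 1) * ((- 1) ^ (a + i + j + 1) * fact (a + i + j + 1 - 1))
        * ((- 1) ^ (a + i + l + 1) * fact (a + i + l + 1 - 1)) * ((- 1) ^ (a + j + l + 1) * fact (a + j + l + 1 - 1)))
      = gamma_value"
    unfolding gamma_value_def diffs
    by (cases "even i"; cases "even j"; cases "even l"; cases "even a")
       (simp_all add: minus_one_power_iff odd_CARD not_less less_imp_le[OF a_less_CARD])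
  show ?thesis
    unfolding val[symmetric] gamma_quotient_def
    by (intro unit_cong_divide unit_cong_mult 1 2 3 4 5 6 7 8)
qed

text \<open>With x = p - a the product (1 + x)_d passes through p at index a - 1; dropping that
  factor leaves (p - a + 1)...(p - 1) and (p + 1)...(p + d - a), the first two products
  here.\<close>

definition whipple_factor :: "'p padic" where
  "whipple_factor = pochhammer (1 + of_nat (CARD('p) - a)) (a - 1) * pochhammer (1 + P) (d - a)
     * pochhammer (1 + of_nat (CARD('p) - a) + of_nat b + of_nat c) d
     / (pochhammer (1 + of_nat (CARD('p) - a) + of_nat b) d * pochhammer (1 + of_nat (CARD('p) - a) + of_nat c) d)"

definition whipple_4F3 :: "'p padic" where
  "whipple_4F3 = (\<Sum>j\<le>d. pochhammer (1 + P + of_nat e) j * pochhammer (- of_nat b) j * pochhammer (- of_nat c) j * pochhammer (- of_nat d) j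
      / (fact j * pochhammer (1 + P) j * pochhammer (1 + of_nat (CARD('p) - a) + of_nat e) j
          * pochhammer (- of_nat b - of_nat c - of_nat (CARD('p) - a) - of_nat d) j))"

lemma whipple_sum_eq: "whipple_sum = P * (whipple_factor * whipple_4F3)"
proof -
  define x :: "'p padic" where "x = of_nat (CARD('p) - a)"
  have xa: "x + of_nat a = P" using a_less_CARD by (simp add: x_def flip: of_nat_add)
  have nz: "pochhammer (1 + x + of_nat m) k \<noteq> 0" for m k
    using pochhammer_of_nat_nonzero[of "1 + (CARD('p) - a) + m" k, where 'a = "'p padic"] by (simp add: x_def add.assoc)
  have "- of_nat b + - of_nat c - x - of_nat d = (- of_nat (b + c + d + (CARD('p) - a)) :: 'p padic)"
    by (simp add: x_def algebra_simps)
  then have nz': "pochhammer (- of_nat b + - of_nat c - x - of_nat d) d \<noteq> 0"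
    by (simp only: pochhammer_of_nat_eq_0_iff)
  have "whipple_sum = (\<Sum>k\<le>a. well_poised_term x (- of_nat a) (- of_nat b) (- of_nat c) (- of_nat d) (- of_nat e) k)"
    by (simp only: whipple_sum_def x_def)
  also have "\<dots> = pochhammer (1 + x) d * pochhammer (1 + x - - of_nat b - - of_nat c) d
        / (pochhammer (1 + x - - of_nat b) d * pochhammer (1 + x - - of_nat c) d)
      * (\<Sum>j\<le>d. pochhammer (1 + x + of_nat a - - of_nat e) j * pochhammer (- of_nat b) j * pochhammer (- of_nat c) j * pochhammer (- of_nat d) j
            / (fact j * pochhammer (1 + x + of_nat a) j * pochhammer (1 + x - - of_nat e) j * pochhammer (- of_nat b + - of_nat c - x - of_nat d) j))"
  proof (rule sum_well_poised_term_whipple[OF _ _ _ _ _ _ nz'])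
    show "pochhammer x (Suc (2 * d)) \<noteq> 0"
      unfolding x_def using a_less_CARD by (intro pochhammer_of_nat_nonzero) simp
  qed (use a_le nz in simp_all)
  also have "pochhammer (1 + x) d = P * (pochhammer (1 + x) (a - 1) * pochhammer (1 + P) (d - a))"
  proof -
    have "pochhammer (1 + x) (a - 1 + Suc (d - a))
        = pochhammer (1 + x) (a - 1) * pochhammer (1 + x + of_nat (a - 1)) (Suc (d - a))"
      by (rule pochhammer_product')
    moreover have "1 + x + of_nat (a - 1) = P" using a_pos xa by (simp add: of_nat_diff algebra_simps)
    moreover have "a - 1 + Suc (d - a) = d" using a_pos a_le by simp
    ultimately show ?thesis by (simp add: pochhammer_rec add.commute[of P])
  qed
  also have "1 + x + of_nat a = 1 + P" using xa by (simp add: add.assoc)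
  finally show ?thesis
    by (simp add: whipple_factor_def whipple_4F3_def x_def mult.assoc)
qed

lemma padic_cong_x: "padic_cong 1 (of_nat (CARD('p) - a)) (- of_nat a :: 'p padic)"
  using padic_cong_CARD[where 'p = 'p] a_less_CARD by (simp add: padic_cong_iff of_nat_diff)

lemma padic_cong_one_add_x:
  assumes "a \<le> m"
  shows "padic_cong 1 (1 + of_nat (CARD('p) - a) + of_nat m) (1 + of_nat (m - a) :: 'p padic)"
  using padic_cong_add[OF padic_cong_add[OF padic_cong_refl[of 1 1] padic_cong_x] padic_cong_refl[of 1 "of_nat m"]] assms
  by (simp add: of_nat_diff algebra_simps)

text \<open>The first product is (p - 1)! / (p - a)!, hence -1 / (p - a)! modulo p by Wilson's
  theorem. The factors of every other product reduce to consecutive integers strictly between 0 and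
  p, giving ratios of factorials.\<close>

lemma whipple_factor_cong: "unit_cong whipple_factor gamma_value"
proof -
  have 1: "unit_cong (pochhammer (1 + of_nat (CARD('p) - a)) (a - 1)) (- 1 / fact (CARD('p) - a) :: 'p padic)"
  proof -
    have eq: "pochhammer (1 + of_nat (CARD('p) - a)) (a - 1) = (fact (CARD('p) - 1) / fact (CARD('p) - a) :: 'p padic)"
    proof -
      have "CARD('p) - a + (a - 1) = CARD('p) - 1" using a_pos a_less_CARD by simp
      then show ?thesis by (simp only: pochhammer_Suc_of_nat)
    qed
    have "[fact (CARD('p) - 1) = - 1 :: int] (mod int CARD('p))"
      by (rule wilson_theorem) (rule prime_card)
    then have "padic_cong 1 (of_int (fact (CARD('p) - 1))) (of_int (- 1) :: 'p padic)"
      by (rule padic_cong_of_int)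
    moreover have "(- 1) \<in> (padic_units :: 'p padic set)"
      using of_int_unit_iff[of "- 1", where 'p = 'p] prime_card_gt_1[where 'p = 'p] by simp
    ultimately have "unit_cong (fact (CARD('p) - 1)) (- 1 :: 'p padic)" by (intro unit_congI) simp_all
    moreover have "unit_cong (fact (CARD('p) - a)) (fact (CARD('p) - a) :: 'p padic)"
      using a_pos a_less_CARD by (intro unit_congI fact_unit) auto
    ultimately show ?thesis unfolding eq by (rule unit_cong_divide)
  qed
  have 2: "unit_cong (pochhammer (1 + P) (d - a)) (fact (0 + (d - a)) / fact 0)"
    using padic_cong_add[OF padic_cong_refl[of 1 1] padic_cong_CARD[where 'p = 'p]] less_CARD
    by (intro unit_cong_pochhammer) auto
  have 3: "unit_cong (pochhammer (1 + of_nat (CARD('p) - a) + of_nat b + of_nat c) d) (fact (b + c - a + d) / fact (b + c - a) :: 'p padic)"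
    using padic_cong_one_add_x[of "b + c"] a_le sum_less by (intro unit_cong_pochhammer) (auto simp: add.assoc)
  have 4: "unit_cong (pochhammer (1 + of_nat (CARD('p) - a) + of_nat b) d) (fact (b - a + d) / fact (b - a) :: 'p padic)"
    using padic_cong_one_add_x[of b] a_le sum_less by (intro unit_cong_pochhammer) auto
  have 5: "unit_cong (pochhammer (1 + of_nat (CARD('p) - a) + of_nat c) d) (fact (c - a + d) / fact (c - a) :: 'p padic)"
    using padic_cong_one_add_x[of c] a_le sum_less by (intro unit_cong_pochhammer) auto
  have "- 1 / fact (CARD('p) - a) * (fact (0 + (d - a)) / fact 0) * (fact (b + c - a + d) / fact (b + c - a))
      / (fact (b - a + d) / fact (b - a) * (fact (c - a + d) / fact (c - a))) = gamma_value"
  proof -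
    have "b + c - a + d = b + c + d - a" "b - a + d = b + d - a" "c - a + d = c + d - a"
      using a_le by auto
    then show ?thesis unfolding gamma_value_def by (simp add: ac_simps)
  qed
  moreover have "unit_cong whipple_factor (- 1 / fact (CARD('p) - a) * (fact (0 + (d - a)) / fact 0) * (fact (b + c - a + d) / fact (b + c - a))
      / (fact (b - a + d) / fact (b - a) * (fact (c - a + d) / fact (c - a))))"
    unfolding whipple_factor_def by (intro unit_cong_divide unit_cong_mult 1 2 3 4 5)
  ultimately show ?thesis by simp
qed

lemma res_sum: "padic_cong 1 (to_fract (\<beta> + \<gamma> + \<delta> - \<alpha>)) (of_int (- int (b + c + d - a)))"
  using padic_cong_diff[OF padic_cong_add[OF padic_cong_add[OF res_\<beta> res_\<gamma>] res_\<delta>] res_\<alpha>] a_le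
  by (simp add: of_nat_diff algebra_simps)

lemma res_one_minus_\<epsilon>: "padic_cong 1 (1 - E) (of_int (1 + int e))"
  using padic_cong_diff[OF padic_cong_refl[of 1 1] res_\<epsilon>] by simp

text \<open>(\<delta>)_k supplies the factor p. Each lower parameter that may contain p has an upper
  partner reaching a multiple of p no later: 1 - \<epsilon> at index p - 1 - e against p - 1 - e +
  a, and \<beta> at index b against b + c + d - a.\<close>

lemma transformed_term_tail:
  assumes "d < k" "k \<le> CARD('p) - 1"
  shows "transformed_term A B C D E k \<in> padic_ideal 1"
proof -
  have eq: "transformed_term A B C D E k = pochhammer D k * pochhammer C k * (1 / (fact k * fact k))
      * (pochhammer (1 - E) k / pochhammer (to_fract (\<alpha> - \<epsilon> + 1)) k)
      * (pochhammer B k / pochhammer (to_fract (\<beta> + \<gamma> + \<delta> - \<alpha>)) k)"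
    by (simp add: transformed_term_def add.commute[of "A - E" 1] add_diff_eq ac_simps)
  have 1: "pochhammer D k \<in> padic_ideal 1"
    using assms res_\<delta> by (intro pochhammer_ideal_1[of _ "- int d" d]) auto
  have 2: "pochhammer C k \<in> padic_ideal 0" by (intro integral_pochhammer to_fract_integral)
  have 3: "1 / (fact k * fact k) \<in> (padic_ideal 0 :: 'p padic set)"
    using assms less_CARD by (intro padic_ideal_divide_unit padic_units_mult fact_unit) auto
  have 4: "pochhammer (1 - E) k / pochhammer (to_fract (\<alpha> - \<epsilon> + 1)) k \<in> padic_ideal 0"
  proof (rule pochhammer_quotient_integral[OF res_one_minus_\<epsilon> _ not_dvd_\<epsilon> assms(2)])
    show "padic_cong 1 (to_fract (\<alpha> - \<epsilon> + 1)) (of_int (1 + int e - int a))"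
      using padic_cong_one_add_diff[OF res_\<alpha> res_\<epsilon>] by (simp add: add.commute add_diff_eq)
    fix i assume i: "i < k" "int CARD('p) dvd 1 + int e - int a + int i"
    have "1 + int e - int a + int i = int CARD('p)"
      using i assms a_le less_CARD by (intro int_dvd_less_twice) auto
    then show "\<exists>j<k. int CARD('p) dvd 1 + int e + int j"
      using i less_CARD a_pos by (intro exI[of _ "CARD('p) - 1 - e"]) (auto simp: of_nat_diff)
  qed
  have 5: "pochhammer B k / pochhammer (to_fract (\<beta> + \<gamma> + \<delta> - \<alpha>)) k \<in> padic_ideal 0"
  proof (rule pochhammer_quotient_integral[OF _ res_sum not_dvd_sum assms(2)])
    show "padic_cong 1 B (of_int (- int b))" using res_\<beta> by simp
    fix i assume i: "i < k" "int CARD('p) dvd - int (b + c + d - a) + int i"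
    \<comment> \<open>Both b + c + d - a and i lie below p, so 0 is the only multiple of p in
      range.\<close>
    have "- int (b + c + d - a) + int i = 0"
    proof (rule ccontr)
      assume "- int (b + c + d - a) + int i \<noteq> 0"
      then have "\<bar>int CARD('p)\<bar> \<le> \<bar>- int (b + c + d - a) + int i\<bar>"
        using i(2) by (rule dvd_imp_le_int)
      then show False using i assms sum_less by linarith
    qed
    then show "\<exists>j<k. int CARD('p) dvd - int b + int j"
      using i a_le by (intro exI[of _ b]) auto
  qed
  show ?thesis
    unfolding eq by (rule padic_ideal_integral[OF padic_ideal_integral[OF padic_ideal_integral[OF
      padic_ideal_integral[OF 1 2] 3] 4] 5])
qed

text \<open>The first product stays below p because d + e < p + a. The second starts above -p by
  condition (ii) and stops short of 0 because b + c > a.\<close>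

lemma unit_denominators:
  assumes "k \<le> d"
  shows "pochhammer (1 + A - E) k \<in> padic_units" "pochhammer (B + C + D - A) k \<in> padic_units"
proof -
  show "pochhammer (1 + A - E) k \<in> padic_units"
    using assms a_le sum_less by (intro unit_pochhammer_one_add_diff[OF res_\<alpha> res_\<epsilon>]) auto
  show "pochhammer (B + C + D - A) k \<in> padic_units"
  proof (rule unit_pochhammer)
    show "padic_cong 1 (B + C + D - A) (of_int (- int (b + c + d - a)))" using res_sum by simp
    fix i assume i: "i < k"
    have "\<not> int CARD('p) dvd int (b + c + d - a) - int i"
      using i assms sum_less a_pos a_le by (intro zdvd_not_zless) auto
    then show "\<not> int CARD('p) dvd - int (b + c + d - a) + int i"
      using dvd_minus_iff[of "int CARD('p)" "int (b + c + d - a) - int i"] by simp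
  qed
qed

lemma transformed_term_integral:
  assumes "k \<le> d"
  shows "transformed_term A B C D E k \<in> padic_ideal 0"
  unfolding transformed_term_def using unit_denominators[OF assms] assms less_CARD
  by (intro padic_ideal_divide_unit padic_units_mult fact_unit integral_mult integral_pochhammer
    padic_ideal_diff one_integral to_fract_integral) auto

lemma transformed_term_cong:
  assumes "k \<le> d"
  shows "padic_cong 1 (pochhammer (1 + P + of_nat e) k * pochhammer (- of_nat b) k * pochhammer (- of_nat c) k * pochhammer (- of_nat d) k
      / (fact k * pochhammer (1 + P) k * pochhammer (1 + of_nat (CARD('p) - a) + of_nat e) k
          * pochhammer (- of_nat b - of_nat c - of_nat (CARD('p) - a) - of_nat d) k))
      (transformed_term A B C D E k)"
  unfolding transformed_term_def
proof (rule padic_cong_divide)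
  let ?n1 = "pochhammer (1 + P + of_nat e) k" and ?n1' = "pochhammer (1 - E) k"
  have n1: "padic_cong 1 ?n1 ?n1'"
  proof (rule padic_cong_pochhammer)
    have "padic_cong 1 (1 + P + of_nat e) (1 + 0 + of_nat e)"
      by (intro padic_cong_add padic_cong_refl padic_cong_CARD)
    then show "padic_cong 1 (1 + P + of_nat e) (1 - E)"
      using padic_cong_trans padic_cong_sym[OF res_one_minus_\<epsilon>] by fastforce
  qed (simp add: padic_ideal_diff)
  have p: "padic_cong 1 (pochhammer (- of_nat m) k) (pochhammer (to_fract z) k)"
    if "padic_cong 1 (to_fract z :: 'p padic) (- of_nat m)" for z m
    using that by (intro padic_cong_pochhammer) (auto simp: padic_cong_sym)
  note int = integral_mult padic_ideal_add padic_ideal_diff padic_ideal_uminus integral_pochhammer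
    one_integral of_nat_integral to_fract_integral
  show "padic_cong 1 (?n1 * pochhammer (- of_nat b) k * pochhammer (- of_nat c) k * pochhammer (- of_nat d) k)
      (?n1' * pochhammer B k * pochhammer C k * pochhammer D k)"
    by (intro padic_cong_mult n1 p res_\<beta> res_\<gamma> res_\<delta> int)
  show "?n1' * pochhammer B k * pochhammer C k * pochhammer D k \<in> padic_ideal 0"
    by (intro int)
  have k: "k < CARD('p)" using assms less_CARD by simp
  have d1: "unit_cong (fact k) (fact k :: 'p padic)"
    using k by (intro unit_congI fact_unit) auto
  have d2: "unit_cong (pochhammer (1 + P) k) (fact (0 + k) / fact 0)"
    using padic_cong_add[OF padic_cong_refl[of 1 1] padic_cong_CARD[where 'p = 'p]] k
    by (intro unit_cong_pochhammer) auto
  have d3: "unit_cong (pochhammer (1 + of_nat (CARD('p) - a) + of_nat e) k) (pochhammer (1 + A - E) k)"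
  proof (rule unit_congI)
    show "pochhammer (1 + A - E) k \<in> padic_units" using assms by (rule unit_denominators)
    have "padic_cong 1 (1 + of_nat (CARD('p) - a) - - of_nat e) (1 + A - E)"
      using padic_cong_trans[OF padic_cong_x padic_cong_sym[OF res_\<alpha>]]
      by (intro padic_cong_diff padic_cong_add padic_cong_refl padic_cong_sym[OF res_\<epsilon>])
    then have "padic_cong 1 (1 + of_nat (CARD('p) - a) + of_nat e) (1 + A - E)" by simp
    then show "padic_cong 1 (pochhammer (1 + of_nat (CARD('p) - a) + of_nat e) k) (pochhammer (1 + A - E) k)"
      by (intro padic_cong_pochhammer int)
  qed
  have d4: "unit_cong (pochhammer (- of_nat b - of_nat c - of_nat (CARD('p) - a) - of_nat d) k) (pochhammer (B + C + D - A) k)"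
  proof (rule unit_congI)
    show "pochhammer (B + C + D - A) k \<in> padic_units" using assms by (rule unit_denominators)
    have "padic_cong 1 (- of_nat b + - of_nat c + - of_nat d - of_nat (CARD('p) - a)) (B + C + D - A)"
      using padic_cong_trans[OF padic_cong_x padic_cong_sym[OF res_\<alpha>]]
      by (intro padic_cong_diff padic_cong_add padic_cong_sym[OF res_\<beta>] padic_cong_sym[OF res_\<gamma>] padic_cong_sym[OF res_\<delta>])
    then have "padic_cong 1 (- of_nat b - of_nat c - of_nat (CARD('p) - a) - of_nat d) (B + C + D - A)"
      by (simp add: algebra_simps)
    then show "padic_cong 1 (pochhammer (- of_nat b - of_nat c - of_nat (CARD('p) - a) - of_nat d) k) (pochhammer (B + C + D - A) k)"
      by (intro padic_cong_pochhammer int)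
  qed
  have "unit_cong (fact k * pochhammer (1 + P) k * pochhammer (1 + of_nat (CARD('p) - a) + of_nat e) k
          * pochhammer (- of_nat b - of_nat c - of_nat (CARD('p) - a) - of_nat d) k)
      (fact k * (fact (0 + k) / fact 0) * pochhammer (1 + A - E) k * pochhammer (B + C + D - A) k)"
    by (intro unit_cong_mult d1 d2 d3 d4)
  then show "padic_cong 1 (fact k * pochhammer (1 + P) k * pochhammer (1 + of_nat (CARD('p) - a) + of_nat e) k
          * pochhammer (- of_nat b - of_nat c - of_nat (CARD('p) - a) - of_nat d) k)
      (fact k * fact k * pochhammer (1 + A - E) k * pochhammer (B + C + D - A) k)"
    "fact k * pochhammer (1 + P) k * pochhammer (1 + of_nat (CARD('p) - a) + of_nat e) k
          * pochhammer (- of_nat b - of_nat c - of_nat (CARD('p) - a) - of_nat d) k \<in> padic_units"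
    "fact k * fact k * pochhammer (1 + A - E) k * pochhammer (B + C + D - A) k \<in> padic_units"
    by (simp_all add: unit_cong_def)
qed

text \<open>Integrality accompanies the congruence because multiplying congruences requires integral
  factors.\<close>

lemma sum_transformed_term:
  "(\<Sum>k\<le>CARD('p) - 1. transformed_term A B C D E k) \<in> padic_ideal 0"
  "padic_cong 1 whipple_4F3 (\<Sum>k\<le>CARD('p) - 1. transformed_term A B C D E k)"
proof -
  let ?h = "\<Sum>k\<le>d. transformed_term A B C D E k"
  let ?t = "\<Sum>k\<in>{d<..CARD('p) - 1}. transformed_term A B C D E k"
  have "{..CARD('p) - 1} = {..d} \<union> {d<..CARD('p) - 1}" using less_CARD by auto
  then have split: "(\<Sum>k\<le>CARD('p) - 1. transformed_term A B C D E k) = ?h + ?t"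
    by (simp add: sum.union_disjoint ivl_disj_int)
  have t: "?t \<in> padic_ideal 1" by (intro padic_ideal_sum transformed_term_tail) auto
  have h: "?h \<in> padic_ideal 0" by (intro padic_ideal_sum transformed_term_integral) auto
  show "(\<Sum>k\<le>CARD('p) - 1. transformed_term A B C D E k) \<in> padic_ideal 0"
    unfolding split using h padic_ideal_antimono[OF t] by (intro padic_ideal_add) auto
  have "padic_cong 1 whipple_4F3 ?h"
    unfolding whipple_4F3_def by (intro padic_cong_sum transformed_term_cong) simp
  then have "whipple_4F3 - ?h - ?t \<in> padic_ideal 1"
    using t unfolding padic_cong_iff by (rule padic_ideal_diff)
  then show "padic_cong 1 whipple_4F3 (\<Sum>k\<le>CARD('p) - 1. transformed_term A B C D E k)"
    unfolding split padic_cong_iff by (simp add: algebra_simps)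
qed

text \<open>Prefactor and 4F3 are compared modulo p only; the factor P taken out of
  \<open>whipple_sum\<close> raises the comparison to p^2.\<close>

lemma well_poised_congruence:
  "padic_cong 2 (\<Sum>k\<le>CARD('p) - 1. well_poised_term A A B C D E k)
     ((A + of_nat a) * gamma_quotient \<alpha> \<beta> \<gamma> \<delta> * (\<Sum>k\<le>CARD('p) - 1. transformed_term A B C D E k))"
proof -
  let ?T = "\<Sum>k\<le>CARD('p) - 1. transformed_term A B C D E k"
  obtain s where s: "A + of_nat a = P * to_fract s"
    using res_\<alpha> by (auto simp: padic_cong_def)
  have "padic_cong 1 whipple_factor (gamma_quotient \<alpha> \<beta> \<gamma> \<delta>)"
    using whipple_factor_cong gamma_quotient_cong padic_cong_trans padic_cong_sym unfolding unit_cong_def by blast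
  then have "padic_cong 1 (whipple_factor * whipple_4F3) (gamma_quotient \<alpha> \<beta> \<gamma> \<delta> * ?T)"
    using gamma_quotient_cong padic_cong_integral[OF sum_transformed_term(2,1)]
    by (intro padic_cong_mult sum_transformed_term) (auto simp: unit_cong_def padic_units_integral)
  then have "P * (whipple_factor * whipple_4F3 - gamma_quotient \<alpha> \<beta> \<gamma> \<delta> * ?T) \<in> padic_ideal 2"
    unfolding padic_cong_iff Suc_1[symmetric] by (rule CARD_mult_ideal)
  then have "to_fract s * (P * (whipple_factor * whipple_4F3 - gamma_quotient \<alpha> \<beta> \<gamma> \<delta> * ?T)) \<in> padic_ideal 2"
    by (rule integral_mult[OF to_fract_integral])
  moreover have "to_fract s * (P * (whipple_factor * whipple_4F3 - gamma_quotient \<alpha> \<beta> \<gamma> \<delta> * ?T))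
      = to_fract s * whipple_sum - (A + of_nat a) * gamma_quotient \<alpha> \<beta> \<gamma> \<delta> * ?T"
    unfolding s whipple_sum_eq by (simp only: right_diff_distrib mult_ac)
  ultimately have "padic_cong 2 (to_fract s * whipple_sum) ((A + of_nat a) * gamma_quotient \<alpha> \<beta> \<gamma> \<delta> * ?T)"
    by (simp only: padic_cong_iff)
  with lhs_cong[OF s] show ?thesis by (rule padic_cong_trans)
qed

lemma hypergeometric_congruence:
  assumes half: "pochhammer (A / 2) (CARD('p) - 1) \<noteq> 0"
  shows "padic_cong 2
    (truncated_hypergeometric [A, A, A / 2 + 1, B, C, D, E]
      [1, A / 2, A - B + 1, A - C + 1, A - D + 1, A - E + 1] 1 (CARD('p) - 1))
    ((A + of_nat a) * gamma_quotient \<alpha> \<beta> \<gamma> \<delta>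
      * truncated_hypergeometric [1 - E, B, C, D] [1, A - E + 1, B + C + D - A] 1 (CARD('p) - 1))"
proof -
  have swap: "A - z + 1 = 1 + A - z" for z by simp
  have "truncated_hypergeometric [A, A, A / 2 + 1, B, C, D, E]
      [1, A / 2, A - B + 1, A - C + 1, A - D + 1, A - E + 1] 1 (CARD('p) - 1)
    = (\<Sum>k\<le>CARD('p) - 1. well_poised_term A A B C D E k)"
    unfolding truncated_hypergeometric_def swap
  proof (intro sum.cong refl)
    fix k assume "k \<in> {..CARD('p) - 1}"
    \<comment> \<open>Nonvanishing makes the half-parameter quotient a genuine one; it collapses to
      (A + 2k) / A because A/2 and A/2 + 1 differ by one.\<close>
    then have "pochhammer (A / 2) k \<noteq> 0" using half pochhammer_eq_0_mono by auto
    moreover have "A / 2 * pochhammer (A / 2 + 1) k = pochhammer (A / 2) k * (A / 2 + of_nat k)"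
      using pochhammer_rec[of "A / 2" k] pochhammer_Suc[of "A / 2" k] by simp
    ultimately have "pochhammer (A / 2 + 1) k / pochhammer (A / 2) k = (A + 2 * of_nat k) / A"
      using padic_units_nonzero[OF unit_\<alpha>] by (simp add: field_simps)
    moreover have "(\<Prod>x\<leftarrow>[A, A, A / 2 + 1, B, C, D, E]. pochhammer x k)
        / (\<Prod>x\<leftarrow>[1, A / 2, 1 + A - B, 1 + A - C, 1 + A - D, 1 + A - E]. pochhammer x k) * (1 ^ k / fact k)
      = pochhammer A k * (pochhammer (A / 2 + 1) k / pochhammer (A / 2) k) * pochhammer A k
        * pochhammer B k * pochhammer C k * pochhammer D k * pochhammer E k
        / (fact k * pochhammer (1 + A - A) k * pochhammer (1 + A - B) k * pochhammer (1 + A - C) k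
           * pochhammer (1 + A - D) k * pochhammer (1 + A - E) k)"
      by (simp add: mult_ac)
    ultimately show "(\<Prod>x\<leftarrow>[A, A, A / 2 + 1, B, C, D, E]. pochhammer x k)
        / (\<Prod>x\<leftarrow>[1, A / 2, 1 + A - B, 1 + A - C, 1 + A - D, 1 + A - E]. pochhammer x k) * (1 ^ k / fact k)
      = well_poised_term A A B C D E k"
      by (simp add: well_poised_term_def)
  qed
  moreover have "truncated_hypergeometric [1 - E, B, C, D] [1, A - E + 1, B + C + D - A] 1 (CARD('p) - 1)
    = (\<Sum>k\<le>CARD('p) - 1. transformed_term A B C D E k)"
    unfolding truncated_hypergeometric_def swap
    by (intro sum.cong refl) (simp add: transformed_term_def mult_ac flip: pochhammer_fact)
  ultimately show ?thesis using well_poised_congruence by simp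
qed

end

section \<open>The theorem for any order of the residues b, c, d\<close>

theorem theorem2p18:
  fixes p :: nat and \<alpha> \<beta> \<gamma> \<delta> \<epsilon> :: "'p :: prime_card padic_int"
  defines "a \<equiv> to_fract \<alpha>" and "b \<equiv> to_fract \<beta>" and "c \<equiv> to_fract \<gamma>"
    and "d \<equiv> to_fract \<delta>" and "e \<equiv> to_fract \<epsilon>"
  assumes "p = CARD('p)" and "odd p"
    and "padic_residue (- \<alpha>) \<le> Min {padic_residue (- \<beta>), padic_residue (- \<gamma>),
           padic_residue (- \<delta>), padic_residue (- \<epsilon>)}"
    and "p + padic_residue (- \<alpha>) >
           max (padic_residue (- \<beta>) + padic_residue (- \<gamma>) + padic_residue (- \<delta>))
             (Min {padic_residue (- \<beta>), padic_residue (- \<gamma>), padic_residue (- \<delta>)}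
               + padic_residue (- \<epsilon>))"
    and "\<not> of_nat (p ^ 2) dvd pochhammer (\<alpha> - \<beta> + 1) (p - 1)"
    and "\<not> of_nat (p ^ 2) dvd pochhammer (\<alpha> - \<gamma> + 1) (p - 1)"
    and "\<not> of_nat (p ^ 2) dvd pochhammer (\<alpha> - \<delta> + 1) (p - 1)"
    and "\<not> of_nat (p ^ 2) dvd pochhammer (\<alpha> - \<epsilon> + 1) (p - 1)"
    and "\<not> of_nat (p ^ 2) dvd pochhammer (\<beta> + \<gamma> + \<delta> - \<alpha>) (p - 1)"
    and half_denominator_nonzero: "pochhammer (a / 2) (p - 1) \<noteq> 0"
    and residue_nonzero: "padic_residue (- \<alpha>) \<noteq> 0"
  shows "padic_cong 2
    (truncated_hypergeometric
      [a, a, a / 2 + 1, b, c, d, e]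
      [1, a / 2, a - b + 1, a - c + 1, a - d + 1, a - e + 1] 1 (p - 1))
    ((a + of_nat (padic_residue (- \<alpha>)))
      * (to_fract (Gamma_padic (\<alpha> - \<beta> + 1)) * to_fract (Gamma_padic (\<alpha> - \<gamma> + 1))
          * to_fract (Gamma_padic (\<alpha> - \<delta> + 1)) * to_fract (Gamma_padic (\<alpha> - \<beta> - \<gamma> - \<delta> + 1))
        / (to_fract (Gamma_padic (\<alpha> + 1)) * to_fract (Gamma_padic (\<alpha> - \<beta> - \<gamma> + 1))
          * to_fract (Gamma_padic (\<alpha> - \<beta> - \<delta> + 1)) * to_fract (Gamma_padic (\<alpha> - \<gamma> - \<delta> + 1))))
      * truncated_hypergeometric
          [1 - e, b, c, d]
          [1, a - e + 1, b + c + d - a] 1 (p - 1))"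
proof -
  define r where "r z = padic_residue (- z)" for z :: "'p padic_int"
  have r: "padic_cong 1 (to_fract z) (- of_nat (r z))" "r z < CARD('p)" for z
    unfolding r_def by (rule padic_cong_neg_residue padic_residue_props)+
  have le: "r \<alpha> \<le> r \<beta>" "r \<alpha> \<le> r \<gamma>" "r \<alpha> \<le> r \<delta>" "r \<alpha> \<le> r \<epsilon>"
    using \<open>padic_residue (- \<alpha>) \<le> _\<close> by (simp_all add: r_def)
  have sum: "r \<beta> + r \<gamma> + r \<delta> < CARD('p) + r \<alpha>"
    and min: "Min {r \<beta>, r \<gamma>, r \<delta>} + r \<epsilon> < CARD('p) + r \<alpha>"
    using \<open>p + _ > _\<close> \<open>p = CARD('p)\<close> by (simp_all add: r_def)
  have pos: "0 < r \<alpha>" using residue_nonzero by (simp add: r_def)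
  have odd: "odd CARD('p)" using \<open>odd p\<close> \<open>p = CARD('p)\<close> by simp
  note nd = \<open>\<not> of_nat (p ^ 2) dvd pochhammer (\<alpha> - \<beta> + 1) (p - 1)\<close>
    \<open>\<not> of_nat (p ^ 2) dvd pochhammer (\<alpha> - \<gamma> + 1) (p - 1)\<close>
    \<open>\<not> of_nat (p ^ 2) dvd pochhammer (\<alpha> - \<delta> + 1) (p - 1)\<close>
    \<open>\<not> of_nat (p ^ 2) dvd pochhammer (\<alpha> - \<epsilon> + 1) (p - 1)\<close>
    \<open>\<not> of_nat (p ^ 2) dvd pochhammer (\<beta> + \<gamma> + \<delta> - \<alpha>) (p - 1)\<close>
  note nd = nd[unfolded \<open>p = CARD('p)\<close>]
  have half: "pochhammer (a / 2) (CARD('p) - 1) \<noteq> 0"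
    using half_denominator_nonzero \<open>p = CARD('p)\<close> by simp
  have rotate: "\<gamma> + \<delta> + \<beta> = \<beta> + \<gamma> + \<delta>" "\<delta> + \<beta> + \<gamma> = \<beta> + \<gamma> + \<delta>" "c + d + b = b + c + d" "d + b + c = b + c + d"
    by (simp_all add: add_ac)
  let ?L = "truncated_hypergeometric [a, a, a / 2 + 1, b, c, d, e]
      [1, a / 2, a - b + 1, a - c + 1, a - d + 1, a - e + 1] 1 (CARD('p) - 1)"
  let ?R = "truncated_hypergeometric [1 - e, b, c, d] [1, a - e + 1, b + c + d - a] 1 (CARD('p) - 1)"
  have "padic_cong 2 ?L ((a + of_nat (r \<alpha>)) * gamma_quotient \<alpha> \<beta> \<gamma> \<delta> * ?R)"
  proof -
    \<comment> \<open>One of the three residues is smallest, and a cyclic rotation moves it to the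
      last place, with no condition on the order of the other two.\<close>
    consider "r \<delta> \<le> r \<beta>" "r \<delta> \<le> r \<gamma>" | "r \<beta> \<le> r \<gamma>" "r \<beta> \<le> r \<delta>" | "r \<gamma> \<le> r \<delta>" "r \<gamma> \<le> r \<beta>"
      by linarith
    then show ?thesis
    proof cases
      case 1
      interpret residue_data \<alpha> \<beta> \<gamma> \<delta> \<epsilon> "r \<alpha>" "r \<beta>" "r \<gamma>" "r \<delta>" "r \<epsilon>"
        by unfold_locales (use r le sum min pos odd nd 1 in \<open>simp_all add: min_def split: if_splits\<close>)
      show ?thesis
        using hypergeometric_congruence[OF half[unfolded a_def]] by (simp only: a_def b_def c_def d_def e_def)
    next
      case 2
      interpret residue_data \<alpha> \<gamma> \<delta> \<beta> \<epsilon> "r \<alpha>" "r \<gamma>" "r \<delta>" "r \<beta>" "r \<epsilon>"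
        by unfold_locales (use r le sum min pos odd nd 2 in \<open>simp_all add: min_def rotate split: if_splits\<close>)
      have "?L = truncated_hypergeometric [a, a, a / 2 + 1, c, d, b, e]
          [1, a / 2, a - c + 1, a - d + 1, a - b + 1, a - e + 1] 1 (CARD('p) - 1)"
        and "?R = truncated_hypergeometric [1 - e, c, d, b] [1, a - e + 1, c + d + b - a] 1 (CARD('p) - 1)"
        unfolding rotate by (rule truncated_hypergeometric_mset; simp)+
      moreover have "gamma_quotient \<alpha> \<gamma> \<delta> \<beta> = gamma_quotient \<alpha> \<beta> \<gamma> \<delta>"
        by (rule gamma_quotient_rotate)
      ultimately show ?thesis
        using hypergeometric_congruence[OF half[unfolded a_def]] by (simp only: a_def b_def c_def d_def e_def)
    next
      case 3
      interpret residue_data \<alpha> \<delta> \<beta> \<gamma> \<epsilon> "r \<alpha>" "r \<delta>" "r \<beta>" "r \<gamma>" "r \<epsilon>"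
        by unfold_locales (use r le sum min pos odd nd 3 in \<open>simp_all add: min_def rotate split: if_splits\<close>)
      have "?L = truncated_hypergeometric [a, a, a / 2 + 1, d, b, c, e]
          [1, a / 2, a - d + 1, a - b + 1, a - c + 1, a - e + 1] 1 (CARD('p) - 1)"
        and "?R = truncated_hypergeometric [1 - e, d, b, c] [1, a - e + 1, d + b + c - a] 1 (CARD('p) - 1)"
        unfolding rotate by (rule truncated_hypergeometric_mset; simp)+
      moreover have "gamma_quotient \<alpha> \<beta> \<gamma> \<delta> = gamma_quotient \<alpha> \<delta> \<beta> \<gamma>"
        by (rule gamma_quotient_rotate)
      ultimately show ?thesis
        using hypergeometric_congruence[OF half[unfolded a_def]] by (simp only: a_def b_def c_def d_def e_def)
    qed
  qed
  then show ?thesis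
    by (simp only: \<open>p = CARD('p)\<close> gamma_quotient_def r_def)
qed

end
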